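(* Let $A$ be a $\Bbbk$-algebra. For every $A$-anchored Lie algebra $(L,\omega)$, the map $$A^{e}\,\#\,U(L)\to A\odot U(L)\odot A,\qquad (a\otimes b^{o})\otimes u\mapsto a\otimes u\otimes b,$$ is an isomorphism of $A^{e}$-rings. In particular, the functor $\mathsf{AnchLie}_A\to\mathsf{Ring}_{A^e}$, $(L,\omega)\mapsto A\odot U(L)\odot A$ (the Connes-Moscovici bialgebroid construction), is left adjoint to the functor $\mathscr{L}_A:\mathsf{Ring}_{A^e}\to\mathsf{AnchLie}_A$, $\mathscr{L}_A=\mathcal{F}_A\circ\mathcal{L}_{A^e}$.
   Context: $\Bbbk$ is a field of characteristic $0$; algebras are associative and unital, $\otimes=\otimes_\Bbbk$; $A$ is not necessarily commutative. $A^{o}$ is the opposite algebra ($a\in A$ seen in $A^o$ is written $a^o$) and $A^e=A\otimes A^o$. For a $\Bbbk$-algebra $B$, a $B$-ring is a pair $(R,\phi)$ with $R$ a $\Bbbk$-algebra and $\phi:B\to R$ a $\Bbbk$-algebra map; a morphism $(R,\phi)\to(S,\psi)$ is a $\Bbbk$-algebra map $\varphi$ with $\varphi\circ\phi=\psi$. The category is $\mathsf{Ring}_B$. A $B$-anchored Lie algebra is a Lie algebra $L$ over $\Bbbk$ with a Lie algebra morphism $\omega:L\to\mathrm{Der}_\Bbbk(B)$ (the anchor); a morphism $(L,\omega)\to(L',\omega')$ is a Lie algebra morphism $f$ with $\omega'\circ f=\omega$. The category is $\mathsf{AnchLie}_B$. $U(L)$ is the universal enveloping algebra of the Lie algebra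 $L$, a Hopf algebra with comultiplication $\Delta(u)=\sum u_1\otimes u_2$ for which elements of $L$ are primitive. For $(L,\omega)\in\mathsf{AnchLie}_A$, $\omega$ extends to an algebra map $U(L)\to\mathrm{End}_\Bbbk(A)$ making $A$ a $U(L)$-module algebra with $X\cdot a=\omega(X)(a)$ for $X\in L$; $A^e$ is a $U(L)$-module algebra by $u\cdot(a\otimes b^o)=\sum(u_1\cdot a)\otimes(u_2\cdot b)^o$. $A^e\,\#\,U(L)$ is the $A^e$-ring with underlying space $A^e\otimes U(L)$, unit $1\otimes 1$, multiplication $(x\otimes u)(y\otimes v)=\sum x(u_1\cdot y)\otimes u_2v$, and structure map $x\mapsto x\otimes 1$. $A\odot U(L)\odot A$ is the $A^e$-ring with underlying space $A\otimes U(L)\otimes A$, unit $1\otimes1\otimes1$, multiplication $(a\otimes u\otimes b)(a'\otimes v\otimes b')=\sum a(u_1\cdot a')\otimes u_2v\otimes(u_3\cdot b')b$, and structure map $a\otimes b^o\mapsto a\otimes1\otimes b$. A morphism $f$ of $A$-anchored Lie algebras is sent to $\mathrm{id}\otimes U(f)\otimes\mathrm{id}$. For a $\Bbbk$-algebra $B$, the functor $\mathcal{L}_B:\mathsf{Ring}_B\to\mathsf{AnchLie}_B$ sends $(R,\phi)$ to $\{(r,\delta)\in R\times\mathrm{Der}_\Bbbk(B)\mid [r,\phi(b)]=\phi(\delta(b))\ \forall b\in B\}$ with component-wise bracket (commutator brackets) and anchor $(r,\delta)\mapsto\delta$, and a morphism $\varphi$ to $(r,\delta)\mapsto(\varphi(r),\delta)$.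 For $\delta\in\mathrm{Der}_\Bbbk(A)$ let $\delta_\otimes\in\mathrm{Der}_\Bbbk(A^e)$ be given by $\delta_\otimes(a\otimes b^o)=\delta(a)\otimes b^o+a\otimes\delta(b)^o$. The functor $\mathcal{F}_A:\mathsf{AnchLie}_{A^e}\to\mathsf{AnchLie}_A$ sends $(M,\varpi)$ to $\{(X,\delta)\in M\times\mathrm{Der}_\Bbbk(A)\mid\varpi(X)=\delta_\otimes\}$ with component-wise bracket and anchor $(X,\delta)\mapsto\delta$, and a morphism $f$ to $(X,\delta)\mapsto(f(X),\delta)$. *)

theory Defs
  imports "HOL-Algebra.QuotRing" "HOL-Algebra.Module"
begin

text \<open>
  Throughout, the ground field is a \<^locale>\<open>field\<close> \<open>K\<close>, vector spaces are \<^locale>\<open>module\<close>s over \<open>K\<close>,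
  and morphisms are functions on the carrier that are \<^const>\<open>undefined\<close> elsewhere
  (\<^const>\<open>extensional\<close>), so that equality of morphisms is equality of functions and morphisms are
  composed by \<^const>\<open>compose\<close>. As in \<^theory>\<open>HOL-Algebra.Module\<close>, the fields \<open>mult\<close> and \<open>one\<close> of a
  record that is only used as a vector space or as a Lie algebra carry no meaning.
\<close>

section \<open>Algebras\<close>

definition char_zero :: "('k, 'kk) ring_scheme \<Rightarrow> bool" where
  "char_zero K \<longleftrightarrow> (\<forall>n::nat. n > 0 \<longrightarrow> [n] \<cdot>\<^bsub>K\<^esub> \<one>\<^bsub>K\<^esub> \<noteq> \<zero>\<^bsub>K\<^esub>)"

text \<open>The library locale \<^locale>\<open>algebra\<close> is for commutative algebras only.\<close>

locale assoc_algebra = module R M + M: ring M for R (structure) and M (structure) +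
  assumes smult_mult_left:
      "\<lbrakk>c \<in> carrier R; x \<in> carrier M; y \<in> carrier M\<rbrakk> \<Longrightarrow>
       (c \<odot>\<^bsub>M\<^esub> x) \<otimes>\<^bsub>M\<^esub> y = c \<odot>\<^bsub>M\<^esub> (x \<otimes>\<^bsub>M\<^esub> y)"
    and smult_mult_right:
      "\<lbrakk>c \<in> carrier R; x \<in> carrier M; y \<in> carrier M\<rbrakk> \<Longrightarrow>
       x \<otimes>\<^bsub>M\<^esub> (c \<odot>\<^bsub>M\<^esub> y) = c \<odot>\<^bsub>M\<^esub> (x \<otimes>\<^bsub>M\<^esub> y)"

definition lin_hom ::
  "('k, 'kk) ring_scheme \<Rightarrow> ('k, 'm, 'mm) module_scheme \<Rightarrow> ('k, 'n, 'nn) module_scheme \<Rightarrow> ('m \<Rightarrow> 'n) set" where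
  "lin_hom K M N = {f \<in> carrier M \<rightarrow>\<^sub>E carrier N.
     (\<forall>x \<in> carrier M. \<forall>y \<in> carrier M. f (x \<oplus>\<^bsub>M\<^esub> y) = f x \<oplus>\<^bsub>N\<^esub> f y) \<and>
     (\<forall>c \<in> carrier K. \<forall>x \<in> carrier M. f (c \<odot>\<^bsub>M\<^esub> x) = c \<odot>\<^bsub>N\<^esub> f x)}"

definition alg_hom ::
  "('k, 'kk) ring_scheme \<Rightarrow> ('k, 'a, 'aa) module_scheme \<Rightarrow> ('k, 'b, 'bb) module_scheme \<Rightarrow> ('a \<Rightarrow> 'b) set" where
  "alg_hom K A B = lin_hom K A B \<inter> ring_hom A B"

definition opp_alg :: "('k, 'a, 'aa) module_scheme \<Rightarrow> ('k, 'a, 'aa) module_scheme" where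
  "opp_alg A = A\<lparr>mult := \<lambda>x y. y \<otimes>\<^bsub>A\<^esub> x\<rparr>"

definition End_alg :: "('k, 'kk) ring_scheme \<Rightarrow> ('k, 'm, 'mm) module_scheme \<Rightarrow> ('k, 'm \<Rightarrow> 'm) module" where
  "End_alg K M =
     \<lparr>carrier = lin_hom K M M,
      mult = compose (carrier M),
      one = (\<lambda>x\<in>carrier M. x),
      zero = (\<lambda>x\<in>carrier M. \<zero>\<^bsub>M\<^esub>),
      add = (\<lambda>f g. \<lambda>x\<in>carrier M. f x \<oplus>\<^bsub>M\<^esub> g x),
      smult = (\<lambda>c f. \<lambda>x\<in>carrier M. c \<odot>\<^bsub>M\<^esub> f x)\<rparr>"

section \<open>Tensor products\<close>

definition free_module :: "('k, 'kk) ring_scheme \<Rightarrow> 's set \<Rightarrow> ('k, 's \<Rightarrow> 'k) module" where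
  "free_module K S =
     \<lparr>carrier = {f. (\<forall>s\<in>S. f s \<in> carrier K) \<and> (\<forall>s. s \<notin> S \<longrightarrow> f s = \<zero>\<^bsub>K\<^esub>) \<and> finite {s. f s \<noteq> \<zero>\<^bsub>K\<^esub>}},
      mult = undefined,
      one = undefined,
      zero = (\<lambda>_. \<zero>\<^bsub>K\<^esub>),
      add = (\<lambda>f g s. f s \<oplus>\<^bsub>K\<^esub> g s),
      smult = (\<lambda>c f s. c \<otimes>\<^bsub>K\<^esub> f s)\<rparr>"

definition single :: "('k, 'kk) ring_scheme \<Rightarrow> 's \<Rightarrow> ('s \<Rightarrow> 'k)" where
  "single K s = (\<lambda>t. if t = s then \<one>\<^bsub>K\<^esub> else \<zero>\<^bsub>K\<^esub>)"

definition span_module :: "('k, 'kk) ring_scheme \<Rightarrow> ('k, 'm, 'mm) module_scheme \<Rightarrow> 'm set \<Rightarrow> 'm set" where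
  "span_module K M S = \<Inter>{H. submodule H K M \<and> S \<subseteq> H}"

text \<open>Scalar multiplication of cosets, in the style of \<^const>\<open>rcoset_mult\<close>.\<close>

definition coset_smult :: "('k, 'm, 'mm) module_scheme \<Rightarrow> 'm set \<Rightarrow> 'k \<Rightarrow> 'm set \<Rightarrow> 'm set" where
  "coset_smult M H c X = (\<Union>x\<in>X. H +>\<^bsub>M\<^esub> (c \<odot>\<^bsub>M\<^esub> x))"

definition quot_module :: "('k, 'm, 'mm) module_scheme \<Rightarrow> 'm set \<Rightarrow> ('k, 'm set) module" where
  "quot_module M H =
     \<lparr>carrier = a_rcosets\<^bsub>M\<^esub> H,
      mult = undefined,
      one = undefined,
      zero = H,
      add = set_add M,
      smult = coset_smult M H\<rparr>"

type_synonym ('k, 'm, 'n) tens = "('m \<times> 'n \<Rightarrow> 'k) set"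

definition tensor_relations ::
  "('k, 'kk) ring_scheme \<Rightarrow> ('k, 'm, 'mm) module_scheme \<Rightarrow> ('k, 'n, 'nn) module_scheme \<Rightarrow> ('m \<times> 'n \<Rightarrow> 'k) set" where
  "tensor_relations K M N =
    (let F = free_module K (carrier M \<times> carrier N) in
       {single K (x \<oplus>\<^bsub>M\<^esub> x', y) \<ominus>\<^bsub>F\<^esub> (single K (x, y) \<oplus>\<^bsub>F\<^esub> single K (x', y)) | x x' y.
          x \<in> carrier M \<and> x' \<in> carrier M \<and> y \<in> carrier N}
     \<union> {single K (x, y \<oplus>\<^bsub>N\<^esub> y') \<ominus>\<^bsub>F\<^esub> (single K (x, y) \<oplus>\<^bsub>F\<^esub> single K (x, y')) | x y y'.
          x \<in> carrier M \<and> y \<in> carrier N \<and> y' \<in> carrier N}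
     \<union> {single K (c \<odot>\<^bsub>M\<^esub> x, y) \<ominus>\<^bsub>F\<^esub> (c \<odot>\<^bsub>F\<^esub> single K (x, y)) | c x y.
          c \<in> carrier K \<and> x \<in> carrier M \<and> y \<in> carrier N}
     \<union> {single K (x, c \<odot>\<^bsub>N\<^esub> y) \<ominus>\<^bsub>F\<^esub> (c \<odot>\<^bsub>F\<^esub> single K (x, y)) | c x y.
          c \<in> carrier K \<and> x \<in> carrier M \<and> y \<in> carrier N})"

definition tensor_null ::
  "('k, 'kk) ring_scheme \<Rightarrow> ('k, 'm, 'mm) module_scheme \<Rightarrow> ('k, 'n, 'nn) module_scheme \<Rightarrow> ('m \<times> 'n \<Rightarrow> 'k) set" where
  "tensor_null K M N =
     span_module K (free_module K (carrier M \<times> carrier N)) (tensor_relations K M N)"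

definition tensor ::
  "('k, 'kk) ring_scheme \<Rightarrow> ('k, 'm, 'mm) module_scheme \<Rightarrow> ('k, 'n, 'nn) module_scheme
     \<Rightarrow> ('k, ('k, 'm, 'n) tens) module" where
  "tensor K M N = quot_module (free_module K (carrier M \<times> carrier N)) (tensor_null K M N)"

text \<open>The pure tensor of \<open>x\<close> in \<open>M\<close> and \<open>y\<close> in \<open>N\<close>.\<close>

definition pure_tensor ::
  "('k, 'kk) ring_scheme \<Rightarrow> ('k, 'm, 'mm) module_scheme \<Rightarrow> ('k, 'n, 'nn) module_scheme
     \<Rightarrow> 'm \<Rightarrow> 'n \<Rightarrow> ('k, 'm, 'n) tens" where
  "pure_tensor K M N x y = tensor_null K M N +>\<^bsub>free_module K (carrier M \<times> carrier N)\<^esub> single K (x, y)"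

text \<open>
  \<open>tensor_lift K M N P b\<close> is the \<open>K\<close>-linear map from the tensor product of \<open>M\<close> and \<open>N\<close> to \<open>P\<close> induced
  by a \<open>K\<close>-bilinear map \<open>b\<close>. A map given in Sweedler notation by summing \<open>b t\<^sub>1 t\<^sub>2\<close>, for an element
  \<open>t\<close> written as a sum of tensors of \<open>t\<^sub>1\<close> with \<open>t\<^sub>2\<close>, is \<open>tensor_lift K M N P b t\<close>.
\<close>

definition tensor_lift ::
  "('k, 'kk) ring_scheme \<Rightarrow> ('k, 'm, 'mm) module_scheme \<Rightarrow> ('k, 'n, 'nn) module_scheme
     \<Rightarrow> ('k, 'p, 'pp) module_scheme \<Rightarrow> ('m \<Rightarrow> 'n \<Rightarrow> 'p) \<Rightarrow> ('k, 'm, 'n) tens \<Rightarrow> 'p" where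
  "tensor_lift K M N P b = (THE f. f \<in> lin_hom K (tensor K M N) P \<and>
     (\<forall>x \<in> carrier M. \<forall>y \<in> carrier N. f (pure_tensor K M N x y) = b x y))"

definition tensor_alg ::
  "('k, 'kk) ring_scheme \<Rightarrow> ('k, 'a, 'aa) module_scheme \<Rightarrow> ('k, 'b, 'bb) module_scheme
     \<Rightarrow> ('k, ('k, 'a, 'b) tens) module" where
  "tensor_alg K A B = (tensor K A B)
     \<lparr>mult := \<lambda>s t.
        tensor_lift K A B (tensor K A B) (\<lambda>a b.
          tensor_lift K A B (tensor K A B) (\<lambda>a' b'.
            pure_tensor K A B (a \<otimes>\<^bsub>A\<^esub> a') (b \<otimes>\<^bsub>B\<^esub> b')) t) s,
      one := pure_tensor K A B \<one>\<^bsub>A\<^esub> \<one>\<^bsub>B\<^esub>\<rparr>"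

definition env_alg ::
  "('k, 'kk) ring_scheme \<Rightarrow> ('k, 'a, 'aa) module_scheme \<Rightarrow> ('k, ('k, 'a, 'a) tens) module" where
  "env_alg K A = tensor_alg K A (opp_alg A)"

section \<open>Rings over an algebra\<close>

record ('k, 'r, 'b) b_ring = "('k, 'r) module" +
  str :: "'b \<Rightarrow> 'r"

definition is_b_ring ::
  "('k, 'kk) ring_scheme \<Rightarrow> ('k, 'b, 'bb) module_scheme \<Rightarrow> ('k, 'r, 'b) b_ring \<Rightarrow> bool" where
  "is_b_ring K B R \<longleftrightarrow> assoc_algebra K R \<and> str R \<in> alg_hom K B R"

definition b_ring_hom ::
  "('k, 'kk) ring_scheme \<Rightarrow> ('k, 'b, 'bb) module_scheme \<Rightarrow> ('k, 'r, 'b) b_ring \<Rightarrow> ('k, 's, 'b) b_ring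
     \<Rightarrow> ('r \<Rightarrow> 's) set" where
  "b_ring_hom K B R S = {h \<in> alg_hom K R S. \<forall>b \<in> carrier B. h (str R b) = str S b}"

definition b_ring_iso ::
  "('k, 'kk) ring_scheme \<Rightarrow> ('k, 'b, 'bb) module_scheme \<Rightarrow> ('k, 'r, 'b) b_ring \<Rightarrow> ('k, 's, 'b) b_ring
     \<Rightarrow> ('r \<Rightarrow> 's) set" where
  "b_ring_iso K B R S = {h \<in> b_ring_hom K B R S. bij_betw h (carrier R) (carrier S)}"

section \<open>Lie algebras and anchored Lie algebras\<close>

record ('k, 'l) lie = "('k, 'l) module" +
  bracket :: "'l \<Rightarrow> 'l \<Rightarrow> 'l"

locale lie_algebra = module R L for R (structure) and L (structure) +
  assumes bracket_closed:
      "\<lbrakk>x \<in> carrier L; y \<in> carrier L\<rbrakk> \<Longrightarrow> bracket L x y \<in> carrier L"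
    and bracket_add_left:
      "\<lbrakk>x \<in> carrier L; y \<in> carrier L; z \<in> carrier L\<rbrakk> \<Longrightarrow>
       bracket L (x \<oplus>\<^bsub>L\<^esub> y) z = bracket L x z \<oplus>\<^bsub>L\<^esub> bracket L y z"
    and bracket_add_right:
      "\<lbrakk>x \<in> carrier L; y \<in> carrier L; z \<in> carrier L\<rbrakk> \<Longrightarrow>
       bracket L x (y \<oplus>\<^bsub>L\<^esub> z) = bracket L x y \<oplus>\<^bsub>L\<^esub> bracket L x z"
    and bracket_smult_left:
      "\<lbrakk>c \<in> carrier R; x \<in> carrier L; y \<in> carrier L\<rbrakk> \<Longrightarrow>
       bracket L (c \<odot>\<^bsub>L\<^esub> x) y = c \<odot>\<^bsub>L\<^esub> bracket L x y"
    and bracket_smult_right: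
      "\<lbrakk>c \<in> carrier R; x \<in> carrier L; y \<in> carrier L\<rbrakk> \<Longrightarrow>
       bracket L x (c \<odot>\<^bsub>L\<^esub> y) = c \<odot>\<^bsub>L\<^esub> bracket L x y"
    and bracket_self: "x \<in> carrier L \<Longrightarrow> bracket L x x = \<zero>\<^bsub>L\<^esub>"
    and jacobi:
      "\<lbrakk>x \<in> carrier L; y \<in> carrier L; z \<in> carrier L\<rbrakk> \<Longrightarrow>
       bracket L x (bracket L y z) \<oplus>\<^bsub>L\<^esub> bracket L y (bracket L z x) \<oplus>\<^bsub>L\<^esub> bracket L z (bracket L x y) = \<zero>\<^bsub>L\<^esub>"

definition lie_hom ::
  "('k, 'kk) ring_scheme \<Rightarrow> ('k, 'l, 'll) lie_scheme \<Rightarrow> ('k, 'm, 'mm) lie_scheme \<Rightarrow> ('l \<Rightarrow> 'm) set" where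
  "lie_hom K L M = {f \<in> lin_hom K L M.
     \<forall>x \<in> carrier L. \<forall>y \<in> carrier L. f (bracket L x y) = bracket M (f x) (f y)}"

definition Der :: "('k, 'kk) ring_scheme \<Rightarrow> ('k, 'b, 'bb) module_scheme \<Rightarrow> ('k, 'b \<Rightarrow> 'b) lie" where
  "Der K B =
     \<lparr>carrier = {d \<in> lin_hom K B B. \<forall>x \<in> carrier B. \<forall>y \<in> carrier B.
                   d (x \<otimes>\<^bsub>B\<^esub> y) = d x \<otimes>\<^bsub>B\<^esub> y \<oplus>\<^bsub>B\<^esub> x \<otimes>\<^bsub>B\<^esub> d y},
      mult = undefined,
      one = undefined,
      zero = (\<lambda>x\<in>carrier B. \<zero>\<^bsub>B\<^esub>),
      add = (\<lambda>d e. \<lambda>x\<in>carrier B. d x \<oplus>\<^bsub>B\<^esub> e x),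
      smult = (\<lambda>c d. \<lambda>x\<in>carrier B. c \<odot>\<^bsub>B\<^esub> d x),
      bracket = (\<lambda>d e. \<lambda>x\<in>carrier B. d (e x) \<ominus>\<^bsub>B\<^esub> e (d x))\<rparr>"

record ('k, 'l, 'b) anch_lie = "('k, 'l) lie" +
  anchor :: "'l \<Rightarrow> ('b \<Rightarrow> 'b)"

definition is_anch_lie ::
  "('k, 'kk) ring_scheme \<Rightarrow> ('k, 'b, 'bb) module_scheme \<Rightarrow> ('k, 'l, 'b) anch_lie \<Rightarrow> bool" where
  "is_anch_lie K B L \<longleftrightarrow> lie_algebra K L \<and> anchor L \<in> lie_hom K L (Der K B)"

definition anch_hom ::
  "('k, 'kk) ring_scheme \<Rightarrow> ('k, 'l, 'b) anch_lie \<Rightarrow> ('k, 'm, 'b) anch_lie \<Rightarrow> ('l \<Rightarrow> 'm) set" where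
  "anch_hom K L M = {f \<in> lie_hom K L M. \<forall>x \<in> carrier L. anchor M (f x) = anchor L x}"

section \<open>The universal enveloping algebra\<close>

text \<open>
  \<open>U(L)\<close> is presented as the free associative algebra on the set \<open>L\<close> (with basis the words in \<open>L\<close>)
  modulo the two-sided ideal that makes the generators depend linearly on \<open>L\<close> and turns brackets into
  commutators; the linearity relations alone yield the tensor algebra of \<open>L\<close>.
\<close>

definition free_alg :: "('k, 'kk) ring_scheme \<Rightarrow> 's set \<Rightarrow> ('k, 's list \<Rightarrow> 'k) module" where
  "free_alg K S = (free_module K (lists S))
     \<lparr>mult := \<lambda>f g w. \<Oplus>\<^bsub>K\<^esub>i\<in>{..length w}. f (take i w) \<otimes>\<^bsub>K\<^esub> g (drop i w),
      one := single K []\<rparr>"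

definition uea_relations ::
  "('k, 'kk) ring_scheme \<Rightarrow> ('k, 'l, 'll) lie_scheme \<Rightarrow> ('l list \<Rightarrow> 'k) set" where
  "uea_relations K L =
    (let F = free_alg K (carrier L) in
       {single K [x \<oplus>\<^bsub>L\<^esub> y] \<ominus>\<^bsub>F\<^esub> (single K [x] \<oplus>\<^bsub>F\<^esub> single K [y]) | x y.
          x \<in> carrier L \<and> y \<in> carrier L}
     \<union> {single K [c \<odot>\<^bsub>L\<^esub> x] \<ominus>\<^bsub>F\<^esub> (c \<odot>\<^bsub>F\<^esub> single K [x]) | c x.
          c \<in> carrier K \<and> x \<in> carrier L}
     \<union> {single K [bracket L x y] \<ominus>\<^bsub>F\<^esub>
          (single K [x] \<otimes>\<^bsub>F\<^esub> single K [y] \<ominus>\<^bsub>F\<^esub> single K [y] \<otimes>\<^bsub>F\<^esub> single K [x]) | x y.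
          x \<in> carrier L \<and> y \<in> carrier L})"

type_synonym ('k, 'l) env = "('l list \<Rightarrow> 'k) set"

definition uea_ideal ::
  "('k, 'kk) ring_scheme \<Rightarrow> ('k, 'l, 'll) lie_scheme \<Rightarrow> ('l list \<Rightarrow> 'k) set" where
  "uea_ideal K L = Idl\<^bsub>free_alg K (carrier L)\<^esub> (uea_relations K L)"

definition uea :: "('k, 'kk) ring_scheme \<Rightarrow> ('k, 'l, 'll) lie_scheme \<Rightarrow> ('k, ('k, 'l) env) module" where
  "uea K L = ring.extend (free_alg K (carrier L) Quot uea_ideal K L)
     \<lparr>smult = coset_smult (free_alg K (carrier L)) (uea_ideal K L)\<rparr>"

definition uea_gen :: "('k, 'kk) ring_scheme \<Rightarrow> ('k, 'l, 'll) lie_scheme \<Rightarrow> 'l \<Rightarrow> ('k, 'l) env" where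
  "uea_gen K L x = uea_ideal K L +>\<^bsub>free_alg K (carrier L)\<^esub> single K [x]"

text \<open>
  The algebra map from \<open>U(L)\<close> to \<open>S\<close> that extends a Lie algebra morphism from \<open>L\<close> to \<open>S\<close> with its
  commutator bracket.
\<close>

definition uea_lift ::
  "('k, 'kk) ring_scheme \<Rightarrow> ('k, 'l, 'll) lie_scheme \<Rightarrow> ('k, 's, 'ss) module_scheme
     \<Rightarrow> ('l \<Rightarrow> 's) \<Rightarrow> ('k, 'l) env \<Rightarrow> 's" where
  "uea_lift K L S f =
     (THE g. g \<in> alg_hom K (uea K L) S \<and> (\<forall>x \<in> carrier L. g (uea_gen K L x) = f x))"

definition uea_map ::
  "('k, 'kk) ring_scheme \<Rightarrow> ('k, 'l, 'll) lie_scheme \<Rightarrow> ('k, 'm, 'mm) lie_scheme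
     \<Rightarrow> ('l \<Rightarrow> 'm) \<Rightarrow> ('k, 'l) env \<Rightarrow> ('k, 'm) env" where
  "uea_map K L M f = uea_lift K L (uea K M) (\<lambda>x. uea_gen K M (f x))"

definition comult ::
  "('k, 'kk) ring_scheme \<Rightarrow> ('k, 'l, 'll) lie_scheme
     \<Rightarrow> ('k, 'l) env \<Rightarrow> ('k, ('k, 'l) env, ('k, 'l) env) tens" where
  "comult K L =
    (let U = uea K L; T = tensor_alg K U U in
     uea_lift K L T (\<lambda>x. pure_tensor K U U (uea_gen K L x) \<one>\<^bsub>U\<^esub> \<oplus>\<^bsub>T\<^esub> pure_tensor K U U \<one>\<^bsub>U\<^esub> (uea_gen K L x)))"

section \<open>The actions of the enveloping algebra\<close>

definition act ::
  "('k, 'kk) ring_scheme \<Rightarrow> ('k, 'a, 'aa) module_scheme \<Rightarrow> ('k, 'l, 'a) anch_lie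
     \<Rightarrow> ('k, 'l) env \<Rightarrow> 'a \<Rightarrow> 'a" where
  "act K A L = uea_lift K L (End_alg K A) (anchor L)"

definition act_env ::
  "('k, 'kk) ring_scheme \<Rightarrow> ('k, 'a, 'aa) module_scheme \<Rightarrow> ('k, 'l, 'a) anch_lie
     \<Rightarrow> ('k, 'l) env \<Rightarrow> ('k, 'a, 'a) tens \<Rightarrow> ('k, 'a, 'a) tens" where
  "act_env K A L u x =
     tensor_lift K (uea K L) (uea K L) (env_alg K A) (\<lambda>u1 u2.
       tensor_lift K A (opp_alg A) (env_alg K A) (\<lambda>a b.
         pure_tensor K A (opp_alg A) (act K A L u1 a) (act K A L u2 b)) x)
     (comult K L u)"

section \<open>The smash product\<close>

type_synonym ('k, 'l, 'a) smash_elt = "('k, ('k, 'a, 'a) tens, ('k, 'l) env) tens"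

definition smash_space ::
  "('k, 'kk) ring_scheme \<Rightarrow> ('k, 'a, 'aa) module_scheme \<Rightarrow> ('k, 'l, 'a) anch_lie
     \<Rightarrow> ('k, ('k, 'l, 'a) smash_elt) module" where
  "smash_space K A L = tensor K (env_alg K A) (uea K L)"

definition smash_pure ::
  "('k, 'kk) ring_scheme \<Rightarrow> ('k, 'a, 'aa) module_scheme \<Rightarrow> ('k, 'l, 'a) anch_lie
     \<Rightarrow> ('k, 'a, 'a) tens \<Rightarrow> ('k, 'l) env \<Rightarrow> ('k, 'l, 'a) smash_elt" where
  "smash_pure K A L = pure_tensor K (env_alg K A) (uea K L)"

definition smash_mult ::
  "('k, 'kk) ring_scheme \<Rightarrow> ('k, 'a, 'aa) module_scheme \<Rightarrow> ('k, 'l, 'a) anch_lie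
     \<Rightarrow> ('k, 'l, 'a) smash_elt \<Rightarrow> ('k, 'l, 'a) smash_elt \<Rightarrow> ('k, 'l, 'a) smash_elt" where
  "smash_mult K A L s t =
    (let Ae = env_alg K A; U = uea K L; V = smash_space K A L in
     tensor_lift K Ae U V (\<lambda>x u.
       tensor_lift K Ae U V (\<lambda>y v.
         tensor_lift K U U V (\<lambda>u1 u2.
           smash_pure K A L (x \<otimes>\<^bsub>Ae\<^esub> act_env K A L u1 y) (u2 \<otimes>\<^bsub>U\<^esub> v))
         (comult K L u)) t) s)"

definition smash ::
  "('k, 'kk) ring_scheme \<Rightarrow> ('k, 'a, 'aa) module_scheme \<Rightarrow> ('k, 'l, 'a) anch_lie
     \<Rightarrow> ('k, ('k, 'l, 'a) smash_elt, ('k, 'a, 'a) tens) b_ring" where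
  "smash K A L = module.extend
     ((smash_space K A L)
        \<lparr>mult := smash_mult K A L,
         one := smash_pure K A L \<one>\<^bsub>env_alg K A\<^esub> \<one>\<^bsub>uea K L\<^esub>\<rparr>)
     \<lparr>str = \<lambda>x\<in>carrier (env_alg K A). smash_pure K A L x \<one>\<^bsub>uea K L\<^esub>\<rparr>"

section \<open>The Connes-Moscovici construction\<close>

text \<open>The triple tensor product is bracketed to the right.\<close>

type_synonym ('k, 'l, 'a) cm_elt = "('k, 'a, ('k, ('k, 'l) env, 'a) tens) tens"

definition tensor_lift3 ::
  "('k, 'kk) ring_scheme \<Rightarrow> ('k, 'm, 'mm) module_scheme \<Rightarrow> ('k, 'n, 'nn) module_scheme
     \<Rightarrow> ('k, 'o, 'oo) module_scheme \<Rightarrow> ('k, 'p, 'pp) module_scheme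
     \<Rightarrow> ('m \<Rightarrow> 'n \<Rightarrow> 'o \<Rightarrow> 'p) \<Rightarrow> ('k, 'm, ('k, 'n, 'o) tens) tens \<Rightarrow> 'p" where
  "tensor_lift3 K M N Q P b =
     tensor_lift K M (tensor K N Q) P (\<lambda>x. tensor_lift K N Q P (b x))"

definition cm_space ::
  "('k, 'kk) ring_scheme \<Rightarrow> ('k, 'a, 'aa) module_scheme \<Rightarrow> ('k, 'l, 'a) anch_lie
     \<Rightarrow> ('k, ('k, 'l, 'a) cm_elt) module" where
  "cm_space K A L = tensor K A (tensor K (uea K L) A)"

definition cm_pure ::
  "('k, 'kk) ring_scheme \<Rightarrow> ('k, 'a, 'aa) module_scheme \<Rightarrow> ('k, 'l, 'a) anch_lie
     \<Rightarrow> 'a \<Rightarrow> ('k, 'l) env \<Rightarrow> 'a \<Rightarrow> ('k, 'l, 'a) cm_elt" where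
  "cm_pure K A L a u b = pure_tensor K A (tensor K (uea K L) A) a (pure_tensor K (uea K L) A u b)"

text \<open>The iterated comultiplication is computed as \<open>u \<mapsto> u\<^sub>1 \<otimes> \<Delta>(u\<^sub>2)\<close>.\<close>

definition cm_mult ::
  "('k, 'kk) ring_scheme \<Rightarrow> ('k, 'a, 'aa) module_scheme \<Rightarrow> ('k, 'l, 'a) anch_lie
     \<Rightarrow> ('k, 'l, 'a) cm_elt \<Rightarrow> ('k, 'l, 'a) cm_elt \<Rightarrow> ('k, 'l, 'a) cm_elt" where
  "cm_mult K A L s t =
    (let U = uea K L; V = cm_space K A L in
     tensor_lift3 K A U A V (\<lambda>a u b.
       tensor_lift3 K A U A V (\<lambda>a' v b'.
         tensor_lift K U U V (\<lambda>u1 w.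
           tensor_lift K U U V (\<lambda>u2 u3.
             cm_pure K A L (a \<otimes>\<^bsub>A\<^esub> act K A L u1 a') (u2 \<otimes>\<^bsub>U\<^esub> v) (act K A L u3 b' \<otimes>\<^bsub>A\<^esub> b))
           (comult K L w))
         (comult K L u)) t) s)"

definition cm ::
  "('k, 'kk) ring_scheme \<Rightarrow> ('k, 'a, 'aa) module_scheme \<Rightarrow> ('k, 'l, 'a) anch_lie
     \<Rightarrow> ('k, ('k, 'l, 'a) cm_elt, ('k, 'a, 'a) tens) b_ring" where
  "cm K A L = module.extend
     ((cm_space K A L)
        \<lparr>mult := cm_mult K A L,
         one := cm_pure K A L \<one>\<^bsub>A\<^esub> \<one>\<^bsub>uea K L\<^esub> \<one>\<^bsub>A\<^esub>\<rparr>)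
     \<lparr>str = tensor_lift K A (opp_alg A) (cm_space K A L) (\<lambda>a b. cm_pure K A L a \<one>\<^bsub>uea K L\<^esub> b)\<rparr>"

definition cm_map ::
  "('k, 'kk) ring_scheme \<Rightarrow> ('k, 'a, 'aa) module_scheme \<Rightarrow> ('k, 'l, 'a) anch_lie \<Rightarrow> ('k, 'm, 'a) anch_lie
     \<Rightarrow> ('l \<Rightarrow> 'm) \<Rightarrow> ('k, 'l, 'a) cm_elt \<Rightarrow> ('k, 'm, 'a) cm_elt" where
  "cm_map K A L M f = tensor_lift3 K A (uea K L) A (cm_space K A M)
     (\<lambda>a u b. cm_pure K A M a (uea_map K L M f u) b)"

definition smash_to_cm ::
  "('k, 'kk) ring_scheme \<Rightarrow> ('k, 'a, 'aa) module_scheme \<Rightarrow> ('k, 'l, 'a) anch_lie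
     \<Rightarrow> ('k, 'l, 'a) smash_elt \<Rightarrow> ('k, 'l, 'a) cm_elt" where
  "smash_to_cm K A L = tensor_lift K (env_alg K A) (uea K L) (cm_space K A L)
     (\<lambda>x u. tensor_lift K A (opp_alg A) (cm_space K A L) (\<lambda>a b. cm_pure K A L a u b) x)"

section \<open>The right adjoint\<close>

definition L_ring ::
  "('k, 'kk) ring_scheme \<Rightarrow> ('k, 'b, 'bb) module_scheme \<Rightarrow> ('k, 'r, 'b) b_ring
     \<Rightarrow> ('k, 'r \<times> ('b \<Rightarrow> 'b), 'b) anch_lie" where
  "L_ring K B R =
    (let C = {(r, d). r \<in> carrier R \<and> d \<in> carrier (Der K B) \<and>
                (\<forall>b \<in> carrier B. r \<otimes>\<^bsub>R\<^esub> str R b \<ominus>\<^bsub>R\<^esub> str R b \<otimes>\<^bsub>R\<^esub> r = str R (d b))} in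
     \<lparr>carrier = C,
      mult = undefined,
      one = undefined,
      zero = (\<zero>\<^bsub>R\<^esub>, \<zero>\<^bsub>Der K B\<^esub>),
      add = (\<lambda>(r, d) (s, e). (r \<oplus>\<^bsub>R\<^esub> s, d \<oplus>\<^bsub>Der K B\<^esub> e)),
      smult = (\<lambda>c (r, d). (c \<odot>\<^bsub>R\<^esub> r, c \<odot>\<^bsub>Der K B\<^esub> d)),
      bracket = (\<lambda>(r, d) (s, e). (r \<otimes>\<^bsub>R\<^esub> s \<ominus>\<^bsub>R\<^esub> s \<otimes>\<^bsub>R\<^esub> r, bracket (Der K B) d e)),
      anchor = (\<lambda>(r, d)\<in>C. d)\<rparr>)"

definition L_ring_map ::
  "('k, 'kk) ring_scheme \<Rightarrow> ('k, 'b, 'bb) module_scheme \<Rightarrow> ('k, 'r, 'b) b_ring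
     \<Rightarrow> ('r \<Rightarrow> 's) \<Rightarrow> 'r \<times> ('b \<Rightarrow> 'b) \<Rightarrow> 's \<times> ('b \<Rightarrow> 'b)" where
  "L_ring_map K B R h = (\<lambda>(r, d)\<in>carrier (L_ring K B R). (h r, d))"

definition der_tensor ::
  "('k, 'kk) ring_scheme \<Rightarrow> ('k, 'a, 'aa) module_scheme \<Rightarrow> ('a \<Rightarrow> 'a)
     \<Rightarrow> ('k, 'a, 'a) tens \<Rightarrow> ('k, 'a, 'a) tens" where
  "der_tensor K A d = tensor_lift K A (opp_alg A) (env_alg K A)
     (\<lambda>a b. pure_tensor K A (opp_alg A) (d a) b \<oplus>\<^bsub>env_alg K A\<^esub> pure_tensor K A (opp_alg A) a (d b))"

definition F_anch ::
  "('k, 'kk) ring_scheme \<Rightarrow> ('k, 'a, 'aa) module_scheme \<Rightarrow> ('k, 'm, ('k, 'a, 'a) tens) anch_lie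
     \<Rightarrow> ('k, 'm \<times> ('a \<Rightarrow> 'a), 'a) anch_lie" where
  "F_anch K A M =
    (let C = {(x, d). x \<in> carrier M \<and> d \<in> carrier (Der K A) \<and> anchor M x = der_tensor K A d} in
     \<lparr>carrier = C,
      mult = undefined,
      one = undefined,
      zero = (\<zero>\<^bsub>M\<^esub>, \<zero>\<^bsub>Der K A\<^esub>),
      add = (\<lambda>(x, d) (y, e). (x \<oplus>\<^bsub>M\<^esub> y, d \<oplus>\<^bsub>Der K A\<^esub> e)),
      smult = (\<lambda>c (x, d). (c \<odot>\<^bsub>M\<^esub> x, c \<odot>\<^bsub>Der K A\<^esub> d)),
      bracket = (\<lambda>(x, d) (y, e). (bracket M x y, bracket (Der K A) d e)),
      anchor = (\<lambda>(x, d)\<in>C. d)\<rparr>)"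

definition F_anch_map ::
  "('k, 'kk) ring_scheme \<Rightarrow> ('k, 'a, 'aa) module_scheme \<Rightarrow> ('k, 'm, ('k, 'a, 'a) tens) anch_lie
     \<Rightarrow> ('m \<Rightarrow> 'n) \<Rightarrow> 'm \<times> ('a \<Rightarrow> 'a) \<Rightarrow> 'n \<times> ('a \<Rightarrow> 'a)" where
  "F_anch_map K A M f = (\<lambda>(x, d)\<in>carrier (F_anch K A M). (f x, d))"

type_synonym ('k, 'r, 'a) LA_elt =
  "('r \<times> (('k, 'a, 'a) tens \<Rightarrow> ('k, 'a, 'a) tens)) \<times> ('a \<Rightarrow> 'a)"

definition LA ::
  "('k, 'kk) ring_scheme \<Rightarrow> ('k, 'a, 'aa) module_scheme \<Rightarrow> ('k, 'r, ('k, 'a, 'a) tens) b_ring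
     \<Rightarrow> ('k, ('k, 'r, 'a) LA_elt, 'a) anch_lie" where
  "LA K A R = F_anch K A (L_ring K (env_alg K A) R)"

definition LA_map ::
  "('k, 'kk) ring_scheme \<Rightarrow> ('k, 'a, 'aa) module_scheme \<Rightarrow> ('k, 'r, ('k, 'a, 'a) tens) b_ring
     \<Rightarrow> ('r \<Rightarrow> 's) \<Rightarrow> ('k, 'r, 'a) LA_elt \<Rightarrow> ('k, 's, 'a) LA_elt" where
  "LA_map K A R h = F_anch_map K A (L_ring K (env_alg K A) R) (L_ring_map K (env_alg K A) R h)"

section \<open>The adjunction\<close>

definition cm_unit ::
  "('k, 'kk) ring_scheme \<Rightarrow> ('k, 'a, 'aa) module_scheme \<Rightarrow> ('k, 'l, 'a) anch_lie
     \<Rightarrow> 'l \<Rightarrow> ('k, ('k, 'l, 'a) cm_elt, 'a) LA_elt" where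
  "cm_unit K A L = (\<lambda>x\<in>carrier L.
     ((cm_pure K A L \<one>\<^bsub>A\<^esub> (uea_gen K L x) \<one>\<^bsub>A\<^esub>, der_tensor K A (anchor L x)), anchor L x))"

text \<open>
  The adjunction is stated through this hom-set map. It is given explicitly because a natural family
  ranging over objects with different carrier types cannot be existentially quantified in HOL.
\<close>

definition cm_transpose ::
  "('k, 'kk) ring_scheme \<Rightarrow> ('k, 'a, 'aa) module_scheme \<Rightarrow> ('k, 'l, 'a) anch_lie
     \<Rightarrow> (('k, 'l, 'a) cm_elt \<Rightarrow> 'r) \<Rightarrow> 'l \<Rightarrow> ('k, 'r, 'a) LA_elt" where
  "cm_transpose K A L g = compose (carrier L) (LA_map K A (cm K A L) g) (cm_unit K A L)"

end

theory Submission
  imports Defs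
begin

text \<open>
  The smash product carries two structures: multiplication by \<open>A\<^sup>e\<close> on the left factor, and the
  representation \<open>T\<close> of \<open>U(L)\<close> on the tensor product of the representations \<open>A\<^sup>e\<close> and \<open>U(L)\<close>. Its product
  is \<open>(x \<otimes> u) t = x T\<^sub>u(t)\<close>. A representation of \<open>U(L)\<close> is determined by the generators, on which \<open>T\<close> is given
  by the Leibniz rule \<open>T\<^sub>X(y \<otimes> v) = X\<cdot>y \<otimes> v + y \<otimes> X v\<close>; hence associativity, compatibility with the
  Connes-Moscovici product and the universal property all reduce to one check on \<open>X \<in> L\<close>, and
  coassociativity is never used. The ring axioms of \<open>A \<odot> U(L) \<odot> A\<close> are transported along the linear
  isomorphism with the smash product.

  For the adjunction, \<open>a \<otimes> u \<otimes> b = (a \<otimes> 1 \<otimes> b)(1 \<otimes> u \<otimes> 1)\<close> shows that a morphism to an \<open>A\<^sup>e\<close>-ring \<open>(R, \<phi>)\<close> is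
  determined by the images \<open>r\<^sub>X\<close> of \<open>1 \<otimes> X \<otimes> 1\<close>. Conversely, a Lie morphism \<open>X \<mapsto> r\<^sub>X\<close> into \<open>R\<close> extends to a
  morphism as soon as \<open>[r\<^sub>X, \<phi>(y)] = \<phi>(X\<cdot>y)\<close>, and this is what it means for \<open>X\<close> to be sent into \<open>\<L>\<^sub>A(R)\<close>.
\<close>

section \<open>Linear and bilinear maps\<close>

text \<open>Every map out of a tensor product or out of U(L) is a definite description, so a nested
  Sweedler formula says nothing until existence and uniqueness of its map are known. Such formulas
  are not computed term by term: a linear map with the right values on pure tensors is exhibited,
  and uniqueness does the rest (\<open>tensor_lift_apply\<close>).

  The two products split u differently. The smash product splits the first leg of \<Delta>(u) again,
  between the two copies of A, while \<open>cm_mult\<close> splits the second leg, and the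
  isomorphism moves U(L) past the last copy of A. Comparing the formulas directly would mean
  permuting three legs of \<Delta>. Read as representations on (A \<otimes> A) \<otimes> U and A
  \<otimes> (U \<otimes> A), both are fixed by the generators, each of which acts by a sum of three
  terms, one per factor. The sums differ only in the order of their terms, so cocommutativity
  shrinks to commutativity of addition.

  Likewise, that Ae is a module algebra enters only as the fact that a generator acts by the
  derivation \<open>der_tensor\<close>. The same derivation occurs in the right adjoint, which is
  why the unit of the adjunction lands there.\<close>

definition linear_map ::
  "('k, 'kk) ring_scheme \<Rightarrow> ('k, 'm, 'mm) module_scheme \<Rightarrow> ('k, 'n, 'nn) module_scheme \<Rightarrow> ('m \<Rightarrow> 'n) \<Rightarrow> bool" where
  "linear_map K M N f \<longleftrightarrow> f \<in> carrier M \<rightarrow> carrier N \<and>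
     (\<forall>x \<in> carrier M. \<forall>y \<in> carrier M. f (x \<oplus>\<^bsub>M\<^esub> y) = f x \<oplus>\<^bsub>N\<^esub> f y) \<and>
     (\<forall>c \<in> carrier K. \<forall>x \<in> carrier M. f (c \<odot>\<^bsub>M\<^esub> x) = c \<odot>\<^bsub>N\<^esub> f x)"

definition bilinear_map ::
  "('k, 'kk) ring_scheme \<Rightarrow> ('k, 'm, 'mm) module_scheme \<Rightarrow> ('k, 'n, 'nn) module_scheme
     \<Rightarrow> ('k, 'p, 'pp) module_scheme \<Rightarrow> ('m \<Rightarrow> 'n \<Rightarrow> 'p) \<Rightarrow> bool" where
  "bilinear_map K M N P b \<longleftrightarrow>
     (\<forall>x \<in> carrier M. linear_map K N P (b x)) \<and> (\<forall>y \<in> carrier N. linear_map K M P (\<lambda>x. b x y))"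

text \<open>Linearity and the convention of being \<open>undefined\<close> off the carrier are kept
  apart. Intermediate maps are lambda terms, linear but seldom extensional; extensionality is
  restored only where an equation between morphisms is claimed.\<close>

lemma lin_hom_iff: "f \<in> lin_hom K M N \<longleftrightarrow> linear_map K M N f \<and> f \<in> extensional (carrier M)"
  by (auto simp: lin_hom_def linear_map_def PiE_def)

lemma linear_mapI:
  assumes "\<And>x. x \<in> carrier M \<Longrightarrow> f x \<in> carrier N"
    and "\<And>x y. x \<in> carrier M \<Longrightarrow> y \<in> carrier M \<Longrightarrow> f (x \<oplus>\<^bsub>M\<^esub> y) = f x \<oplus>\<^bsub>N\<^esub> f y"
    and "\<And>c x. c \<in> carrier K \<Longrightarrow> x \<in> carrier M \<Longrightarrow> f (c \<odot>\<^bsub>M\<^esub> x) = c \<odot>\<^bsub>N\<^esub> f x"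
  shows "linear_map K M N f"
  using assms by (auto simp: linear_map_def)

lemma linear_map_closed: "linear_map K M N f \<Longrightarrow> x \<in> carrier M \<Longrightarrow> f x \<in> carrier N"
  and linear_map_add:
    "linear_map K M N f \<Longrightarrow> x \<in> carrier M \<Longrightarrow> y \<in> carrier M \<Longrightarrow> f (x \<oplus>\<^bsub>M\<^esub> y) = f x \<oplus>\<^bsub>N\<^esub> f y"
  and linear_map_smult:
    "linear_map K M N f \<Longrightarrow> c \<in> carrier K \<Longrightarrow> x \<in> carrier M \<Longrightarrow> f (c \<odot>\<^bsub>M\<^esub> x) = c \<odot>\<^bsub>N\<^esub> f x"
  by (auto simp: linear_map_def)

lemmas linear_mapD = linear_map_closed linear_map_add linear_map_smult

lemma bilinear_mapI:
  assumes "\<And>x. x \<in> carrier M \<Longrightarrow> linear_map K N P (b x)"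
    and "\<And>y. y \<in> carrier N \<Longrightarrow> linear_map K M P (\<lambda>x. b x y)"
  shows "bilinear_map K M N P b"
  using assms by (auto simp: bilinear_map_def)

lemma bilinear_map_right: "bilinear_map K M N P b \<Longrightarrow> x \<in> carrier M \<Longrightarrow> linear_map K N P (b x)"
  and bilinear_map_left: "bilinear_map K M N P b \<Longrightarrow> y \<in> carrier N \<Longrightarrow> linear_map K M P (\<lambda>x. b x y)"
  by (auto simp: bilinear_map_def)

lemma bilinear_map_closed:
  "bilinear_map K M N P b \<Longrightarrow> x \<in> carrier M \<Longrightarrow> y \<in> carrier N \<Longrightarrow> b x y \<in> carrier P"
  and bilinear_map_add_left:
    "bilinear_map K M N P b \<Longrightarrow> x \<in> carrier M \<Longrightarrow> x' \<in> carrier M \<Longrightarrow> y \<in> carrier N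
      \<Longrightarrow> b (x \<oplus>\<^bsub>M\<^esub> x') y = b x y \<oplus>\<^bsub>P\<^esub> b x' y"
  and bilinear_map_add_right:
    "bilinear_map K M N P b \<Longrightarrow> x \<in> carrier M \<Longrightarrow> y \<in> carrier N \<Longrightarrow> y' \<in> carrier N
      \<Longrightarrow> b x (y \<oplus>\<^bsub>N\<^esub> y') = b x y \<oplus>\<^bsub>P\<^esub> b x y'"
  and bilinear_map_smult_left:
    "bilinear_map K M N P b \<Longrightarrow> c \<in> carrier K \<Longrightarrow> x \<in> carrier M \<Longrightarrow> y \<in> carrier N
      \<Longrightarrow> b (c \<odot>\<^bsub>M\<^esub> x) y = c \<odot>\<^bsub>P\<^esub> b x y"
  and bilinear_map_smult_right:
    "bilinear_map K M N P b \<Longrightarrow> c \<in> carrier K \<Longrightarrow> x \<in> carrier M \<Longrightarrow> y \<in> carrier N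
      \<Longrightarrow> b x (c \<odot>\<^bsub>N\<^esub> y) = c \<odot>\<^bsub>P\<^esub> b x y"
  by (auto simp: bilinear_map_def linear_map_def)

lemmas bilinear_mapD = bilinear_map_closed bilinear_map_add_left bilinear_map_add_right
  bilinear_map_smult_left bilinear_map_smult_right

lemma linear_map_comp:
  "linear_map K M N f \<Longrightarrow> linear_map K N P g \<Longrightarrow> linear_map K M P (\<lambda>x. g (f x))"
  by (auto simp: linear_map_def Pi_iff)

lemma linear_map_id: "linear_map K M M (\<lambda>x. x)"
  by (auto simp: linear_map_def)

lemma linear_map_zero_map:
  assumes "module K N" shows "linear_map K M N (\<lambda>x. \<zero>\<^bsub>N\<^esub>)"
proof -
  interpret N: module K N by fact
  show ?thesis by (auto simp: linear_map_def)
qed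

lemma linear_map_plus:
  assumes "module K N" "linear_map K M N f" "linear_map K M N g"
  shows "linear_map K M N (\<lambda>x. f x \<oplus>\<^bsub>N\<^esub> g x)"
proof -
  interpret N: module K N by fact
  show ?thesis using assms(2,3)
    by (auto intro!: linear_mapI simp: linear_mapD N.smult_r_distr N.M.add.m_ac)
qed

lemma linear_map_scale:
  assumes "module K N" "linear_map K M N f" "c \<in> carrier K"
  shows "linear_map K M N (\<lambda>x. c \<odot>\<^bsub>N\<^esub> f x)"
proof -
  interpret N: module K N by fact
  show ?thesis using assms(2,3)
    by (auto intro!: linear_mapI simp: linear_mapD N.smult_r_distr N.smult_assoc1[symmetric] N.R.m_comm)
qed

lemma linear_map_zero:
  assumes "module K M" "module K N" "linear_map K M N f"
  shows "f \<zero>\<^bsub>M\<^esub> = \<zero>\<^bsub>N\<^esub>"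
proof -
  interpret M: module K M by fact
  interpret N: module K N by fact
  have "f (\<zero>\<^bsub>K\<^esub> \<odot>\<^bsub>M\<^esub> \<zero>\<^bsub>M\<^esub>) = \<zero>\<^bsub>N\<^esub>"
    using assms(3) by (simp add: linear_mapD del: M.smult_l_null M.smult_r_null)
  then show ?thesis by simp
qed

lemma linear_map_uminus:
  assumes "module K M" "module K N" "linear_map K M N f" "x \<in> carrier M"
  shows "f (\<ominus>\<^bsub>M\<^esub> x) = \<ominus>\<^bsub>N\<^esub> f x"
proof -
  interpret M: module K M by fact
  interpret N: module K N by fact
  have "f (\<ominus>\<^bsub>M\<^esub> x) \<oplus>\<^bsub>N\<^esub> f x = f (\<ominus>\<^bsub>M\<^esub> x \<oplus>\<^bsub>M\<^esub> x)"
    using assms(3,4) by (simp add: linear_mapD del: M.M.l_neg)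
  also have "\<dots> = \<zero>\<^bsub>N\<^esub>" using assms by (simp add: M.M.l_neg linear_map_zero)
  finally show ?thesis
    using assms(3,4) by (simp add: linear_mapD N.M.minus_equality)
qed

lemma linear_map_minus:
  assumes "module K M" "module K N" "linear_map K M N f" "x \<in> carrier M" "y \<in> carrier M"
  shows "f (x \<ominus>\<^bsub>M\<^esub> y) = f x \<ominus>\<^bsub>N\<^esub> f y"
proof -
  interpret M: module K M by fact
  show ?thesis using assms by (simp add: a_minus_def linear_mapD linear_map_uminus)
qed

lemma linear_map_cong:
  assumes "linear_map K M N f" "\<And>x. x \<in> carrier M \<Longrightarrow> g x = f x" "module K M"
  shows "linear_map K M N g"
proof -
  interpret M: module K M by fact
  show ?thesis using assms(1,2) by (auto intro!: linear_mapI simp: linear_mapD)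
qed

text \<open>Most bilinear maps below consist of a bilinear core (a pure tensor, a product, an
  action) with linear maps at its inputs and output, so their bilinearity is an instance of
  this.\<close>

lemma bilinear_map_compose:
  assumes "bilinear_map K M N P b" "linear_map K M' M f" "linear_map K N' N g" "linear_map K P P' h"
  shows "bilinear_map K M' N' P' (\<lambda>x y. h (b (f x) (g y)))"
  using assms by (auto intro!: bilinear_mapI linear_mapI simp: linear_mapD bilinear_mapD)

section \<open>Free modules\<close>

lemma free_module_simps:
  "carrier (free_module K S) = {f. (\<forall>s\<in>S. f s \<in> carrier K) \<and> (\<forall>s. s \<notin> S \<longrightarrow> f s = \<zero>\<^bsub>K\<^esub>) \<and> finite {s. f s \<noteq> \<zero>\<^bsub>K\<^esub>}}"
  "zero (free_module K S) = (\<lambda>_. \<zero>\<^bsub>K\<^esub>)"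
  "add (free_module K S) f g = (\<lambda>s. f s \<oplus>\<^bsub>K\<^esub> g s)"
  "smult (free_module K S) c f = (\<lambda>s. c \<otimes>\<^bsub>K\<^esub> f s)"
  by (simp_all add: free_module_def)

lemma free_module_value:
  assumes "cring K" "f \<in> carrier (free_module K S)" shows "f s \<in> carrier K"
proof -
  interpret cring K by fact
  show ?thesis using assms(2) by (cases "s \<in> S") (auto simp: free_module_simps)
qed

lemma free_module_module:
  assumes "cring K" shows "module K (free_module K S)"
proof -
  interpret cring K by fact
  have add: "f \<oplus>\<^bsub>free_module K S\<^esub> g \<in> carrier (free_module K S)"
    if "f \<in> carrier (free_module K S)" "g \<in> carrier (free_module K S)" for f g
  proof -
    have "finite ({s. f s \<noteq> \<zero>\<^bsub>K\<^esub>} \<union> {s. g s \<noteq> \<zero>\<^bsub>K\<^esub>})" using that by (simp add: free_module_simps)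
    moreover have "{s. f s \<oplus>\<^bsub>K\<^esub> g s \<noteq> \<zero>\<^bsub>K\<^esub>} \<subseteq> {s. f s \<noteq> \<zero>\<^bsub>K\<^esub>} \<union> {s. g s \<noteq> \<zero>\<^bsub>K\<^esub>}" by auto
    ultimately have "finite {s. f s \<oplus>\<^bsub>K\<^esub> g s \<noteq> \<zero>\<^bsub>K\<^esub>}" by (rule rev_finite_subset)
    with that show ?thesis by (auto simp: free_module_simps)
  qed
  have smult: "c \<odot>\<^bsub>free_module K S\<^esub> f \<in> carrier (free_module K S)"
    if "c \<in> carrier K" "f \<in> carrier (free_module K S)" for c f
  proof -
    have "finite {s. f s \<noteq> \<zero>\<^bsub>K\<^esub>}" using that by (simp add: free_module_simps)
    moreover have "{s. c \<otimes>\<^bsub>K\<^esub> f s \<noteq> \<zero>\<^bsub>K\<^esub>} \<subseteq> {s. f s \<noteq> \<zero>\<^bsub>K\<^esub>}" using that by auto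
    ultimately have "finite {s. c \<otimes>\<^bsub>K\<^esub> f s \<noteq> \<zero>\<^bsub>K\<^esub>}" by (rule rev_finite_subset)
    with that show ?thesis by (auto simp: free_module_simps)
  qed
  note val = free_module_value[OF assms]
  have "abelian_group (free_module K S)"
  proof (rule abelian_groupI)
    \<comment> \<open>The inverse is taken as -1 times f, so that finiteness of its support is
      already covered by closure under scalars.\<close>
    fix f assume f: "f \<in> carrier (free_module K S)"
    have "(\<ominus>\<^bsub>K\<^esub> \<one>\<^bsub>K\<^esub>) \<odot>\<^bsub>free_module K S\<^esub> f \<oplus>\<^bsub>free_module K S\<^esub> f = \<zero>\<^bsub>free_module K S\<^esub>"
      using val[OF f] by (simp add: free_module_simps(2-) l_minus l_neg)
    with smult[OF _ f] show "\<exists>y \<in> carrier (free_module K S). y \<oplus>\<^bsub>free_module K S\<^esub> f = \<zero>\<^bsub>free_module K S\<^esub>"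
      by (intro bexI[of _ "(\<ominus>\<^bsub>K\<^esub> \<one>\<^bsub>K\<^esub>) \<odot>\<^bsub>free_module K S\<^esub> f"]) auto
  qed (auto simp: add, auto simp: free_module_simps(2-) val a_ac, simp add: free_module_simps)
  then show ?thesis
    by (intro moduleI) (auto simp: assms smult, auto simp: free_module_simps(2-) val l_distr r_distr m_assoc)
qed

lemma single_closed:
  assumes "cring K" "s \<in> S" shows "single K s \<in> carrier (free_module K S)"
proof -
  interpret cring K by fact
  show ?thesis using assms(2) by (auto simp: free_module_simps single_def)
qed

text \<open>Induction over the finite support: erasing the value at one point t removes exactly t
  from it. Since f vanishes off S, t is one of the basis indices.\<close>

lemma free_module_induct [consumes 2, case_names zero single add]:
  assumes "cring K" "f \<in> carrier (free_module K S)"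
    and zero: "Q \<zero>\<^bsub>free_module K S\<^esub>"
    and single: "\<And>c s. c \<in> carrier K \<Longrightarrow> s \<in> S \<Longrightarrow> Q (c \<odot>\<^bsub>free_module K S\<^esub> single K s)"
    and add: "\<And>f g. f \<in> carrier (free_module K S) \<Longrightarrow> g \<in> carrier (free_module K S) \<Longrightarrow> Q f \<Longrightarrow> Q g
      \<Longrightarrow> Q (f \<oplus>\<^bsub>free_module K S\<^esub> g)"
  shows "Q f"
proof -
  interpret cring K by fact
  interpret F: module K "free_module K S" by (rule free_module_module) fact
  have "finite {s. f s \<noteq> \<zero>\<^bsub>K\<^esub>}" using assms(2) by (simp add: free_module_simps)
  then show ?thesis using assms(2)
  proof (induction "{s. f s \<noteq> \<zero>\<^bsub>K\<^esub>}" arbitrary: f rule: finite_induct)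
    case empty
    then have "f = \<zero>\<^bsub>free_module K S\<^esub>" by (auto simp: free_module_simps(2))
    then show ?case using zero by simp
  next
    case (insert t T)
    define g where "g = f(t := \<zero>\<^bsub>K\<^esub>)"
    have T: "T = {s. g s \<noteq> \<zero>\<^bsub>K\<^esub>}" using insert.hyps(2,4) by (auto simp: g_def)
    have t: "t \<in> S" using insert.hyps(4) insert.prems by (auto simp: free_module_simps)
    have g: "g \<in> carrier (free_module K S)"
      using insert.prems \<open>finite T\<close> unfolding T by (auto simp: free_module_simps g_def)
    have v: "f s \<in> carrier K" for s by (rule free_module_value[OF assms(1) insert.prems])
    have "f = f t \<odot>\<^bsub>free_module K S\<^esub> single K t \<oplus>\<^bsub>free_module K S\<^esub> g"
      using v by (auto simp: free_module_simps(3,4) single_def g_def)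
    moreover have "Q (f t \<odot>\<^bsub>free_module K S\<^esub> single K t \<oplus>\<^bsub>free_module K S\<^esub> g)"
      using v t g by (intro add single insert.hyps(3) T) (auto intro: F.smult_closed single_closed is_cring)
    ultimately show ?case by simp
  qed
qed

definition free_lift ::
  "('k, 'kk) ring_scheme \<Rightarrow> ('k, 'p, 'pp) module_scheme \<Rightarrow> ('s \<Rightarrow> 'p) \<Rightarrow> ('s \<Rightarrow> 'k) \<Rightarrow> 'p" where
  "free_lift K P b f = (\<Oplus>\<^bsub>P\<^esub>s\<in>{s. f s \<noteq> \<zero>\<^bsub>K\<^esub>}. f s \<odot>\<^bsub>P\<^esub> b s)"

text \<open>The support of a sum or of a multiple can shrink by cancellation. Summing over a fixed
  finite superset gives all terms of an identity the same range.\<close>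

lemma free_lift_superset:
  assumes "module K P" "b \<in> S \<rightarrow> carrier P" "f \<in> carrier (free_module K S)"
    and "finite T" "T \<subseteq> S" "{s. f s \<noteq> \<zero>\<^bsub>K\<^esub>} \<subseteq> T"
  shows "free_lift K P b f = (\<Oplus>\<^bsub>P\<^esub>s\<in>T. f s \<odot>\<^bsub>P\<^esub> b s)"
proof -
  interpret P: module K P by fact
  note v = free_module_value[OF P.R.is_cring assms(3)]
  show ?thesis unfolding free_lift_def
    by (rule P.M.add.finprod_mono_neutral_cong_left) (use assms v in \<open>auto simp: Pi_iff subset_eq\<close>)
qed

lemma free_lift_linear:
  assumes "module K P" "b \<in> S \<rightarrow> carrier P"
  shows "linear_map K (free_module K S) P (free_lift K P b)"
proof -
  interpret P: module K P by fact
  let ?F = "free_module K S"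
  interpret F: module K ?F by (rule free_module_module) (rule P.R.is_cring)
  note v = free_module_value[OF P.R.is_cring]
  have fin: "finite {s. f s \<noteq> \<zero>\<^bsub>K\<^esub>}" "{s. f s \<noteq> \<zero>\<^bsub>K\<^esub>} \<subseteq> S" if "f \<in> carrier ?F" for f
    using that by (auto simp: free_module_simps)
  have b: "b s \<in> carrier P" if "s \<in> S" for s using assms(2) that by auto
  show ?thesis
  proof (rule linear_mapI)
    fix f g assume f: "f \<in> carrier ?F" and g: "g \<in> carrier ?F"
    let ?T = "{s. f s \<noteq> \<zero>\<^bsub>K\<^esub>} \<union> {s. g s \<noteq> \<zero>\<^bsub>K\<^esub>}"
    have T: "finite ?T" "?T \<subseteq> S" using fin f g by auto
    have "free_lift K P b (f \<oplus>\<^bsub>?F\<^esub> g) = (\<Oplus>\<^bsub>P\<^esub>s\<in>?T. (f \<oplus>\<^bsub>?F\<^esub> g) s \<odot>\<^bsub>P\<^esub> b s)"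
      by (rule free_lift_superset[OF assms F.M.a_closed[OF f g] T]) (auto simp: free_module_simps(3))
    also have "\<dots> = (\<Oplus>\<^bsub>P\<^esub>s\<in>?T. f s \<odot>\<^bsub>P\<^esub> b s \<oplus>\<^bsub>P\<^esub> g s \<odot>\<^bsub>P\<^esub> b s)"
      using v[OF f] v[OF g] b T
      by (intro P.M.finsum_cong') (auto simp: free_module_simps(3) P.smult_l_distr subset_eq)
    also have "\<dots> = (\<Oplus>\<^bsub>P\<^esub>s\<in>?T. f s \<odot>\<^bsub>P\<^esub> b s) \<oplus>\<^bsub>P\<^esub> (\<Oplus>\<^bsub>P\<^esub>s\<in>?T. g s \<odot>\<^bsub>P\<^esub> b s)"
      using v[OF f] v[OF g] b T by (intro P.M.finsum_addf) auto
    also have "\<dots> = free_lift K P b f \<oplus>\<^bsub>P\<^esub> free_lift K P b g"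
      using free_lift_superset[OF assms f T] free_lift_superset[OF assms g T] by simp
    finally show "free_lift K P b (f \<oplus>\<^bsub>?F\<^esub> g) = free_lift K P b f \<oplus>\<^bsub>P\<^esub> free_lift K P b g" .
  next
    fix c f assume c: "c \<in> carrier K" and f: "f \<in> carrier ?F"
    let ?T = "{s. f s \<noteq> \<zero>\<^bsub>K\<^esub>}"
    have "free_lift K P b (c \<odot>\<^bsub>?F\<^esub> f) = (\<Oplus>\<^bsub>P\<^esub>s\<in>?T. (c \<odot>\<^bsub>?F\<^esub> f) s \<odot>\<^bsub>P\<^esub> b s)"
      using c by (intro free_lift_superset[OF assms F.smult_closed[OF c f] fin[OF f]]) (auto simp: free_module_simps(4))
    also have "\<dots> = (\<Oplus>\<^bsub>P\<^esub>s\<in>?T. c \<odot>\<^bsub>P\<^esub> (f s \<odot>\<^bsub>P\<^esub> b s))"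
      using v[OF f] b fin[OF f] c
      by (intro P.M.finsum_cong') (auto simp: free_module_simps(4) P.smult_assoc1 subset_eq)
    also have "\<dots> = c \<odot>\<^bsub>P\<^esub> free_lift K P b f"
      unfolding free_lift_def using v[OF f] b fin[OF f] c
      by (intro P.finsum_smult_ldistr[symmetric]) auto
    finally show "free_lift K P b (c \<odot>\<^bsub>?F\<^esub> f) = c \<odot>\<^bsub>P\<^esub> free_lift K P b f" .
  next
    fix f assume f: "f \<in> carrier ?F"
    show "free_lift K P b f \<in> carrier P"
      unfolding free_lift_def using v[OF f] b fin[OF f] by (intro P.M.finsum_closed) auto
  qed
qed

lemma free_lift_single:
  assumes "module K P" "b \<in> S \<rightarrow> carrier P" "s \<in> S"
  shows "free_lift K P b (single K s) = b s"
proof -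
  interpret P: module K P by fact
  have b: "b s \<in> carrier P" using assms by auto
  have "free_lift K P b (single K s) = (\<Oplus>\<^bsub>P\<^esub>t\<in>{s}. single K s t \<odot>\<^bsub>P\<^esub> b t)"
    using assms by (intro free_lift_superset single_closed P.R.is_cring) (auto simp: single_def)
  also have "\<dots> = b s" using b by (simp add: single_def)
  finally show ?thesis .
qed

lemma linear_map_eq_on_free:
  assumes "cring K" "module K P" "linear_map K (free_module K S) P f" "linear_map K (free_module K S) P g"
    and "\<And>s. s \<in> S \<Longrightarrow> f (single K s) = g (single K s)" "x \<in> carrier (free_module K S)"
  shows "f x = g x"
  using assms(1,6)
proof (induction rule: free_module_induct)
  case zero
  then show ?case using assms by (simp add: linear_map_zero[OF free_module_module[OF assms(1)]])
next
  case (single c s)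
  then show ?case using assms by (simp add: linear_mapD single_closed)
next
  case (add f g)
  then show ?case using assms by (simp add: linear_mapD)
qed

section \<open>Quotient modules\<close>

context
  fixes K :: "('k, 'kk) ring_scheme" and F :: "('k, 'm, 'mm) module_scheme"
    and H :: "'m set" and Q :: "('k, 'm set, 'qq) module_scheme"
  assumes F: "module K F" and H: "submodule H K F"
    and carrier_Q: "carrier Q = a_rcosets\<^bsub>F\<^esub> H" and add_Q: "add Q = set_add F"
    and zero_Q: "zero Q = H" and smult_Q: "smult Q = coset_smult F H"
begin

interpretation F: module K F by (rule F)

interpretation H: abelian_subgroup H F
  using H F.abelian_group_axioms by (intro abelian_subgroupI3) (auto simp: additive_subgroup_def submodule_def)

lemma coset_eq_iff:
  assumes "x \<in> carrier F" "y \<in> carrier F"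
  shows "H +>\<^bsub>F\<^esub> x = H +>\<^bsub>F\<^esub> y \<longleftrightarrow> x \<ominus>\<^bsub>F\<^esub> y \<in> H"
proof
  assume "H +>\<^bsub>F\<^esub> x = H +>\<^bsub>F\<^esub> y"
  then have "x \<in> H +>\<^bsub>F\<^esub> y" using H.a_rcos_self[OF assms(1)] by simp
  then show "x \<ominus>\<^bsub>F\<^esub> y \<in> H" using assms H.a_rcos_module_minus[of y x] F.M.abelian_group_axioms
    by (simp add: H.a_rcos_module_imp a_minus_def)
next
  assume "x \<ominus>\<^bsub>F\<^esub> y \<in> H"
  then have "x \<in> H +>\<^bsub>F\<^esub> y" using assms by (simp add: a_minus_def H.a_rcos_module_rev)
  then show "H +>\<^bsub>F\<^esub> x = H +>\<^bsub>F\<^esub> y" using assms(2) by (metis F.M.a_repr_independence H.a_subgroup)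
qed

text \<open>\<open>coset_smult\<close> is a union over all representatives. H is closed under
  scalars, so every member of the union is the same coset, and a union of equal sets over a nonempty
  index set is that set.\<close>

lemma coset_smult_coset:
  assumes c: "c \<in> carrier K" and x: "x \<in> carrier F"
  shows "coset_smult F H c (H +>\<^bsub>F\<^esub> x) = H +>\<^bsub>F\<^esub> (c \<odot>\<^bsub>F\<^esub> x)"
proof -
  have "H +>\<^bsub>F\<^esub> (c \<odot>\<^bsub>F\<^esub> y) = H +>\<^bsub>F\<^esub> (c \<odot>\<^bsub>F\<^esub> x)" if y: "y \<in> H +>\<^bsub>F\<^esub> x" for y
  proof -
    have yc: "y \<in> carrier F" using H.a_elemrcos_carrier[OF x y] .
    have "y \<ominus>\<^bsub>F\<^esub> x \<in> H" using H.a_rcos_module_imp[OF x y] by (simp add: a_minus_def)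
    then have "c \<odot>\<^bsub>F\<^esub> (y \<ominus>\<^bsub>F\<^esub> x) \<in> H" using H c by (simp add: submodule.smult_closed)
    moreover have "c \<odot>\<^bsub>F\<^esub> (y \<ominus>\<^bsub>F\<^esub> x) = c \<odot>\<^bsub>F\<^esub> y \<ominus>\<^bsub>F\<^esub> c \<odot>\<^bsub>F\<^esub> x"
      using c x yc by (simp add: a_minus_def F.smult_r_distr F.smult_r_minus)
    ultimately show ?thesis using c x yc by (simp add: coset_eq_iff)
  qed
  then have "(\<Union>y\<in>H +>\<^bsub>F\<^esub> x. H +>\<^bsub>F\<^esub> (c \<odot>\<^bsub>F\<^esub> y)) = (\<Union>y\<in>H +>\<^bsub>F\<^esub> x. H +>\<^bsub>F\<^esub> (c \<odot>\<^bsub>F\<^esub> x))"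
    by (intro SUP_cong refl)
  also have "\<dots> = H +>\<^bsub>F\<^esub> (c \<odot>\<^bsub>F\<^esub> x)" using H.a_rcos_self[OF x] by blast
  finally show ?thesis by (simp add: coset_smult_def)
qed

lemma coset_closed: "x \<in> carrier F \<Longrightarrow> H +>\<^bsub>F\<^esub> x \<in> carrier Q"
  by (simp add: carrier_Q F.M.a_rcosetsI H.a_subset)

lemma coset_add:
  "x \<in> carrier F \<Longrightarrow> y \<in> carrier F \<Longrightarrow> H +>\<^bsub>F\<^esub> (x \<oplus>\<^bsub>F\<^esub> y) = (H +>\<^bsub>F\<^esub> x) \<oplus>\<^bsub>Q\<^esub> (H +>\<^bsub>F\<^esub> y)"
  by (simp add: add_Q H.a_rcos_sum)

lemma coset_scale:
  "c \<in> carrier K \<Longrightarrow> x \<in> carrier F \<Longrightarrow> H +>\<^bsub>F\<^esub> (c \<odot>\<^bsub>F\<^esub> x) = c \<odot>\<^bsub>Q\<^esub> (H +>\<^bsub>F\<^esub> x)"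
  by (simp add: smult_Q coset_smult_coset)

lemma coset_zero: "\<zero>\<^bsub>Q\<^esub> = H +>\<^bsub>F\<^esub> \<zero>\<^bsub>F\<^esub>"
  by (simp add: zero_Q F.M.a_coset_add_zero H.a_subset)

lemma coset_cases:
  assumes "X \<in> carrier Q"
  obtains x where "x \<in> carrier F" "X = H +>\<^bsub>F\<^esub> x"
  using assms by (auto simp: carrier_Q A_RCOSETS_def')

text \<open>Q is pinned down only through its carrier, addition, zero and scalars. The result
  therefore serves both the tensor product and the enveloping algebra, whose product is a separate
  field.\<close>

lemma quotient_module: "module K Q"
proof -
  have "abelian_group Q"
  proof (rule abelian_groupI)
    fix X Y assume "X \<in> carrier Q" "Y \<in> carrier Q"
    then obtain x y where "x \<in> carrier F" "X = H +>\<^bsub>F\<^esub> x" "y \<in> carrier F" "Y = H +>\<^bsub>F\<^esub> y"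
      by (metis coset_cases)
    then show "X \<oplus>\<^bsub>Q\<^esub> Y \<in> carrier Q" "X \<oplus>\<^bsub>Q\<^esub> Y = Y \<oplus>\<^bsub>Q\<^esub> X"
      by (simp_all add: coset_add[symmetric] coset_closed F.M.a_comm)
  next
    fix X Y Z assume "X \<in> carrier Q" "Y \<in> carrier Q" "Z \<in> carrier Q"
    then obtain x y z where "x \<in> carrier F" "X = H +>\<^bsub>F\<^esub> x" "y \<in> carrier F" "Y = H +>\<^bsub>F\<^esub> y"
        "z \<in> carrier F" "Z = H +>\<^bsub>F\<^esub> z"
      by (metis coset_cases)
    then show "X \<oplus>\<^bsub>Q\<^esub> Y \<oplus>\<^bsub>Q\<^esub> Z = X \<oplus>\<^bsub>Q\<^esub> (Y \<oplus>\<^bsub>Q\<^esub> Z)"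
      by (simp add: coset_add[symmetric] F.M.a_assoc)
  next
    fix X assume "X \<in> carrier Q"
    then obtain x where x: "x \<in> carrier F" "X = H +>\<^bsub>F\<^esub> x" by (rule coset_cases)
    then show "\<zero>\<^bsub>Q\<^esub> \<oplus>\<^bsub>Q\<^esub> X = X"
      by (simp only: coset_zero coset_add[symmetric] F.M.zero_closed F.M.l_zero)
    from x have "(H +>\<^bsub>F\<^esub> (\<ominus>\<^bsub>F\<^esub> x)) \<oplus>\<^bsub>Q\<^esub> X = \<zero>\<^bsub>Q\<^esub>"
      by (simp only: coset_add[symmetric] F.M.l_neg coset_zero F.M.a_inv_closed)
    then show "\<exists>Y\<in>carrier Q. Y \<oplus>\<^bsub>Q\<^esub> X = \<zero>\<^bsub>Q\<^esub>" using x by (blast intro: coset_closed F.M.a_inv_closed)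
  qed (simp only: coset_zero coset_closed F.M.zero_closed)
  then show ?thesis
  proof (intro moduleI F.R.is_cring)
    fix X assume "X \<in> carrier Q"
    then obtain x where x: "x \<in> carrier F" "X = H +>\<^bsub>F\<^esub> x" by (rule coset_cases)
    then show "\<one>\<^bsub>K\<^esub> \<odot>\<^bsub>Q\<^esub> X = X" by (simp add: coset_scale[symmetric])
    fix a assume a: "a \<in> carrier K"
    then show "a \<odot>\<^bsub>Q\<^esub> X \<in> carrier Q" using x by (simp add: coset_scale[symmetric] coset_closed)
    {
      fix Y assume "Y \<in> carrier Q"
      then obtain y where "y \<in> carrier F" "Y = H +>\<^bsub>F\<^esub> y" by (rule coset_cases)
      then show "a \<odot>\<^bsub>Q\<^esub> (X \<oplus>\<^bsub>Q\<^esub> Y) = a \<odot>\<^bsub>Q\<^esub> X \<oplus>\<^bsub>Q\<^esub> a \<odot>\<^bsub>Q\<^esub> Y"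
        using x a by (simp add: coset_add[symmetric] coset_scale[symmetric] F.smult_r_distr)
    }
    fix b assume "b \<in> carrier K"
    then show "(a \<oplus>\<^bsub>K\<^esub> b) \<odot>\<^bsub>Q\<^esub> X = a \<odot>\<^bsub>Q\<^esub> X \<oplus>\<^bsub>Q\<^esub> b \<odot>\<^bsub>Q\<^esub> X"
      "a \<otimes>\<^bsub>K\<^esub> b \<odot>\<^bsub>Q\<^esub> X = a \<odot>\<^bsub>Q\<^esub> (b \<odot>\<^bsub>Q\<^esub> X)"
      using x a by (simp_all add: coset_add[symmetric] coset_scale[symmetric] F.smult_l_distr F.smult_assoc1)
  qed
qed

lemma coset_linear: "linear_map K F Q (\<lambda>x. H +>\<^bsub>F\<^esub> x)"
  by (intro linear_mapI) (simp_all add: coset_closed coset_add coset_scale)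

text \<open>The map is defined through a chosen representative; two choices differ by an element of
  H, which f kills, so the choice does not affect the value.\<close>

lemma quotient_lift:
  assumes P: "module K P" and f: "linear_map K F P f" and "\<And>x. x \<in> H \<Longrightarrow> f x = \<zero>\<^bsub>P\<^esub>"
  shows "\<exists>g \<in> lin_hom K Q P. \<forall>x \<in> carrier F. g (H +>\<^bsub>F\<^esub> x) = f x"
proof -
  interpret P: module K P by fact
  define g where "g = (\<lambda>X\<in>carrier Q. f (SOME x. x \<in> carrier F \<and> X = H +>\<^bsub>F\<^esub> x))"
  have g: "g (H +>\<^bsub>F\<^esub> x) = f x" if x: "x \<in> carrier F" for x
  proof -
    define y where "y = (SOME y. y \<in> carrier F \<and> H +>\<^bsub>F\<^esub> x = H +>\<^bsub>F\<^esub> y)"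
    have y: "y \<in> carrier F" "H +>\<^bsub>F\<^esub> x = H +>\<^bsub>F\<^esub> y"
      unfolding y_def using x by (metis (mono_tags, lifting) someI_ex)+
    then have "f (x \<ominus>\<^bsub>F\<^esub> y) = \<zero>\<^bsub>P\<^esub>" using x assms(3) coset_eq_iff by simp
    then have "f x \<ominus>\<^bsub>P\<^esub> f y = \<zero>\<^bsub>P\<^esub>" using x y linear_map_minus[OF F P f] by simp
    then have "f x = f y"
      using linear_map_closed[OF f x] linear_map_closed[OF f y(1)]
      by (metis P.M.minus_equality P.M.minus_minus P.M.a_inv_closed a_minus_def)
    then show ?thesis using x by (simp add: g_def coset_closed y_def)
  qed
  have "linear_map K Q P g"
    by (intro linear_mapI)
      (auto elim!: coset_cases simp: g coset_add[symmetric] coset_scale[symmetric] linear_mapD[OF f])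
  then show ?thesis using g by (intro bexI[of _ g]) (auto simp: lin_hom_iff g_def)
qed

end

section \<open>Tensor products\<close>

text \<open>To be combined with \<open>span_module_minimal\<close>: a linear map that kills the
  defining relations of a tensor product kills their whole span.\<close>

lemma kernel_submodule:
  assumes "module K M" "module K N" "linear_map K M N f"
  shows "submodule {x \<in> carrier M. f x = \<zero>\<^bsub>N\<^esub>} K M"
proof -
  interpret M: module K M by fact
  interpret N: module K N by fact
  show ?thesis
    by (rule M.submoduleI)
      (auto simp: linear_map_zero[OF assms] linear_map_uminus[OF assms] linear_mapD(2,3)[OF assms(3)])
qed

lemma span_module_submodule:
  assumes "module K M" "S \<subseteq> carrier M"
  shows "submodule (span_module K M S) K M"
proof -
  interpret M: module K M by fact
  let ?C = "{H. submodule H K M \<and> S \<subseteq> H}"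
  \<comment> \<open>The family must have a member inside the module: the intersection of an empty
    family would be the whole type.\<close>
  have C: "carrier M \<in> ?C" using assms(2) M.carrier_is_submodule by simp
  show ?thesis unfolding span_module_def
  proof (rule M.submoduleI)
    show "\<Inter>?C \<subseteq> carrier M" using C by blast
    show "\<zero>\<^bsub>M\<^esub> \<in> \<Inter>?C"
      by (auto simp: submodule_def dest: subgroup.one_closed)
  qed (auto dest: M.submoduleE)
qed

lemma span_module_superset: "S \<subseteq> span_module K M S"
  by (auto simp: span_module_def)

lemma span_module_minimal: "submodule H K M \<Longrightarrow> S \<subseteq> H \<Longrightarrow> span_module K M S \<subseteq> H"
  by (auto simp: span_module_def)

section \<open>The tensor product and its universal property\<close>

context
  fixes K :: "('k, 'kk) ring_scheme"
    and M :: "('k, 'm, 'mm) module_scheme" and N :: "('k, 'n, 'nn) module_scheme"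
  assumes M: "module K M" and N: "module K N"
begin

interpretation M: module K M by (rule M)
interpretation N: module K N by (rule N)

abbreviation (input) free_pairs where "free_pairs \<equiv> free_module K (carrier M \<times> carrier N)"

lemma free_pairs_module: "module K free_pairs"
  by (rule free_module_module) (rule M.R.is_cring)

interpretation F: module K free_pairs by (rule free_pairs_module)

lemma single_pair: "x \<in> carrier M \<Longrightarrow> y \<in> carrier N \<Longrightarrow> single K (x, y) \<in> carrier free_pairs"
  by (simp add: single_closed M.R.is_cring)

lemma tensor_relations_carrier: "tensor_relations K M N \<subseteq> carrier free_pairs"
  unfolding tensor_relations_def Let_def
  by (auto intro!: F.M.minus_closed F.M.a_closed F.smult_closed single_pair)

lemma tensor_null_submodule: "submodule (tensor_null K M N) K free_pairs"
  unfolding tensor_null_def by (rule span_module_submodule[OF free_pairs_module tensor_relations_carrier])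

lemma tensor_relation_null: "r \<in> tensor_relations K M N \<Longrightarrow> r \<in> tensor_null K M N"
  unfolding tensor_null_def by (rule subsetD[OF span_module_superset])

lemma tensor_quot_simps:
  "carrier (tensor K M N) = a_rcosets\<^bsub>free_pairs\<^esub> (tensor_null K M N)"
  "add (tensor K M N) = set_add free_pairs"
  "zero (tensor K M N) = tensor_null K M N"
  "smult (tensor K M N) = coset_smult free_pairs (tensor_null K M N)"
  by (simp_all add: tensor_def quot_module_def)

lemmas tensor_quot = free_pairs_module tensor_null_submodule tensor_quot_simps

lemma tensor_module: "module K (tensor K M N)"
  by (rule quotient_module[OF tensor_quot])

interpretation T: module K "tensor K M N" by (rule tensor_module)

lemma pure_tensor_closed:
  "x \<in> carrier M \<Longrightarrow> y \<in> carrier N \<Longrightarrow> pure_tensor K M N x y \<in> carrier (tensor K M N)"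
  unfolding pure_tensor_def by (intro coset_closed[OF tensor_quot] single_pair)

text \<open>Each of the four laws is one family of \<open>tensor_relations\<close>, read as an
  equality of cosets.\<close>

lemma pure_tensor_bilinear: "bilinear_map K M N (tensor K M N) (pure_tensor K M N)"
proof -
  have eq: "tensor_null K M N +>\<^bsub>free_pairs\<^esub> f = tensor_null K M N +>\<^bsub>free_pairs\<^esub> g"
    if "f \<ominus>\<^bsub>free_pairs\<^esub> g \<in> tensor_relations K M N" "f \<in> carrier free_pairs" "g \<in> carrier free_pairs" for f g
    using that by (simp add: coset_eq_iff[OF tensor_quot] tensor_relation_null)
  show ?thesis
  proof (intro bilinear_mapI linear_mapI pure_tensor_closed)
    fix x x' y assume A: "x \<in> carrier M" "x' \<in> carrier M" "y \<in> carrier N"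
    have "single K (x \<oplus>\<^bsub>M\<^esub> x', y) \<ominus>\<^bsub>free_pairs\<^esub> (single K (x, y) \<oplus>\<^bsub>free_pairs\<^esub> single K (x', y)) \<in> tensor_relations K M N"
      unfolding tensor_relations_def Let_def using A by blast
    then show "pure_tensor K M N (x \<oplus>\<^bsub>M\<^esub> x') y =
        pure_tensor K M N x y \<oplus>\<^bsub>tensor K M N\<^esub> pure_tensor K M N x' y"
      unfolding pure_tensor_def coset_add[OF tensor_quot single_pair[OF A(1,3)] single_pair[OF A(2,3)], symmetric]
      using A by (intro eq single_pair F.M.a_closed M.M.a_closed)
  next
    fix x y y' assume A: "x \<in> carrier M" "y \<in> carrier N" "y' \<in> carrier N"
    have "single K (x, y \<oplus>\<^bsub>N\<^esub> y') \<ominus>\<^bsub>free_pairs\<^esub> (single K (x, y) \<oplus>\<^bsub>free_pairs\<^esub> single K (x, y')) \<in> tensor_relations K M N"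
      unfolding tensor_relations_def Let_def using A by blast
    then show "pure_tensor K M N x (y \<oplus>\<^bsub>N\<^esub> y') =
        pure_tensor K M N x y \<oplus>\<^bsub>tensor K M N\<^esub> pure_tensor K M N x y'"
      unfolding pure_tensor_def coset_add[OF tensor_quot single_pair[OF A(1,2)] single_pair[OF A(1,3)], symmetric]
      using A by (intro eq single_pair F.M.a_closed N.M.a_closed)
  next
    fix c x y assume A: "c \<in> carrier K" "x \<in> carrier M" "y \<in> carrier N"
    have "single K (c \<odot>\<^bsub>M\<^esub> x, y) \<ominus>\<^bsub>free_pairs\<^esub> (c \<odot>\<^bsub>free_pairs\<^esub> single K (x, y)) \<in> tensor_relations K M N"
      "single K (x, c \<odot>\<^bsub>N\<^esub> y) \<ominus>\<^bsub>free_pairs\<^esub> (c \<odot>\<^bsub>free_pairs\<^esub> single K (x, y)) \<in> tensor_relations K M N"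
      unfolding tensor_relations_def Let_def using A by blast+
    then show "pure_tensor K M N (c \<odot>\<^bsub>M\<^esub> x) y = c \<odot>\<^bsub>tensor K M N\<^esub> pure_tensor K M N x y"
      "pure_tensor K M N x (c \<odot>\<^bsub>N\<^esub> y) = c \<odot>\<^bsub>tensor K M N\<^esub> pure_tensor K M N x y"
      unfolding pure_tensor_def coset_scale[OF tensor_quot A(1) single_pair[OF A(2,3)], symmetric]
      using A by - (intro eq single_pair F.smult_closed M.smult_closed N.smult_closed; assumption)+
  qed
qed

text \<open>There is no case for scalars or for zero: a multiple of a pure tensor is pure because
  the scalar moves into the left factor, and zero is the pure tensor of two zeros.\<close>

lemma tensor_induct [consumes 1, case_names pure add]:
  assumes "t \<in> carrier (tensor K M N)"
    and pure: "\<And>x y. x \<in> carrier M \<Longrightarrow> y \<in> carrier N \<Longrightarrow> Q (pure_tensor K M N x y)"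
    and add: "\<And>s t. s \<in> carrier (tensor K M N) \<Longrightarrow> t \<in> carrier (tensor K M N) \<Longrightarrow> Q s \<Longrightarrow> Q t
      \<Longrightarrow> Q (s \<oplus>\<^bsub>tensor K M N\<^esub> t)"
  shows "Q t"
proof -
  obtain f where f: "f \<in> carrier free_pairs" and t: "t = tensor_null K M N +>\<^bsub>free_pairs\<^esub> f"
    by (rule coset_cases[OF tensor_quot assms(1)])
  note b = pure_tensor_bilinear
  from M.R.is_cring f have "Q (tensor_null K M N +>\<^bsub>free_pairs\<^esub> f)"
  proof (induction rule: free_module_induct)
    case zero
    have "pure_tensor K M N \<zero>\<^bsub>M\<^esub> \<zero>\<^bsub>N\<^esub> = \<zero>\<^bsub>tensor K M N\<^esub>"
      by (rule linear_map_zero[OF N tensor_module bilinear_map_right[OF b]]) simp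
    with pure[of "\<zero>\<^bsub>M\<^esub>" "\<zero>\<^bsub>N\<^esub>"] show ?case by (simp only: coset_zero[OF tensor_quot] M.M.zero_closed N.M.zero_closed)
  next
    case (single c s)
    obtain x y where s: "s = (x, y)" "x \<in> carrier M" "y \<in> carrier N" using single(2) by auto
    with single(1) have "tensor_null K M N +>\<^bsub>free_pairs\<^esub> (c \<odot>\<^bsub>free_pairs\<^esub> single K s) = pure_tensor K M N (c \<odot>\<^bsub>M\<^esub> x) y"
      by (simp add: coset_scale[OF tensor_quot] single_pair bilinear_mapD[OF b])
        (simp add: pure_tensor_def)
    then show ?case using pure[of "c \<odot>\<^bsub>M\<^esub> x" y] s single(1) by simp
  next
    case (add f g)
    then show ?case by (simp add: coset_add[OF tensor_quot] coset_closed[OF tensor_quot] assms(3))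
  qed
  then show ?thesis by (simp add: t)
qed

lemma linear_map_eq_on_tensor:
  assumes "linear_map K (tensor K M N) P f" "linear_map K (tensor K M N) P g"
    and "\<And>x y. x \<in> carrier M \<Longrightarrow> y \<in> carrier N \<Longrightarrow> f (pure_tensor K M N x y) = g (pure_tensor K M N x y)"
    and "t \<in> carrier (tensor K M N)"
  shows "f t = g t"
  using assms(4) by (induction rule: tensor_induct) (simp_all add: assms(3) linear_mapD[OF assms(1)] linear_mapD[OF assms(2)])

text \<open>The linear extension of b to the free module on pairs sends every relation to zero,
  precisely by bilinearity, and so descends to the quotient.\<close>

lemma tensor_lift_exists:
  assumes P: "module K P" and b: "bilinear_map K M N P b"
  shows "\<exists>f \<in> lin_hom K (tensor K M N) P. \<forall>x \<in> carrier M. \<forall>y \<in> carrier N. f (pure_tensor K M N x y) = b x y"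
proof -
  interpret P: module K P by fact
  define h where "h = free_lift K P (\<lambda>(x, y). b x y)"
  have c: "(\<lambda>(x, y). b x y) \<in> carrier M \<times> carrier N \<rightarrow> carrier P" by (auto intro: bilinear_map_closed[OF b])
  have h: "linear_map K free_pairs P h" unfolding h_def by (rule free_lift_linear[OF P c])
  have hs: "h (single K (x, y)) = b x y" if "x \<in> carrier M" "y \<in> carrier N" for x y
    unfolding h_def using that by (subst free_lift_single[OF P c]) auto
  have "tensor_relations K M N \<subseteq> {f \<in> carrier free_pairs. h f = \<zero>\<^bsub>P\<^esub>}"
  proof
    fix r assume r: "r \<in> tensor_relations K M N"
    have diff: "x \<ominus>\<^bsub>P\<^esub> x = \<zero>\<^bsub>P\<^esub>" if "x \<in> carrier P" for x using that by (simp add: a_minus_def P.M.r_neg)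
    from r have "h r = \<zero>\<^bsub>P\<^esub>"
      unfolding tensor_relations_def Let_def
      by (auto simp: linear_map_minus[OF free_pairs_module P h] linear_mapD[OF h] single_pair hs bilinear_mapD[OF b]
          diff)
    with r tensor_relations_carrier show "r \<in> {f \<in> carrier free_pairs. h f = \<zero>\<^bsub>P\<^esub>}" by blast
  qed
  then have "tensor_null K M N \<subseteq> {f \<in> carrier free_pairs. h f = \<zero>\<^bsub>P\<^esub>}"
    unfolding tensor_null_def by (rule span_module_minimal[OF kernel_submodule[OF free_pairs_module P h]])
  then have "\<exists>g \<in> lin_hom K (tensor K M N) P. \<forall>f \<in> carrier free_pairs. g (tensor_null K M N +>\<^bsub>free_pairs\<^esub> f) = h f"
    by (intro quotient_lift[OF tensor_quot P h]) auto
  then obtain g where "g \<in> lin_hom K (tensor K M N) P" "\<forall>f \<in> carrier free_pairs. g (tensor_null K M N +>\<^bsub>free_pairs\<^esub> f) = h f" ..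
  then show ?thesis
    by (intro bexI[of _ g]) (auto simp: pure_tensor_def single_pair hs)
qed

lemma tensor_lift_eq:
  assumes "f \<in> lin_hom K (tensor K M N) P"
    and "\<And>x y. x \<in> carrier M \<Longrightarrow> y \<in> carrier N \<Longrightarrow> f (pure_tensor K M N x y) = b x y"
  shows "tensor_lift K M N P b = f"
  unfolding tensor_lift_def
proof (rule the_equality)
  fix g assume g: "g \<in> lin_hom K (tensor K M N) P \<and>
     (\<forall>x\<in>carrier M. \<forall>y\<in>carrier N. g (pure_tensor K M N x y) = b x y)"
  show "g = f"
  proof (rule extensionalityI)
    fix t assume "t \<in> carrier (tensor K M N)"
    then show "g t = f t"
      using g assms by (intro linear_map_eq_on_tensor[of P g f t]) (auto simp: lin_hom_iff)
  qed (use g assms in \<open>auto simp: lin_hom_iff\<close>)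
qed (use assms in auto)

text \<open>The device by which nested lifts are evaluated: a linear map that agrees with b on pure
  tensors must be the lift, so it is enough to name the map that the lift ought to be.\<close>

lemma tensor_lift_apply:
  assumes "linear_map K (tensor K M N) P f"
    and "\<And>x y. x \<in> carrier M \<Longrightarrow> y \<in> carrier N \<Longrightarrow> f (pure_tensor K M N x y) = b x y"
    and "t \<in> carrier (tensor K M N)"
  shows "tensor_lift K M N P b t = f t"
proof -
  have "tensor_lift K M N P b = (\<lambda>t\<in>carrier (tensor K M N). f t)"
    using assms(1,2)
    by (intro tensor_lift_eq)
      (auto simp: lin_hom_iff pure_tensor_closed intro!: linear_map_cong[OF assms(1) _ tensor_module])
  with assms(3) show ?thesis by simp
qed

context
  fixes P :: "('k, 'p, 'pp) module_scheme" and b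
  assumes P: "module K P" and b: "bilinear_map K M N P b"
begin

lemma tensor_lift_spec:
  "tensor_lift K M N P b \<in> lin_hom K (tensor K M N) P \<and>
   (\<forall>x \<in> carrier M. \<forall>y \<in> carrier N. tensor_lift K M N P b (pure_tensor K M N x y) = b x y)"
proof -
  obtain f where "f \<in> lin_hom K (tensor K M N) P"
    and "\<forall>x \<in> carrier M. \<forall>y \<in> carrier N. f (pure_tensor K M N x y) = b x y"
    using tensor_lift_exists[OF P b] by blast
  moreover from this have "tensor_lift K M N P b = f" by (intro tensor_lift_eq) auto
  ultimately show ?thesis by simp
qed

lemma tensor_lift_hom: "tensor_lift K M N P b \<in> lin_hom K (tensor K M N) P"
  using tensor_lift_spec by simp

lemma tensor_lift_pure:
  "x \<in> carrier M \<Longrightarrow> y \<in> carrier N \<Longrightarrow> tensor_lift K M N P b (pure_tensor K M N x y) = b x y"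
  using tensor_lift_spec by simp

lemma tensor_lift_linear: "linear_map K (tensor K M N) P (tensor_lift K M N P b)"
  using tensor_lift_hom by (simp add: lin_hom_iff)

end

text \<open>The defining description inspects b only on the carriers, so the integrand of a Sweedler
  sum may be rewritten under the assumption that its arguments are carrier elements.\<close>

lemma tensor_lift_cong:
  assumes "\<And>x y. x \<in> carrier M \<Longrightarrow> y \<in> carrier N \<Longrightarrow> b x y = b' x y"
  shows "tensor_lift K M N P b = tensor_lift K M N P b'"
proof -
  have "(\<forall>x \<in> carrier M. \<forall>y \<in> carrier N. f (pure_tensor K M N x y) = b x y) \<longleftrightarrow>
        (\<forall>x \<in> carrier M. \<forall>y \<in> carrier N. f (pure_tensor K M N x y) = b' x y)" for f
    using assms by (intro ball_cong refl) simp
  then show ?thesis unfolding tensor_lift_def by simp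
qed

text \<open>By uniqueness of lifts: the sum of the lifts for s and s' is linear and has the pure
  values of the lift for the sum, and similarly for multiples. This yields linearity in the argument
  that sits inside an inner lift.\<close>

lemma tensor_lift_linear_param:
  assumes P: "module K P" and "module K S" and t: "t \<in> carrier (tensor K M N)"
    and b: "\<And>s. s \<in> carrier S \<Longrightarrow> bilinear_map K M N P (b s)"
    and lin: "\<And>x y. x \<in> carrier M \<Longrightarrow> y \<in> carrier N \<Longrightarrow> linear_map K S P (\<lambda>s. b s x y)"
  shows "linear_map K S P (\<lambda>s. tensor_lift K M N P (b s) t)"
proof -
  interpret P: module K P by fact
  interpret S: module K S by fact
  note L = tensor_lift_linear[OF P b]
  show ?thesis
  proof (rule linear_mapI)
    fix s s' assume s: "s \<in> carrier S" "s' \<in> carrier S"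
    have "tensor_lift K M N P (b (s \<oplus>\<^bsub>S\<^esub> s')) t =
        (\<lambda>t. tensor_lift K M N P (b s) t \<oplus>\<^bsub>P\<^esub> tensor_lift K M N P (b s') t) t"
      using s t
      by (intro tensor_lift_apply linear_map_plus[OF P L L]) (auto simp: tensor_lift_pure[OF P b] linear_mapD[OF lin])
    then show "tensor_lift K M N P (b (s \<oplus>\<^bsub>S\<^esub> s')) t =
        tensor_lift K M N P (b s) t \<oplus>\<^bsub>P\<^esub> tensor_lift K M N P (b s') t" .
  next
    fix c s assume c: "c \<in> carrier K" and s: "s \<in> carrier S"
    have "tensor_lift K M N P (b (c \<odot>\<^bsub>S\<^esub> s)) t = (\<lambda>t. c \<odot>\<^bsub>P\<^esub> tensor_lift K M N P (b s) t) t"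
      using s t c
      by (intro tensor_lift_apply linear_map_scale[OF P L]) (auto simp: tensor_lift_pure[OF P b] linear_mapD[OF lin])
    then show "tensor_lift K M N P (b (c \<odot>\<^bsub>S\<^esub> s)) t = c \<odot>\<^bsub>P\<^esub> tensor_lift K M N P (b s) t" .
  qed (use t in \<open>auto intro: linear_map_closed[OF L]\<close>)
qed

end

section \<open>Associative algebras\<close>

text \<open>The module axioms are insensitive to the product and to additional fields. This covers
  the records made from another one by changing its product, such as opposite, tensor, smash and
  Connes-Moscovici algebras.\<close>

lemma module_cong:
  assumes "module K M" "carrier M' = carrier M" "add M' = add M" "zero M' = zero M" "smult M' = smult M"
  shows "module K M'"
proof -
  interpret M: module K M by fact
  have "abelian_group M'"
    by (rule abelian_groupI) (use M.M.add.l_inv_ex in \<open>auto simp: assms(2-) M.M.a_ac\<close>)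
  then show ?thesis
    by (intro moduleI M.R.is_cring) (simp_all add: assms(2-) M.smult_l_distr M.smult_r_distr M.smult_assoc1)
qed

lemma assoc_algebraI:
  assumes "module K M" "bilinear_map K M M M (mult M)" "\<one>\<^bsub>M\<^esub> \<in> carrier M"
    and "\<And>x y z. x \<in> carrier M \<Longrightarrow> y \<in> carrier M \<Longrightarrow> z \<in> carrier M
      \<Longrightarrow> (x \<otimes>\<^bsub>M\<^esub> y) \<otimes>\<^bsub>M\<^esub> z = x \<otimes>\<^bsub>M\<^esub> (y \<otimes>\<^bsub>M\<^esub> z)"
    and "\<And>x. x \<in> carrier M \<Longrightarrow> \<one>\<^bsub>M\<^esub> \<otimes>\<^bsub>M\<^esub> x = x"
    and "\<And>x. x \<in> carrier M \<Longrightarrow> x \<otimes>\<^bsub>M\<^esub> \<one>\<^bsub>M\<^esub> = x"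
  shows "assoc_algebra K M"
proof -
  interpret M: module K M by fact
  note b = bilinear_mapD[OF assms(2)]
  have "ring M"
    by (intro ringI M.M.abelian_group_axioms monoidI) (simp_all add: b assms(3-))
  then show ?thesis
    by (intro assoc_algebra.intro assms(1) assoc_algebra_axioms.intro) (simp_all add: b)
qed

lemma assoc_algebra_module: "assoc_algebra K A \<Longrightarrow> module K A"
  by (simp add: assoc_algebra_def)

lemma mult_bilinear:
  assumes "assoc_algebra K A" shows "bilinear_map K A A A (mult A)"
proof -
  interpret A: assoc_algebra K A by fact
  show ?thesis
    by (auto intro!: bilinear_mapI linear_mapI simp: A.M.l_distr A.M.r_distr A.smult_mult_left A.smult_mult_right)
qed

lemma alg_hom_iff:
  "f \<in> alg_hom K A B \<longleftrightarrow> linear_map K A B f \<and> f \<in> extensional (carrier A) \<and> f \<one>\<^bsub>A\<^esub> = \<one>\<^bsub>B\<^esub> \<and>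
     (\<forall>x \<in> carrier A. \<forall>y \<in> carrier A. f (x \<otimes>\<^bsub>A\<^esub> y) = f x \<otimes>\<^bsub>B\<^esub> f y)"
  by (auto simp: alg_hom_def lin_hom_iff ring_hom_def linear_map_def)

lemma alg_hom_linear: "f \<in> alg_hom K A B \<Longrightarrow> linear_map K A B f"
  and alg_hom_closed: "f \<in> alg_hom K A B \<Longrightarrow> x \<in> carrier A \<Longrightarrow> f x \<in> carrier B"
  and alg_hom_one: "f \<in> alg_hom K A B \<Longrightarrow> f \<one>\<^bsub>A\<^esub> = \<one>\<^bsub>B\<^esub>"
  and alg_hom_mult:
    "f \<in> alg_hom K A B \<Longrightarrow> x \<in> carrier A \<Longrightarrow> y \<in> carrier A \<Longrightarrow> f (x \<otimes>\<^bsub>A\<^esub> y) = f x \<otimes>\<^bsub>B\<^esub> f y"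
  and alg_hom_add:
    "f \<in> alg_hom K A B \<Longrightarrow> x \<in> carrier A \<Longrightarrow> y \<in> carrier A \<Longrightarrow> f (x \<oplus>\<^bsub>A\<^esub> y) = f x \<oplus>\<^bsub>B\<^esub> f y"
  and alg_hom_smult:
    "f \<in> alg_hom K A B \<Longrightarrow> c \<in> carrier K \<Longrightarrow> x \<in> carrier A \<Longrightarrow> f (c \<odot>\<^bsub>A\<^esub> x) = c \<odot>\<^bsub>B\<^esub> f x"
  and alg_hom_extensional: "f \<in> alg_hom K A B \<Longrightarrow> f \<in> extensional (carrier A)"
  by (auto simp: alg_hom_iff linear_map_def)

lemmas alg_homD = alg_hom_closed alg_hom_one alg_hom_mult alg_hom_add alg_hom_smult

lemma alg_hom_compose:
  assumes "assoc_algebra K A" "f \<in> alg_hom K A B" "g \<in> alg_hom K B C"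
  shows "compose (carrier A) g f \<in> alg_hom K A C"
proof -
  interpret A: assoc_algebra K A by fact
  note [simp] = alg_homD[OF assms(2)] alg_homD[OF assms(3)]
  show ?thesis unfolding alg_hom_iff
    by (auto intro!: linear_mapI simp: compose_eq)
qed

lemma opp_alg_simps [simp]:
  "carrier (opp_alg A) = carrier A" "add (opp_alg A) = add A" "zero (opp_alg A) = zero A"
  "smult (opp_alg A) = smult A" "one (opp_alg A) = one A" "mult (opp_alg A) x y = mult A y x"
  by (simp_all add: opp_alg_def)

lemma opp_alg_assoc_algebra:
  assumes "assoc_algebra K A" shows "assoc_algebra K (opp_alg A)"
proof -
  interpret A: assoc_algebra K A by fact
  show ?thesis
  proof (rule assoc_algebraI)
    show "module K (opp_alg A)" by (rule module_cong[OF A.module_axioms]) simp_all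
  qed (auto intro!: bilinear_mapI linear_mapI
      simp: A.M.l_distr A.M.r_distr A.smult_mult_left A.smult_mult_right A.M.m_assoc)
qed

lemma End_alg_simps:
  "carrier (End_alg K M) = lin_hom K M M" "one (End_alg K M) = (\<lambda>x\<in>carrier M. x)"
  "zero (End_alg K M) = (\<lambda>x\<in>carrier M. \<zero>\<^bsub>M\<^esub>)" "mult (End_alg K M) f g = compose (carrier M) f g"
  "add (End_alg K M) f g = (\<lambda>x\<in>carrier M. f x \<oplus>\<^bsub>M\<^esub> g x)"
  "smult (End_alg K M) c f = (\<lambda>x\<in>carrier M. c \<odot>\<^bsub>M\<^esub> f x)"
  by (simp_all add: End_alg_def)

lemma restrict_lin_hom:
  assumes "module K M" "linear_map K M N f"
  shows "(\<lambda>x\<in>carrier M. f x) \<in> lin_hom K M N"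
  by (auto simp: lin_hom_iff intro: linear_map_cong[OF assms(2) _ assms(1)])

lemma lin_hom_eqI:
  assumes "f \<in> lin_hom K M N" "g \<in> lin_hom K M N" "\<And>x. x \<in> carrier M \<Longrightarrow> f x = g x"
  shows "f = g"
  using assms by (intro extensionalityI[of f "carrier M" g]) (auto simp: lin_hom_iff)

lemma End_alg_assoc_algebra:
  assumes "module K M" shows "assoc_algebra K (End_alg K M)"
proof -
  interpret M: module K M by fact
  let ?E = "End_alg K M"
  note lin = restrict_lin_hom[OF assms]
  have L: "linear_map K M M f" if "f \<in> carrier ?E" for f using that by (simp add: End_alg_simps lin_hom_iff)
  have cl: "f x \<in> carrier M" if "f \<in> carrier ?E" "x \<in> carrier M" for f x using linear_map_closed[OF L] that by blast
  have add: "f \<oplus>\<^bsub>?E\<^esub> g \<in> carrier ?E" if "f \<in> carrier ?E" "g \<in> carrier ?E" for f g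
    unfolding End_alg_simps by (rule lin[OF linear_map_plus[OF assms L[OF that(1)] L[OF that(2)]]])
  have smult: "c \<odot>\<^bsub>?E\<^esub> f \<in> carrier ?E" if "c \<in> carrier K" "f \<in> carrier ?E" for c f
    unfolding End_alg_simps by (rule lin[OF linear_map_scale[OF assms L[OF that(2)] that(1)]])
  have mult: "f \<otimes>\<^bsub>?E\<^esub> g \<in> carrier ?E" if "f \<in> carrier ?E" "g \<in> carrier ?E" for f g
    unfolding End_alg_simps compose_def by (rule lin[OF linear_map_comp[OF L[OF that(2)] L[OF that(1)]]])
  have one: "\<one>\<^bsub>?E\<^esub> \<in> carrier ?E" unfolding End_alg_simps by (rule lin[OF linear_map_id])
  have zero: "\<zero>\<^bsub>?E\<^esub> \<in> carrier ?E" unfolding End_alg_simps by (rule lin[OF linear_map_zero_map[OF assms]])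
  \<comment> \<open>Elements are extensional, so each algebra axiom reduces to an identity of values
    on \<open>carrier M\<close>.\<close>
  have eqI: "f = g" if "f \<in> carrier ?E" "g \<in> carrier ?E" "\<And>x. x \<in> carrier M \<Longrightarrow> f x = g x" for f g
    using that unfolding End_alg_simps by (rule lin_hom_eqI)
  note ap = End_alg_simps(2-)
  have "abelian_group ?E"
  proof (rule abelian_groupI)
    fix f assume f: "f \<in> carrier ?E"
    have "(\<ominus>\<^bsub>K\<^esub> \<one>\<^bsub>K\<^esub>) \<odot>\<^bsub>?E\<^esub> f \<oplus>\<^bsub>?E\<^esub> f = \<zero>\<^bsub>?E\<^esub>"
      by (rule eqI) (use f in \<open>simp_all add: add smult zero\<close>,
          simp add: ap cl M.smult_l_minus M.M.l_neg)
    with smult[OF _ f] show "\<exists>y \<in> carrier ?E. y \<oplus>\<^bsub>?E\<^esub> f = \<zero>\<^bsub>?E\<^esub>"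
      by (intro bexI[of _ "(\<ominus>\<^bsub>K\<^esub> \<one>\<^bsub>K\<^esub>) \<odot>\<^bsub>?E\<^esub> f"]) auto
  qed (auto simp: add zero intro!: eqI, auto simp: ap cl M.M.a_ac)
  then have "module K ?E"
    by (intro moduleI M.R.is_cring)
      (auto simp: add smult intro!: eqI, auto simp: ap cl M.smult_l_distr M.smult_r_distr M.smult_assoc1)
  moreover have "bilinear_map K ?E ?E ?E (mult ?E)"
    by (intro bilinear_mapI linear_mapI)
      (auto simp: mult add smult intro!: eqI, auto simp: ap compose_eq cl linear_mapD[OF L])
  ultimately show ?thesis
    by (rule assoc_algebraI) (auto simp: mult one intro!: eqI, auto simp: ap compose_eq cl)
qed

section \<open>Tensor products of bilinear maps\<close>

text \<open>A linear map may be pulled out of a Sweedler sum.\<close>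

lemma tensor_lift_comp:
  assumes "module K M" "module K N" "module K P" "bilinear_map K M N P b" "linear_map K P P' h"
    and "t \<in> carrier (tensor K M N)"
  shows "tensor_lift K M N P' (\<lambda>x y. h (b x y)) t = h (tensor_lift K M N P b t)"
  by (rule tensor_lift_apply[OF assms(1,2) linear_map_comp[OF tensor_lift_linear[OF assms(1-4)] assms(5)]])
    (simp_all add: assms tensor_lift_pure)

section \<open>The pairing of two tensor products induced by two bilinear maps\<close>

context
  fixes K :: "('k, 'kk) ring_scheme"
    and M :: "('k, 'm, 'mm) module_scheme" and N :: "('k, 'n, 'nn) module_scheme"
    and M' :: "('k, 'm2, 'mm2) module_scheme" and N' :: "('k, 'n2, 'nn2) module_scheme"
    and P :: "('k, 'p, 'pp) module_scheme" and Q :: "('k, 'q, 'qq) module_scheme"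
    and b c
  assumes MN: "module K M" "module K N" and MN': "module K M'" "module K N'" and PQ: "module K P" "module K Q"
    and b: "bilinear_map K M M' P b" and c: "bilinear_map K N N' Q c"
begin

abbreviation (input) "pair_pure x y \<equiv> \<lambda>x' y'. pure_tensor K P Q (b x x') (c y y')"

lemmas PQ_module = tensor_module[OF PQ]

lemma pair_pure_bilinear_right:
  "x \<in> carrier M \<Longrightarrow> y \<in> carrier N \<Longrightarrow> bilinear_map K M' N' (tensor K P Q) (pair_pure x y)"
  by (rule bilinear_map_compose[OF pure_tensor_bilinear[OF PQ] bilinear_map_right[OF b]
        bilinear_map_right[OF c] linear_map_id])

lemma pair_pure_bilinear_left:
  "x' \<in> carrier M' \<Longrightarrow> y' \<in> carrier N' \<Longrightarrow> bilinear_map K M N (tensor K P Q) (\<lambda>x y. pair_pure x y x' y')"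
  by (rule bilinear_map_compose[OF pure_tensor_bilinear[OF PQ] bilinear_map_left[OF b]
        bilinear_map_left[OF c] linear_map_id])

lemma pair_lift_bilinear:
  assumes "t \<in> carrier (tensor K M' N')"
  shows "bilinear_map K M N (tensor K P Q) (\<lambda>x y. tensor_lift K M' N' (tensor K P Q) (pair_pure x y) t)"
proof (rule bilinear_mapI)
  fix x assume x: "x \<in> carrier M"
  show "linear_map K N (tensor K P Q) (\<lambda>y. tensor_lift K M' N' (tensor K P Q) (pair_pure x y) t)"
    by (rule tensor_lift_linear_param[OF MN' PQ_module MN(2) assms])
      (auto intro: x pair_pure_bilinear_right bilinear_map_right[OF pair_pure_bilinear_left])
next
  fix y assume y: "y \<in> carrier N"
  show "linear_map K M (tensor K P Q) (\<lambda>x. tensor_lift K M' N' (tensor K P Q) (pair_pure x y) t)"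
    by (rule tensor_lift_linear_param[OF MN' PQ_module MN(1) assms])
      (auto intro: y pair_pure_bilinear_right bilinear_map_left[OF pair_pure_bilinear_left])
qed

lemma tensor_pairing_pure:
  "x \<in> carrier M \<Longrightarrow> y \<in> carrier N \<Longrightarrow> x' \<in> carrier M' \<Longrightarrow> y' \<in> carrier N' \<Longrightarrow>
   tensor_lift K M N (tensor K P Q) (\<lambda>x y. tensor_lift K M' N' (tensor K P Q) (pair_pure x y)
     (pure_tensor K M' N' x' y')) (pure_tensor K M N x y) = pair_pure x y x' y'"
  by (simp add: tensor_lift_pure[OF MN PQ_module] pair_lift_bilinear pure_tensor_closed[OF MN']
      tensor_lift_pure[OF MN' PQ_module] pair_pure_bilinear_right)

text \<open>One construction with two uses. With the products of A and B for b and c it is the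
  product of \<open>tensor_alg\<close>; with two representations it is the action of U \<otimes> U
  on M \<otimes> N, from which \<open>tensor_act\<close> is obtained through \<Delta>.\<close>

lemma tensor_pairing_bilinear:
  "bilinear_map K (tensor K M N) (tensor K M' N') (tensor K P Q)
     (\<lambda>s t. tensor_lift K M N (tensor K P Q) (\<lambda>x y. tensor_lift K M' N' (tensor K P Q) (pair_pure x y) t) s)"
proof (rule bilinear_mapI)
  fix t assume t: "t \<in> carrier (tensor K M' N')"
  show "linear_map K (tensor K M N) (tensor K P Q)
      (\<lambda>s. tensor_lift K M N (tensor K P Q) (\<lambda>x y. tensor_lift K M' N' (tensor K P Q) (pair_pure x y) t) s)"
    by (rule tensor_lift_linear[OF MN PQ_module pair_lift_bilinear[OF t]])
next
  fix s assume s: "s \<in> carrier (tensor K M N)"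
  show "linear_map K (tensor K M' N') (tensor K P Q)
      (\<lambda>t. tensor_lift K M N (tensor K P Q) (\<lambda>x y. tensor_lift K M' N' (tensor K P Q) (pair_pure x y) t) s)"
    by (rule tensor_lift_linear_param[OF MN PQ_module tensor_module[OF MN'] s])
      (auto intro: pair_lift_bilinear tensor_lift_linear[OF MN' PQ_module] pair_pure_bilinear_right)
qed

end

section \<open>A bilinear action on the left factor of a tensor product\<close>

context
  fixes K :: "('k, 'kk) ring_scheme"
    and X :: "('k, 'x, 'xx) module_scheme" and M :: "('k, 'm, 'mm) module_scheme"
    and N :: "('k, 'n, 'nn) module_scheme" and P :: "('k, 'p, 'pp) module_scheme" and b
  assumes X: "module K X" and M: "module K M" and N: "module K N" and P: "module K P"
    and b: "bilinear_map K X M P b"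
begin

lemma left_factor_bilinear:
  "x \<in> carrier X \<Longrightarrow> bilinear_map K M N (tensor K P N) (\<lambda>m n. pure_tensor K P N (b x m) n)"
  by (rule bilinear_map_compose[OF pure_tensor_bilinear[OF P N] bilinear_map_right[OF b] linear_map_id linear_map_id])

lemma left_factor_action_pure:
  "x \<in> carrier X \<Longrightarrow> m \<in> carrier M \<Longrightarrow> n \<in> carrier N \<Longrightarrow>
   tensor_lift K M N (tensor K P N) (\<lambda>m n. pure_tensor K P N (b x m) n) (pure_tensor K M N m n) =
   pure_tensor K P N (b x m) n"
  by (simp add: tensor_lift_pure[OF M N tensor_module[OF P N] left_factor_bilinear])

lemma left_factor_action_bilinear:
  "bilinear_map K X (tensor K M N) (tensor K P N)
     (\<lambda>x. tensor_lift K M N (tensor K P N) (\<lambda>m n. pure_tensor K P N (b x m) n))"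
proof (rule bilinear_mapI)
  fix x assume "x \<in> carrier X"
  then show "linear_map K (tensor K M N) (tensor K P N)
      (tensor_lift K M N (tensor K P N) (\<lambda>m n. pure_tensor K P N (b x m) n))"
    by (rule tensor_lift_linear[OF M N tensor_module[OF P N] left_factor_bilinear])
next
  fix t assume t: "t \<in> carrier (tensor K M N)"
  show "linear_map K X (tensor K P N) (\<lambda>x. tensor_lift K M N (tensor K P N) (\<lambda>m n. pure_tensor K P N (b x m) n) t)"
  proof (rule tensor_lift_linear_param[OF M N tensor_module[OF P N] X t left_factor_bilinear])
    fix m n assume "m \<in> carrier M" "n \<in> carrier N"
    then show "linear_map K X (tensor K P N) (\<lambda>x. pure_tensor K P N (b x m) n)"
      by (intro linear_map_comp[OF bilinear_map_left[OF b] bilinear_map_left[OF pure_tensor_bilinear[OF P N]]])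
  qed
qed

end

section \<open>Tensor products of algebras\<close>

lemma tensor_alg_simps:
  "carrier (tensor_alg K A B) = carrier (tensor K A B)" "add (tensor_alg K A B) = add (tensor K A B)"
  "zero (tensor_alg K A B) = zero (tensor K A B)" "smult (tensor_alg K A B) = smult (tensor K A B)"
  "one (tensor_alg K A B) = pure_tensor K A B \<one>\<^bsub>A\<^esub> \<one>\<^bsub>B\<^esub>"
  by (simp_all add: tensor_alg_def)

context
  fixes K :: "('k, 'kk) ring_scheme"
    and A :: "('k, 'a, 'aa) module_scheme" and B :: "('k, 'b, 'bb) module_scheme"
  assumes A: "assoc_algebra K A" and B: "assoc_algebra K B"
begin

interpretation A: assoc_algebra K A by (rule A)
interpretation B: assoc_algebra K B by (rule B)

lemmas AB = A.module_axioms B.module_axioms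

interpretation T: module K "tensor K A B" by (rule tensor_module[OF AB])

lemma tensor_mult_pure:
  "a \<in> carrier A \<Longrightarrow> b \<in> carrier B \<Longrightarrow> a' \<in> carrier A \<Longrightarrow> b' \<in> carrier B \<Longrightarrow>
   pure_tensor K A B a b \<otimes>\<^bsub>tensor_alg K A B\<^esub> pure_tensor K A B a' b' =
   pure_tensor K A B (a \<otimes>\<^bsub>A\<^esub> a') (b \<otimes>\<^bsub>B\<^esub> b')"
  using tensor_pairing_pure[OF AB AB AB mult_bilinear[OF A] mult_bilinear[OF B]] by (simp add: tensor_alg_def)

lemma tensor_mult_bilinear:
  "bilinear_map K (tensor K A B) (tensor K A B) (tensor K A B) (mult (tensor_alg K A B))"
  using tensor_pairing_bilinear[OF AB AB AB mult_bilinear[OF A] mult_bilinear[OF B]] by (simp add: tensor_alg_def)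

lemma tensor_alg_assoc_algebra: "assoc_algebra K (tensor_alg K A B)"
proof (rule assoc_algebraI)
  show "module K (tensor_alg K A B)" by (rule module_cong[OF T.module_axioms]) (simp_all add: tensor_alg_simps)
  show "bilinear_map K (tensor_alg K A B) (tensor_alg K A B) (tensor_alg K A B) (mult (tensor_alg K A B))"
    using tensor_mult_bilinear by (simp add: bilinear_map_def linear_map_def tensor_alg_simps)
  note b = bilinear_mapD[OF tensor_mult_bilinear] pure_tensor_closed[OF AB]
  fix r assume r: "r \<in> carrier (tensor_alg K A B)"
  show "\<one>\<^bsub>tensor_alg K A B\<^esub> \<otimes>\<^bsub>tensor_alg K A B\<^esub> r = r"
    using r unfolding tensor_alg_simps
    by (induction rule: tensor_induct[OF AB, consumes 1, case_names pure add]) (simp_all add: b tensor_mult_pure)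
  show "r \<otimes>\<^bsub>tensor_alg K A B\<^esub> \<one>\<^bsub>tensor_alg K A B\<^esub> = r"
    using r unfolding tensor_alg_simps
    by (induction rule: tensor_induct[OF AB, consumes 1, case_names pure add]) (simp_all add: b tensor_mult_pure)
  fix s t assume s: "s \<in> carrier (tensor_alg K A B)" and t: "t \<in> carrier (tensor_alg K A B)"
  show "(r \<otimes>\<^bsub>tensor_alg K A B\<^esub> s) \<otimes>\<^bsub>tensor_alg K A B\<^esub> t = r \<otimes>\<^bsub>tensor_alg K A B\<^esub> (s \<otimes>\<^bsub>tensor_alg K A B\<^esub> t)"
    using r unfolding tensor_alg_simps(1)
  proof (induction rule: tensor_induct[OF AB, consumes 1, case_names pure add])
    case r: (pure x y)
    show ?case using s unfolding tensor_alg_simps(1)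
    proof (induction rule: tensor_induct[OF AB, consumes 1, case_names pure add])
      case s: (pure x' y')
      show ?case using t unfolding tensor_alg_simps(1)
        by (induction rule: tensor_induct[OF AB, consumes 1, case_names pure add]) (use r s in \<open>simp_all add: b tensor_mult_pure A.M.m_assoc B.M.m_assoc\<close>)
    next
      case (add p q)
      then show ?case using r t by (simp add: b tensor_alg_simps(1))
    qed
  next
    case (add p q)
    then show ?case using s t by (simp add: b tensor_alg_simps(1))
  qed
qed (simp add: tensor_alg_simps pure_tensor_closed[OF AB])

end

section \<open>Free algebras\<close>

lemma free_alg_simps:
  "carrier (free_alg K S) = carrier (free_module K (lists S))" "add (free_alg K S) = add (free_module K (lists S))"
  "zero (free_alg K S) = zero (free_module K (lists S))" "smult (free_alg K S) = smult (free_module K (lists S))"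
  "one (free_alg K S) = single K []"
  "mult (free_alg K S) f g = (\<lambda>w. \<Oplus>\<^bsub>K\<^esub>i\<in>{..length w}. f (take i w) \<otimes>\<^bsub>K\<^esub> g (drop i w))"
  by (simp_all add: free_alg_def)

context
  fixes K :: "('k, 'kk) ring_scheme" and S :: "'s set"
  assumes K: "cring K"
begin

interpretation K: cring K by (rule K)

lemma free_alg_module: "module K (free_alg K S)"
  by (rule module_cong[OF free_module_module[OF K]]) (simp_all add: free_alg_simps)

interpretation F: module K "free_alg K S" by (rule free_alg_module)

lemma free_alg_value: "f \<in> carrier (free_alg K S) \<Longrightarrow> f w \<in> carrier K"
  unfolding free_alg_simps by (rule free_module_value[OF K])

text \<open>A word in the support of the product is a concatenation of a word in the support of f
  with one in the support of g. This bounds the support by a finite set and also keeps it inside the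
  words over S.\<close>

lemma free_alg_mult_closed:
  assumes f: "f \<in> carrier (free_alg K S)" and g: "g \<in> carrier (free_alg K S)"
  shows "f \<otimes>\<^bsub>free_alg K S\<^esub> g \<in> carrier (free_alg K S)"
proof -
  let ?h = "f \<otimes>\<^bsub>free_alg K S\<^esub> g"
  note v = free_alg_value[OF f] free_alg_value[OF g]
  \<comment> \<open>If no cut of w had both values nonzero, every term of the convolution at w would
    vanish.\<close>
  have split: "\<exists>v u. w = v @ u \<and> f v \<noteq> \<zero>\<^bsub>K\<^esub> \<and> g u \<noteq> \<zero>\<^bsub>K\<^esub>" if w: "?h w \<noteq> \<zero>\<^bsub>K\<^esub>" for w
  proof (rule ccontr)
    assume *: "\<not> ?thesis"
    have "f (take i w) \<otimes>\<^bsub>K\<^esub> g (drop i w) = \<zero>\<^bsub>K\<^esub>" for i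
    proof (cases "f (take i w) = \<zero>\<^bsub>K\<^esub>")
      case False
      with * have "g (drop i w) = \<zero>\<^bsub>K\<^esub>" by (metis append_take_drop_id)
      then show ?thesis by (simp add: v)
    qed (simp add: v)
    then have "?h w = \<zero>\<^bsub>K\<^esub>" by (simp add: free_alg_simps)
    with w show False by simp
  qed
  have "{w. ?h w \<noteq> \<zero>\<^bsub>K\<^esub>} \<subseteq> (\<lambda>(v, u). v @ u) ` ({v. f v \<noteq> \<zero>\<^bsub>K\<^esub>} \<times> {u. g u \<noteq> \<zero>\<^bsub>K\<^esub>})"
    using split by fast
  moreover have "finite ({v. f v \<noteq> \<zero>\<^bsub>K\<^esub>} \<times> {u. g u \<noteq> \<zero>\<^bsub>K\<^esub>})"
    using f g by (simp add: free_alg_simps free_module_simps)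
  ultimately have "finite {w. ?h w \<noteq> \<zero>\<^bsub>K\<^esub>}" by (meson finite_imageI finite_subset)
  moreover have "?h w = \<zero>\<^bsub>K\<^esub>" if "w \<notin> lists S" for w
  proof (rule ccontr)
    assume "?h w \<noteq> \<zero>\<^bsub>K\<^esub>"
    then obtain v u where "w = v @ u" "f v \<noteq> \<zero>\<^bsub>K\<^esub>" "g u \<noteq> \<zero>\<^bsub>K\<^esub>" using split by blast
    moreover have "v \<in> lists S" "u \<in> lists S"
      using f g calculation(2,3) unfolding free_alg_simps free_module_simps by blast+
    ultimately show False using that by simp
  qed
  moreover have "?h w \<in> carrier K" for w unfolding free_alg_simps by (intro K.finsum_closed) (simp add: v)
  ultimately show ?thesis by (simp add: free_alg_simps(1) free_module_simps(1))
qed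

lemma free_alg_mult_bilinear:
  "bilinear_map K (free_alg K S) (free_alg K S) (free_alg K S) (mult (free_alg K S))"
proof -
  note v = free_alg_value
  note ev = free_alg_simps(2,4,6) free_module_simps(3,4)
  show ?thesis
  proof (intro bilinear_mapI linear_mapI free_alg_mult_closed)
    fix f f' g assume A: "f \<in> carrier (free_alg K S)" "f' \<in> carrier (free_alg K S)" "g \<in> carrier (free_alg K S)"
    show "(f \<oplus>\<^bsub>free_alg K S\<^esub> f') \<otimes>\<^bsub>free_alg K S\<^esub> g =
      f \<otimes>\<^bsub>free_alg K S\<^esub> g \<oplus>\<^bsub>free_alg K S\<^esub> f' \<otimes>\<^bsub>free_alg K S\<^esub> g"
      using A by (simp add: ev v K.l_distr K.finsum_addf)
    show "g \<otimes>\<^bsub>free_alg K S\<^esub> (f \<oplus>\<^bsub>free_alg K S\<^esub> f') =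
      g \<otimes>\<^bsub>free_alg K S\<^esub> f \<oplus>\<^bsub>free_alg K S\<^esub> g \<otimes>\<^bsub>free_alg K S\<^esub> f'"
      using A by (simp add: ev v K.r_distr K.finsum_addf)
  next
    fix c f g assume A: "c \<in> carrier K" "f \<in> carrier (free_alg K S)" "g \<in> carrier (free_alg K S)"
    show "(c \<odot>\<^bsub>free_alg K S\<^esub> f) \<otimes>\<^bsub>free_alg K S\<^esub> g = c \<odot>\<^bsub>free_alg K S\<^esub> (f \<otimes>\<^bsub>free_alg K S\<^esub> g)"
      "f \<otimes>\<^bsub>free_alg K S\<^esub> (c \<odot>\<^bsub>free_alg K S\<^esub> g) = c \<odot>\<^bsub>free_alg K S\<^esub> (f \<otimes>\<^bsub>free_alg K S\<^esub> g)"
      using A by (simp_all add: ev v K.m_assoc K.m_lcomm K.finsum_rdistr)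
  qed
qed

text \<open>Among the cuts of u only the one at position \<open>length v\<close> can contribute, and
  it does so exactly when u is the concatenation. If v is longer than u there is no such cut, and u
  is not the concatenation either.\<close>

lemma single_mult: "single K v \<otimes>\<^bsub>free_alg K S\<^esub> single K w = single K (v @ w)"
proof
  fix u
  define t where "t i = single K v (take i u) \<otimes>\<^bsub>K\<^esub> single K w (drop i u)" for i
  have t: "t i = (if i = length v then single K (v @ w) u else \<zero>\<^bsub>K\<^esub>)" if "i \<le> length u" for i
  proof (cases "i = length v")
    case True
    have "u = v @ w \<longleftrightarrow> take i u = v \<and> drop i u = w"
      unfolding True by (metis append_eq_conv_conj)
    with True show ?thesis by (auto simp: t_def single_def)
  next
    case False
    with that have "take i u \<noteq> v" by auto
    with False show ?thesis by (simp add: t_def single_def)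
  qed
  have "(single K v \<otimes>\<^bsub>free_alg K S\<^esub> single K w) u = (\<Oplus>\<^bsub>K\<^esub>i\<in>{..length u}. t i)"
    by (simp add: free_alg_simps t_def)
  also have "\<dots> = (\<Oplus>\<^bsub>K\<^esub>i\<in>{..length u}. if length v = i then single K (v @ w) u else \<zero>\<^bsub>K\<^esub>)"
    by (intro K.finsum_cong') (auto simp: t single_def)
  also have "\<dots> = single K (v @ w) u"
  proof (cases "length v \<le> length u")
    case True
    then show ?thesis
      by (subst K.add.finprod_singleton[of "length v" _ "\<lambda>_. single K (v @ w) u"]) (auto simp: single_def)
  next
    case False
    then have "(\<Oplus>\<^bsub>K\<^esub>i\<in>{..length u}. if length v = i then single K (v @ w) u else \<zero>\<^bsub>K\<^esub>) =
        (\<Oplus>\<^bsub>K\<^esub>i\<in>{..length u}. \<zero>\<^bsub>K\<^esub>)"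
      by (intro K.finsum_cong') auto
    with False show ?thesis by (auto simp: single_def)
  qed
  finally show "(single K v \<otimes>\<^bsub>free_alg K S\<^esub> single K w) u = single K (v @ w) u" .
qed

lemma single_word_closed: "w \<in> lists S \<Longrightarrow> single K w \<in> carrier (free_alg K S)"
  unfolding free_alg_simps by (rule single_closed[OF K])

lemma free_alg_linear_eq:
  assumes "module K P" "linear_map K (free_alg K S) P f" "linear_map K (free_alg K S) P g"
    and "\<And>w. w \<in> lists S \<Longrightarrow> f (single K w) = g (single K w)" "x \<in> carrier (free_alg K S)"
  shows "f x = g x"
proof (rule linear_map_eq_on_free[OF K assms(1), of "lists S" f g])
  show "linear_map K (free_module K (lists S)) P f" "linear_map K (free_module K (lists S)) P g"
    using assms(2,3) by (simp_all add: linear_map_def free_alg_simps)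
qed (use assms in \<open>auto simp: free_alg_simps\<close>)

text \<open>For words associativity is that of concatenation. It is extended linearly one argument
  at a time, starting with the third, while the arguments not yet treated stay words.\<close>

lemma free_alg_assoc_algebra: "assoc_algebra K (free_alg K S)"
proof (rule assoc_algebraI[OF free_alg_module free_alg_mult_bilinear])
  note b = free_alg_mult_bilinear
  note L = bilinear_map_left[OF b] and R = bilinear_map_right[OF b]
  note eqI = free_alg_linear_eq[OF free_alg_module]
  show one: "\<one>\<^bsub>free_alg K S\<^esub> \<in> carrier (free_alg K S)"
    unfolding free_alg_simps(5) by (rule single_word_closed) simp
  fix f assume f: "f \<in> carrier (free_alg K S)"
  show "\<one>\<^bsub>free_alg K S\<^esub> \<otimes>\<^bsub>free_alg K S\<^esub> f = f"
    by (rule eqI[OF R[OF one] linear_map_id _ f]) (simp add: free_alg_simps(5) single_mult)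
  show "f \<otimes>\<^bsub>free_alg K S\<^esub> \<one>\<^bsub>free_alg K S\<^esub> = f"
    by (rule eqI[OF L[OF one] linear_map_id _ f]) (simp add: free_alg_simps(5) single_mult)
  fix g h assume g: "g \<in> carrier (free_alg K S)" and h: "h \<in> carrier (free_alg K S)"
  note cl = free_alg_mult_closed single_word_closed
  have *: "(single K u \<otimes>\<^bsub>free_alg K S\<^esub> single K v) \<otimes>\<^bsub>free_alg K S\<^esub> h =
      single K u \<otimes>\<^bsub>free_alg K S\<^esub> (single K v \<otimes>\<^bsub>free_alg K S\<^esub> h)"
    if "u \<in> lists S" "v \<in> lists S" for u v
    by (rule eqI[OF R linear_map_comp[OF R R] _ h]) (use that in \<open>auto simp: cl, auto simp: single_mult\<close>)
  have *: "(single K u \<otimes>\<^bsub>free_alg K S\<^esub> g) \<otimes>\<^bsub>free_alg K S\<^esub> h =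
      single K u \<otimes>\<^bsub>free_alg K S\<^esub> (g \<otimes>\<^bsub>free_alg K S\<^esub> h)"
    if "u \<in> lists S" for u
    by (rule eqI[OF linear_map_comp[OF R L] linear_map_comp[OF L R] _ g])
      (use that h in \<open>auto simp: cl *\<close>)
  show "(f \<otimes>\<^bsub>free_alg K S\<^esub> g) \<otimes>\<^bsub>free_alg K S\<^esub> h = f \<otimes>\<^bsub>free_alg K S\<^esub> (g \<otimes>\<^bsub>free_alg K S\<^esub> h)"
    by (rule eqI[OF linear_map_comp[OF L L] L _ f]) (use g h in \<open>auto simp: cl *\<close>)
qed

end

section \<open>The universal enveloping algebra\<close>

context
  fixes K :: "('k, 'kk) ring_scheme" and L :: "('k, 'l, 'll) lie_scheme"
  assumes L: "lie_algebra K L"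
begin

interpretation L: lie_algebra K L by (rule L)

abbreviation (input) words where "words \<equiv> free_alg K (carrier L)"

lemmas words_assoc_algebra = free_alg_assoc_algebra[OF L.R.is_cring, of "carrier L"]

interpretation W: assoc_algebra K words by (rule words_assoc_algebra)

lemma letter_closed: "x \<in> carrier L \<Longrightarrow> single K [x] \<in> carrier words"
  by (simp add: single_word_closed[OF L.R.is_cring])

lemma uea_relations_carrier: "uea_relations K L \<subseteq> carrier words"
  unfolding uea_relations_def Let_def
  by (auto intro!: W.M.minus_closed W.M.a_closed W.smult_closed W.M.m_closed letter_closed
      L.bracket_closed L.M.a_closed L.smult_closed)

lemma uea_ideal_ideal: "ideal (uea_ideal K L) words"
  unfolding uea_ideal_def by (rule W.M.genideal_ideal[OF uea_relations_carrier])

interpretation I: ideal "uea_ideal K L" words by (rule uea_ideal_ideal)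

lemma uea_relation_ideal: "r \<in> uea_relations K L \<Longrightarrow> r \<in> uea_ideal K L"
  unfolding uea_ideal_def by (rule subsetD[OF W.M.genideal_self[OF uea_relations_carrier]])

lemma uea_ideal_submodule: "submodule (uea_ideal K L) K words"
proof (rule W.submoduleI)
  \<comment> \<open>An ideal is only assumed to absorb products; scalars are absorbed because c acts
    as multiplication by c times the unit.\<close>
  fix c x assume c: "c \<in> carrier K" and x: "x \<in> uea_ideal K L"
  then have xc: "x \<in> carrier words" by (rule_tac I.a_Hcarr)
  have "(c \<odot>\<^bsub>words\<^esub> \<one>\<^bsub>words\<^esub>) \<otimes>\<^bsub>words\<^esub> x \<in> uea_ideal K L" using c x by (intro I.I_l_closed) auto
  then show "c \<odot>\<^bsub>words\<^esub> x \<in> uea_ideal K L" using c xc by (simp add: W.smult_mult_left)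
qed (auto intro: I.a_Hcarr)

lemma uea_quot_simps:
  "carrier (uea K L) = a_rcosets\<^bsub>words\<^esub> (uea_ideal K L)"
  "add (uea K L) = set_add words"
  "zero (uea K L) = uea_ideal K L"
  "smult (uea K L) = coset_smult words (uea_ideal K L)"
  "one (uea K L) = uea_ideal K L +>\<^bsub>words\<^esub> \<one>\<^bsub>words\<^esub>"
  "mult (uea K L) = rcoset_mult words (uea_ideal K L)"
  by (simp_all add: uea_def ring.extend_def FactRing_def)

lemmas uea_quot = W.module_axioms uea_ideal_submodule uea_quot_simps(1-4)

abbreviation (input) proj where "proj f \<equiv> uea_ideal K L +>\<^bsub>words\<^esub> f"

lemma uea_module: "module K (uea K L)"
  by (rule quotient_module[OF uea_quot])

lemma proj_mult: "f \<in> carrier words \<Longrightarrow> g \<in> carrier words \<Longrightarrow> proj f \<otimes>\<^bsub>uea K L\<^esub> proj g = proj (f \<otimes>\<^bsub>words\<^esub> g)"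
  by (simp add: uea_quot_simps I.rcoset_mult_add)

lemma proj_closed: "f \<in> carrier words \<Longrightarrow> proj f \<in> carrier (uea K L)"
  by (rule coset_closed[OF uea_quot])

lemma proj_cases:
  assumes "u \<in> carrier (uea K L)" obtains f where "f \<in> carrier words" "u = proj f"
  by (rule coset_cases[OF uea_quot assms])

lemma uea_assoc_algebra: "assoc_algebra K (uea K L)"
proof (rule assoc_algebraI[OF uea_module])
  note ps = proj_mult proj_closed coset_add[OF uea_quot, symmetric] coset_scale[OF uea_quot, symmetric]
  show "bilinear_map K (uea K L) (uea K L) (uea K L) (mult (uea K L))"
  proof (intro bilinear_mapI linear_mapI)
    fix u v assume "u \<in> carrier (uea K L)" "v \<in> carrier (uea K L)"
    then obtain f g where fg: "f \<in> carrier words" "u = proj f" "g \<in> carrier words" "v = proj g"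
      by (elim proj_cases) blast
    show "u \<otimes>\<^bsub>uea K L\<^esub> v \<in> carrier (uea K L)" "v \<otimes>\<^bsub>uea K L\<^esub> u \<in> carrier (uea K L)"
      using fg by (simp_all add: ps)
    {
      fix c assume "c \<in> carrier K"
      with fg show "u \<otimes>\<^bsub>uea K L\<^esub> (c \<odot>\<^bsub>uea K L\<^esub> v) = c \<odot>\<^bsub>uea K L\<^esub> (u \<otimes>\<^bsub>uea K L\<^esub> v)"
        "(c \<odot>\<^bsub>uea K L\<^esub> v) \<otimes>\<^bsub>uea K L\<^esub> u = c \<odot>\<^bsub>uea K L\<^esub> (v \<otimes>\<^bsub>uea K L\<^esub> u)"
        by (simp_all add: ps W.smult_mult_left W.smult_mult_right)
    }
    fix w assume "w \<in> carrier (uea K L)"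
    then obtain h where "h \<in> carrier words" "w = proj h" by (elim proj_cases) blast
    with fg show "u \<otimes>\<^bsub>uea K L\<^esub> (v \<oplus>\<^bsub>uea K L\<^esub> w) = u \<otimes>\<^bsub>uea K L\<^esub> v \<oplus>\<^bsub>uea K L\<^esub> u \<otimes>\<^bsub>uea K L\<^esub> w"
      "(v \<oplus>\<^bsub>uea K L\<^esub> w) \<otimes>\<^bsub>uea K L\<^esub> u = v \<otimes>\<^bsub>uea K L\<^esub> u \<oplus>\<^bsub>uea K L\<^esub> w \<otimes>\<^bsub>uea K L\<^esub> u"
      by (simp_all add: ps W.M.l_distr W.M.r_distr)
  qed
  show "\<one>\<^bsub>uea K L\<^esub> \<in> carrier (uea K L)" by (simp add: uea_quot_simps(5) proj_closed)
  fix u assume "u \<in> carrier (uea K L)"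
  then obtain f where f: "f \<in> carrier words" "u = proj f" by (elim proj_cases) blast
  then show "\<one>\<^bsub>uea K L\<^esub> \<otimes>\<^bsub>uea K L\<^esub> u = u" "u \<otimes>\<^bsub>uea K L\<^esub> \<one>\<^bsub>uea K L\<^esub> = u"
    by (simp_all add: ps uea_quot_simps(5))
  fix v w assume "v \<in> carrier (uea K L)" "w \<in> carrier (uea K L)"
  then obtain g h where "g \<in> carrier words" "v = proj g" "h \<in> carrier words" "w = proj h"
    by (elim proj_cases) blast
  with f show "u \<otimes>\<^bsub>uea K L\<^esub> v \<otimes>\<^bsub>uea K L\<^esub> w = u \<otimes>\<^bsub>uea K L\<^esub> (v \<otimes>\<^bsub>uea K L\<^esub> w)"
    by (simp add: ps W.M.m_assoc)
qed

interpretation U: assoc_algebra K "uea K L" by (rule uea_assoc_algebra)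

lemma uea_gen_closed: "x \<in> carrier L \<Longrightarrow> uea_gen K L x \<in> carrier (uea K L)"
  unfolding uea_gen_def by (intro proj_closed letter_closed)

lemma proj_eq:
  assumes "f \<ominus>\<^bsub>words\<^esub> g \<in> uea_relations K L" "f \<in> carrier words" "g \<in> carrier words"
  shows "proj f = proj g"
  using assms by (simp add: coset_eq_iff[OF uea_quot] uea_relation_ideal)

lemma uea_gen_linear: "linear_map K L (uea K L) (uea_gen K L)"
proof (intro linear_mapI uea_gen_closed)
  fix x y assume xy: "x \<in> carrier L" "y \<in> carrier L"
  have "single K [x \<oplus>\<^bsub>L\<^esub> y] \<ominus>\<^bsub>words\<^esub> (single K [x] \<oplus>\<^bsub>words\<^esub> single K [y]) \<in> uea_relations K L"
    unfolding uea_relations_def Let_def using xy by blast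
  then show "uea_gen K L (x \<oplus>\<^bsub>L\<^esub> y) = uea_gen K L x \<oplus>\<^bsub>uea K L\<^esub> uea_gen K L y"
    unfolding uea_gen_def coset_add[OF uea_quot letter_closed[OF xy(1)] letter_closed[OF xy(2)], symmetric]
    using xy by (intro proj_eq letter_closed W.M.a_closed L.M.a_closed)
next
  fix c x assume cx: "c \<in> carrier K" "x \<in> carrier L"
  have "single K [c \<odot>\<^bsub>L\<^esub> x] \<ominus>\<^bsub>words\<^esub> (c \<odot>\<^bsub>words\<^esub> single K [x]) \<in> uea_relations K L"
    unfolding uea_relations_def Let_def using cx by blast
  then show "uea_gen K L (c \<odot>\<^bsub>L\<^esub> x) = c \<odot>\<^bsub>uea K L\<^esub> uea_gen K L x"
    unfolding uea_gen_def coset_scale[OF uea_quot cx(1) letter_closed[OF cx(2)], symmetric]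
    using cx by (intro proj_eq letter_closed W.smult_closed L.smult_closed)
qed

lemma uea_gen_bracket:
  assumes xy: "x \<in> carrier L" "y \<in> carrier L"
  shows "uea_gen K L (bracket L x y) =
    uea_gen K L x \<otimes>\<^bsub>uea K L\<^esub> uea_gen K L y \<ominus>\<^bsub>uea K L\<^esub> uea_gen K L y \<otimes>\<^bsub>uea K L\<^esub> uea_gen K L x"
proof -
  have "single K [bracket L x y] \<ominus>\<^bsub>words\<^esub>
      (single K [x] \<otimes>\<^bsub>words\<^esub> single K [y] \<ominus>\<^bsub>words\<^esub> single K [y] \<otimes>\<^bsub>words\<^esub> single K [x]) \<in> uea_relations K L"
    unfolding uea_relations_def Let_def using xy by blast
  then have "uea_gen K L (bracket L x y) =
      proj (single K [x] \<otimes>\<^bsub>words\<^esub> single K [y] \<ominus>\<^bsub>words\<^esub> single K [y] \<otimes>\<^bsub>words\<^esub> single K [x])"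
    unfolding uea_gen_def using xy
    by (intro proj_eq letter_closed W.M.minus_closed W.M.m_closed L.bracket_closed)
  also have "\<dots> = proj (single K [x] \<otimes>\<^bsub>words\<^esub> single K [y]) \<ominus>\<^bsub>uea K L\<^esub> proj (single K [y] \<otimes>\<^bsub>words\<^esub> single K [x])"
    using xy by (intro linear_map_minus[OF W.module_axioms uea_module coset_linear[OF uea_quot]]
        letter_closed W.M.m_closed)
  finally show ?thesis unfolding uea_gen_def using xy by (simp add: proj_mult letter_closed)
qed

text \<open>U(L) is spanned by the classes of words, and a word arises from the empty one by
  prefixing letters. Left multiplication by generators is the form suited to representations, where
  a product acts letter by letter.\<close>

lemma uea_induct:
  assumes "u \<in> carrier (uea K L)"
    and one: "Q \<one>\<^bsub>uea K L\<^esub>"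
    and gen: "\<And>x u. x \<in> carrier L \<Longrightarrow> u \<in> carrier (uea K L) \<Longrightarrow> Q u \<Longrightarrow> Q (uea_gen K L x \<otimes>\<^bsub>uea K L\<^esub> u)"
    and add: "\<And>u v. u \<in> carrier (uea K L) \<Longrightarrow> v \<in> carrier (uea K L) \<Longrightarrow> Q u \<Longrightarrow> Q v \<Longrightarrow> Q (u \<oplus>\<^bsub>uea K L\<^esub> v)"
    and smult: "\<And>c u. c \<in> carrier K \<Longrightarrow> u \<in> carrier (uea K L) \<Longrightarrow> Q u \<Longrightarrow> Q (c \<odot>\<^bsub>uea K L\<^esub> u)"
  shows "Q u"
proof -
  note ps = proj_mult[symmetric] proj_closed coset_add[OF uea_quot] coset_scale[OF uea_quot]
  note sc = single_word_closed[OF L.R.is_cring]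
  have word: "Q (proj (single K w))" if "w \<in> lists (carrier L)" for w
    using that
  proof (induction w)
    case Nil
    then show ?case using one by (simp add: uea_quot_simps(5) free_alg_simps(5))
  next
    case (Cons x w)
    have "proj (single K (x # w)) = uea_gen K L x \<otimes>\<^bsub>uea K L\<^esub> proj (single K w)"
      using Cons.hyps by (simp add: uea_gen_def proj_mult sc single_mult[OF L.R.is_cring])
    then show ?case using Cons by (simp add: gen proj_closed sc)
  qed
  obtain f where f: "f \<in> carrier words" and u: "u = proj f" by (rule proj_cases[OF assms(1)])
  have "Q (proj f)"
    using L.R.is_cring f[unfolded free_alg_simps]
  proof (induction rule: free_module_induct)
    \<comment> \<open>Zero has no case of its own in the induction rule; it is obtained as zero
      times the unit.\<close>
    case zero
    have "Q (\<zero>\<^bsub>K\<^esub> \<odot>\<^bsub>uea K L\<^esub> \<one>\<^bsub>uea K L\<^esub>)" using one by (intro smult) auto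
    moreover have "proj \<zero>\<^bsub>words\<^esub> = \<zero>\<^bsub>uea K L\<^esub>" by (rule coset_zero[OF uea_quot, symmetric])
    ultimately show ?case by (simp add: free_alg_simps(3))
  next
    case (single c w)
    have "proj (c \<odot>\<^bsub>words\<^esub> single K w) = c \<odot>\<^bsub>uea K L\<^esub> proj (single K w)"
      using single by (simp add: ps sc)
    then show ?case using single by (simp add: free_alg_simps(4) smult word proj_closed sc)
  next
    case (add f g)
    have "proj (f \<oplus>\<^bsub>words\<^esub> g) = proj f \<oplus>\<^bsub>uea K L\<^esub> proj g"
      using add by (simp add: ps free_alg_simps(1))
    then show ?case using add by (simp add: free_alg_simps(1,2) assms(4) proj_closed)
  qed
  then show ?thesis by (simp add: u)
qed

lemma uea_linear_eq:
  assumes "linear_map K (uea K L) P g" "linear_map K (uea K L) P h"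
    and "g \<one>\<^bsub>uea K L\<^esub> = h \<one>\<^bsub>uea K L\<^esub>"
    and "\<And>x u. x \<in> carrier L \<Longrightarrow> u \<in> carrier (uea K L) \<Longrightarrow> g u = h u \<Longrightarrow>
      g (uea_gen K L x \<otimes>\<^bsub>uea K L\<^esub> u) = h (uea_gen K L x \<otimes>\<^bsub>uea K L\<^esub> u)"
    and "u \<in> carrier (uea K L)"
  shows "g u = h u"
  by (rule uea_induct[OF assms(5)]) (simp_all add: assms(3,4) linear_mapD[OF assms(1)] linear_mapD[OF assms(2)])

lemma uea_alg_hom_eq:
  assumes "g \<in> alg_hom K (uea K L) P" "h \<in> alg_hom K (uea K L) P"
    and "\<And>x. x \<in> carrier L \<Longrightarrow> g (uea_gen K L x) = h (uea_gen K L x)"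
  shows "g = h"
proof (rule extensionalityI)
  fix u assume "u \<in> carrier (uea K L)"
  then show "g u = h u"
    by (rule uea_linear_eq[OF alg_hom_linear[OF assms(1)] alg_hom_linear[OF assms(2)], rotated 2])
      (simp_all add: alg_homD[OF assms(1)] alg_homD[OF assms(2)] uea_gen_closed assms(3))
qed (use assms in \<open>auto intro: alg_hom_extensional\<close>)

section \<open>Universal property of the enveloping algebra\<close>

context
  fixes P :: "('k, 'p, 'pp) module_scheme" and f
  assumes P: "assoc_algebra K P" and f: "linear_map K L P f"
    and comm: "\<And>x y. x \<in> carrier L \<Longrightarrow> y \<in> carrier L
      \<Longrightarrow> f (bracket L x y) = f x \<otimes>\<^bsub>P\<^esub> f y \<ominus>\<^bsub>P\<^esub> f y \<otimes>\<^bsub>P\<^esub> f x"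
begin

interpretation P: assoc_algebra K P by (rule P)

text \<open>Send a word to the ordered product of the values of f on its letters and extend
  linearly. The extension h is multiplicative on words, hence everywhere, so its kernel is a
  two-sided ideal. Linearity of f and \<open>comm\<close> place the relations in that kernel, and h
  descends to the quotient.\<close>

lemma uea_lift_exists: "\<exists>g \<in> alg_hom K (uea K L) P. \<forall>x \<in> carrier L. g (uea_gen K L x) = f x"
proof -
  define b where "b w = foldr (\<lambda>x s. f x \<otimes>\<^bsub>P\<^esub> s) w \<one>\<^bsub>P\<^esub>" for w
  have b: "b w \<in> carrier P" if "w \<in> lists (carrier L)" for w
    using that by (induction w) (auto simp: b_def linear_mapD[OF f])
  then have bc: "b \<in> lists (carrier L) \<rightarrow> carrier P" by auto
  have bm: "b (v @ w) = b v \<otimes>\<^bsub>P\<^esub> b w" if "v \<in> lists (carrier L)" "w \<in> lists (carrier L)" for v w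
    using that
  proof (induction v)
    case Nil
    moreover have "b [] = \<one>\<^bsub>P\<^esub>" by (simp add: b_def)
    ultimately show ?case by (simp add: b)
  next
    case (Cons x v)
    have "b (x # v) = f x \<otimes>\<^bsub>P\<^esub> b v" "b (x # v @ w) = f x \<otimes>\<^bsub>P\<^esub> b (v @ w)" by (simp_all add: b_def)
    with Cons show ?case by (simp add: b linear_mapD[OF f] P.M.m_assoc)
  qed
  define h where "h = free_lift K P b"
  have h: "linear_map K words P h"
    using free_lift_linear[OF P.module_axioms bc] by (simp add: h_def linear_map_def free_alg_simps)
  have hs: "h (single K w) = b w" if "w \<in> lists (carrier L)" for w
    unfolding h_def by (rule free_lift_single[OF P.module_axioms bc that])
  note sc = single_word_closed[OF L.R.is_cring]
  note eqI = free_alg_linear_eq[OF L.R.is_cring P.module_axioms]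
  note LW = bilinear_map_left[OF mult_bilinear[OF words_assoc_algebra]]
    and RW = bilinear_map_right[OF mult_bilinear[OF words_assoc_algebra]]
    and LP = bilinear_map_left[OF mult_bilinear[OF P]]
    and RP = bilinear_map_right[OF mult_bilinear[OF P]]
  have hm1: "h (single K v \<otimes>\<^bsub>words\<^esub> q) = h (single K v) \<otimes>\<^bsub>P\<^esub> h q"
    if v: "v \<in> lists (carrier L)" and q: "q \<in> carrier words" for v q
    by (rule eqI[OF linear_map_comp[OF RW h] linear_map_comp[OF h RP] _ q])
      (use v in \<open>auto simp: sc b single_mult[OF L.R.is_cring] hs bm\<close>)
  have hm: "h (p \<otimes>\<^bsub>words\<^esub> q) = h p \<otimes>\<^bsub>P\<^esub> h q" if p: "p \<in> carrier words" and q: "q \<in> carrier words" for p q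
    by (rule eqI[OF linear_map_comp[OF LW h] linear_map_comp[OF h LP] _ p])
      (use q in \<open>auto simp: hm1 linear_map_closed[OF h]\<close>)
  have h1: "h \<one>\<^bsub>words\<^esub> = \<one>\<^bsub>P\<^esub>" by (simp add: free_alg_simps(5) hs) (simp add: b_def)
  have hl: "h (single K [x]) = f x" if "x \<in> carrier L" for x
    using that by (simp add: hs) (simp add: b_def linear_mapD[OF f])
  have "ring_hom_ring words P h"
    by (rule ring_hom_ringI) (auto simp: W.M.ring_axioms P.M.ring_axioms linear_mapD[OF h] hm h1)
  then have "ideal (a_kernel words P h) words" by (rule ring_hom_ring.kernel_is_ideal)
  moreover have "uea_relations K L \<subseteq> a_kernel words P h"
  proof
    fix r assume r: "r \<in> uea_relations K L"
    have diff: "p \<ominus>\<^bsub>P\<^esub> p = \<zero>\<^bsub>P\<^esub>" if "p \<in> carrier P" for p using that by (simp add: a_minus_def P.M.r_neg)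
    have "h r = \<zero>\<^bsub>P\<^esub>"
      using r unfolding uea_relations_def Let_def
      by (auto simp: linear_map_minus[OF W.module_axioms P.module_axioms h] linear_mapD(2,3)[OF h] letter_closed hl hm
          linear_mapD[OF f] L.bracket_closed comm diff)
    with r uea_relations_carrier show "r \<in> a_kernel words P h" by (auto simp: a_kernel_def')
  qed
  ultimately have "uea_ideal K L \<subseteq> a_kernel words P h"
    unfolding uea_ideal_def by (rule W.M.genideal_minimal)
  then have "\<exists>g \<in> lin_hom K (uea K L) P. \<forall>w \<in> carrier words. g (proj w) = h w"
    by (intro quotient_lift[OF uea_quot P.module_axioms h]) (auto simp: a_kernel_def')
  then obtain g where g: "g \<in> lin_hom K (uea K L) P" "\<And>w. w \<in> carrier words \<Longrightarrow> g (proj w) = h w" by blast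
  have "g \<in> alg_hom K (uea K L) P"
    using g(1) by (auto simp: alg_hom_iff lin_hom_iff uea_quot_simps(5) g(2) h1 proj_mult hm elim!: proj_cases)
  then show ?thesis by (intro bexI[of _ g]) (auto simp: uea_gen_def g(2) letter_closed hl)
qed

lemma uea_lift_eq:
  assumes "g \<in> alg_hom K (uea K L) P" "\<And>x. x \<in> carrier L \<Longrightarrow> g (uea_gen K L x) = f x"
  shows "uea_lift K L P f = g"
  unfolding uea_lift_def using assms by (intro the_equality) (auto intro: uea_alg_hom_eq)

lemma uea_lift_spec:
  "uea_lift K L P f \<in> alg_hom K (uea K L) P \<and> (\<forall>x \<in> carrier L. uea_lift K L P f (uea_gen K L x) = f x)"
proof -
  obtain g where "g \<in> alg_hom K (uea K L) P" "\<forall>x \<in> carrier L. g (uea_gen K L x) = f x"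
    using uea_lift_exists by blast
  moreover from this have "uea_lift K L P f = g" by (intro uea_lift_eq) auto
  ultimately show ?thesis by simp
qed

lemma uea_lift_hom: "uea_lift K L P f \<in> alg_hom K (uea K L) P"
  using uea_lift_spec by simp

lemma uea_lift_gen: "x \<in> carrier L \<Longrightarrow> uea_lift K L P f (uea_gen K L x) = f x"
  using uea_lift_spec by simp

end

end

section \<open>Lie algebras\<close>

lemma submodule_module_cong:
  assumes "module K P" "carrier L \<subseteq> carrier P" "zero L = zero P" "\<zero>\<^bsub>L\<^esub> \<in> carrier L"
    and "\<And>x y. x \<in> carrier L \<Longrightarrow> y \<in> carrier L \<Longrightarrow> x \<oplus>\<^bsub>L\<^esub> y = x \<oplus>\<^bsub>P\<^esub> y \<and> x \<oplus>\<^bsub>P\<^esub> y \<in> carrier L"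
    and "\<And>c x. c \<in> carrier K \<Longrightarrow> x \<in> carrier L \<Longrightarrow> c \<odot>\<^bsub>L\<^esub> x = c \<odot>\<^bsub>P\<^esub> x \<and> c \<odot>\<^bsub>P\<^esub> x \<in> carrier L"
  shows "module K L"
proof -
  interpret P: module K P by fact
  have in_P: "x \<in> carrier P" if "x \<in> carrier L" for x using assms(2) that by blast
  have "abelian_group L"
  proof (rule abelian_groupI)
    fix x assume x: "x \<in> carrier L"
    have "(\<ominus>\<^bsub>K\<^esub> \<one>\<^bsub>K\<^esub>) \<odot>\<^bsub>L\<^esub> x \<oplus>\<^bsub>L\<^esub> x = \<zero>\<^bsub>L\<^esub>"
      using x in_P[OF x] assms(5)[of "\<ominus>\<^bsub>P\<^esub> x" x] assms(6)[of "\<ominus>\<^bsub>K\<^esub> \<one>\<^bsub>K\<^esub>" x]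
      by (simp add: assms(3) P.smult_l_minus P.M.l_neg)
    moreover have "(\<ominus>\<^bsub>K\<^esub> \<one>\<^bsub>K\<^esub>) \<odot>\<^bsub>L\<^esub> x \<in> carrier L" using x by (simp add: assms(6))
    ultimately show "\<exists>y\<in>carrier L. y \<oplus>\<^bsub>L\<^esub> x = \<zero>\<^bsub>L\<^esub>" by blast
  qed (use assms(3-5) in_P in \<open>auto simp: P.M.a_ac\<close>)
  then show ?thesis
    using assms(5,6) in_P
    by (intro moduleI P.R.is_cring) (auto simp: P.smult_l_distr P.smult_r_distr P.smult_assoc1)
qed

text \<open>All Lie algebras constructed here are subalgebras: derivations sit in the commutator
  algebra of endomorphisms, \<open>L_ring\<close> in the product of the commutator algebra of R with
  the derivations, and \<open>F_anch\<close> in the product of M with the derivations of A.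
  Antisymmetry and Jacobi are inherited, and only closure is left to check.\<close>

lemma lie_subalgebra:
  assumes P: "lie_algebra K P" and "carrier L \<subseteq> carrier P" "zero L = zero P" "\<zero>\<^bsub>L\<^esub> \<in> carrier L"
    and add: "\<And>x y. x \<in> carrier L \<Longrightarrow> y \<in> carrier L \<Longrightarrow> x \<oplus>\<^bsub>L\<^esub> y = x \<oplus>\<^bsub>P\<^esub> y \<and> x \<oplus>\<^bsub>P\<^esub> y \<in> carrier L"
    and smult: "\<And>c x. c \<in> carrier K \<Longrightarrow> x \<in> carrier L \<Longrightarrow> c \<odot>\<^bsub>L\<^esub> x = c \<odot>\<^bsub>P\<^esub> x \<and> c \<odot>\<^bsub>P\<^esub> x \<in> carrier L"
    and br: "\<And>x y. x \<in> carrier L \<Longrightarrow> y \<in> carrier L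
      \<Longrightarrow> bracket L x y = bracket P x y \<and> bracket P x y \<in> carrier L"
  shows "lie_algebra K L"
proof -
  interpret P: lie_algebra K P by fact
  have in_P: "x \<in> carrier P" if "x \<in> carrier L" for x using assms(2) that by blast
  have cl: "bracket P x y \<in> carrier L" if "x \<in> carrier L" "y \<in> carrier L" for x y
    using br that by metis
  have "module K L"
    by (rule submodule_module_cong[OF P.module_axioms assms(2-4) add smult])
  then show ?thesis
  proof (intro lie_algebra.intro lie_algebra_axioms.intro)
    fix x y z assume xyz: "x \<in> carrier L" "y \<in> carrier L" "z \<in> carrier L"
    have "bracket P x (bracket P y z) \<oplus>\<^bsub>P\<^esub> bracket P y (bracket P z x) \<in> carrier L"
      using add[of "bracket P x (bracket P y z)" "bracket P y (bracket P z x)"] xyz by (simp add: cl)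
    then show "bracket L x (bracket L y z) \<oplus>\<^bsub>L\<^esub> bracket L y (bracket L z x) \<oplus>\<^bsub>L\<^esub> bracket L z (bracket L x y) = \<zero>\<^bsub>L\<^esub>"
      using xyz in_P P.jacobi by (simp add: br add cl assms(3))
  qed (use add smult br in_P assms(3) in \<open>simp_all add: P.bracket_add_left P.bracket_add_right
      P.bracket_smult_left P.bracket_smult_right P.bracket_self\<close>)
qed

definition commutator_lie :: "('k, 'a, 'aa) module_scheme \<Rightarrow> ('k, 'a) lie" where
  "commutator_lie A =
     \<lparr>carrier = carrier A, mult = undefined, one = undefined, zero = \<zero>\<^bsub>A\<^esub>, add = add A, smult = smult A,
      bracket = (\<lambda>x y. x \<otimes>\<^bsub>A\<^esub> y \<ominus>\<^bsub>A\<^esub> y \<otimes>\<^bsub>A\<^esub> x)\<rparr>"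

lemma commutator_lie_simps:
  "carrier (commutator_lie A) = carrier A" "zero (commutator_lie A) = zero A" "add (commutator_lie A) = add A"
  "smult (commutator_lie A) = smult A" "bracket (commutator_lie A) x y = x \<otimes>\<^bsub>A\<^esub> y \<ominus>\<^bsub>A\<^esub> y \<otimes>\<^bsub>A\<^esub> x"
  by (simp_all add: commutator_lie_def)

lemma commutator_lie_lie_algebra:
  assumes "assoc_algebra K A" shows "lie_algebra K (commutator_lie A)"
proof -
  interpret A: assoc_algebra K A by fact
  have "module K (commutator_lie A)"
    by (rule module_cong[OF A.module_axioms]) (simp_all add: commutator_lie_simps)
  then show ?thesis
  proof (intro lie_algebra.intro lie_algebra_axioms.intro, simp_all only: commutator_lie_simps)
    fix x y z assume [simp]: "x \<in> carrier A" "y \<in> carrier A" "z \<in> carrier A"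
    show "(x \<oplus>\<^bsub>A\<^esub> y) \<otimes>\<^bsub>A\<^esub> z \<ominus>\<^bsub>A\<^esub> z \<otimes>\<^bsub>A\<^esub> (x \<oplus>\<^bsub>A\<^esub> y) =
        (x \<otimes>\<^bsub>A\<^esub> z \<ominus>\<^bsub>A\<^esub> z \<otimes>\<^bsub>A\<^esub> x) \<oplus>\<^bsub>A\<^esub> (y \<otimes>\<^bsub>A\<^esub> z \<ominus>\<^bsub>A\<^esub> z \<otimes>\<^bsub>A\<^esub> y)"
      "x \<otimes>\<^bsub>A\<^esub> (y \<oplus>\<^bsub>A\<^esub> z) \<ominus>\<^bsub>A\<^esub> (y \<oplus>\<^bsub>A\<^esub> z) \<otimes>\<^bsub>A\<^esub> x =
        (x \<otimes>\<^bsub>A\<^esub> y \<ominus>\<^bsub>A\<^esub> y \<otimes>\<^bsub>A\<^esub> x) \<oplus>\<^bsub>A\<^esub> (x \<otimes>\<^bsub>A\<^esub> z \<ominus>\<^bsub>A\<^esub> z \<otimes>\<^bsub>A\<^esub> x)"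
      by (simp_all add: a_minus_def A.M.l_distr A.M.r_distr A.M.minus_add A.M.a_ac)
    show "(x \<otimes>\<^bsub>A\<^esub> (y \<otimes>\<^bsub>A\<^esub> z \<ominus>\<^bsub>A\<^esub> z \<otimes>\<^bsub>A\<^esub> y) \<ominus>\<^bsub>A\<^esub> (y \<otimes>\<^bsub>A\<^esub> z \<ominus>\<^bsub>A\<^esub> z \<otimes>\<^bsub>A\<^esub> y) \<otimes>\<^bsub>A\<^esub> x) \<oplus>\<^bsub>A\<^esub>
        (y \<otimes>\<^bsub>A\<^esub> (z \<otimes>\<^bsub>A\<^esub> x \<ominus>\<^bsub>A\<^esub> x \<otimes>\<^bsub>A\<^esub> z) \<ominus>\<^bsub>A\<^esub> (z \<otimes>\<^bsub>A\<^esub> x \<ominus>\<^bsub>A\<^esub> x \<otimes>\<^bsub>A\<^esub> z) \<otimes>\<^bsub>A\<^esub> y) \<oplus>\<^bsub>A\<^esub>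
        (z \<otimes>\<^bsub>A\<^esub> (x \<otimes>\<^bsub>A\<^esub> y \<ominus>\<^bsub>A\<^esub> y \<otimes>\<^bsub>A\<^esub> x) \<ominus>\<^bsub>A\<^esub> (x \<otimes>\<^bsub>A\<^esub> y \<ominus>\<^bsub>A\<^esub> y \<otimes>\<^bsub>A\<^esub> x) \<otimes>\<^bsub>A\<^esub> z) = \<zero>\<^bsub>A\<^esub>"
      using \<open>x \<in> carrier A\<close> \<open>y \<in> carrier A\<close> \<open>z \<in> carrier A\<close> by algebra
    show "x \<otimes>\<^bsub>A\<^esub> x \<ominus>\<^bsub>A\<^esub> x \<otimes>\<^bsub>A\<^esub> x = \<zero>\<^bsub>A\<^esub>" by (simp add: a_minus_def A.M.r_neg)
    fix c assume "c \<in> carrier K"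
    then show "(c \<odot>\<^bsub>A\<^esub> x) \<otimes>\<^bsub>A\<^esub> y \<ominus>\<^bsub>A\<^esub> y \<otimes>\<^bsub>A\<^esub> (c \<odot>\<^bsub>A\<^esub> x) = c \<odot>\<^bsub>A\<^esub> (x \<otimes>\<^bsub>A\<^esub> y \<ominus>\<^bsub>A\<^esub> y \<otimes>\<^bsub>A\<^esub> x)"
      "x \<otimes>\<^bsub>A\<^esub> (c \<odot>\<^bsub>A\<^esub> y) \<ominus>\<^bsub>A\<^esub> (c \<odot>\<^bsub>A\<^esub> y) \<otimes>\<^bsub>A\<^esub> x = c \<odot>\<^bsub>A\<^esub> (x \<otimes>\<^bsub>A\<^esub> y \<ominus>\<^bsub>A\<^esub> y \<otimes>\<^bsub>A\<^esub> x)"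
      by (simp_all add: a_minus_def A.smult_mult_left A.smult_mult_right A.smult_r_distr A.smult_r_minus)
  qed auto
qed

definition prod_lie ::
  "('k, 'l, 'll) lie_scheme \<Rightarrow> ('k, 'm, 'mm) lie_scheme \<Rightarrow> ('k, 'l \<times> 'm) lie" where
  "prod_lie L M =
     \<lparr>carrier = carrier L \<times> carrier M, mult = undefined, one = undefined, zero = (\<zero>\<^bsub>L\<^esub>, \<zero>\<^bsub>M\<^esub>),
      add = (\<lambda>(x, y) (x', y'). (x \<oplus>\<^bsub>L\<^esub> x', y \<oplus>\<^bsub>M\<^esub> y')),
      smult = (\<lambda>c (x, y). (c \<odot>\<^bsub>L\<^esub> x, c \<odot>\<^bsub>M\<^esub> y)),
      bracket = (\<lambda>(x, y) (x', y'). (bracket L x x', bracket M y y'))\<rparr>"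

lemma prod_lie_lie_algebra:
  assumes "lie_algebra K L" "lie_algebra K M" shows "lie_algebra K (prod_lie L M)"
proof -
  interpret L: lie_algebra K L by fact
  interpret M: lie_algebra K M by fact
  have "abelian_group (prod_lie L M)"
  proof (rule abelian_groupI)
    fix p assume "p \<in> carrier (prod_lie L M)"
    then show "\<exists>q\<in>carrier (prod_lie L M). q \<oplus>\<^bsub>prod_lie L M\<^esub> p = \<zero>\<^bsub>prod_lie L M\<^esub>"
      by (intro bexI[of _ "(\<ominus>\<^bsub>L\<^esub> fst p, \<ominus>\<^bsub>M\<^esub> snd p)"]) (auto simp: prod_lie_def L.M.l_neg M.M.l_neg)
  qed (auto simp: prod_lie_def L.M.a_ac M.M.a_ac)
  then have "module K (prod_lie L M)"
    by (intro moduleI L.R.is_cring)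
      (auto simp: prod_lie_def L.smult_l_distr L.smult_r_distr L.smult_assoc1
        M.smult_l_distr M.smult_r_distr M.smult_assoc1)
  then show ?thesis
    by (intro lie_algebra.intro lie_algebra_axioms.intro)
      (auto simp: prod_lie_def L.bracket_closed L.bracket_add_left L.bracket_add_right L.bracket_smult_left
        L.bracket_smult_right L.bracket_self L.jacobi M.bracket_closed M.bracket_add_left M.bracket_add_right
        M.bracket_smult_left M.bracket_smult_right M.bracket_self M.jacobi)
qed

section \<open>Derivations\<close>

lemma Der_simps:
  "d \<in> carrier (Der K B) \<longleftrightarrow> d \<in> lin_hom K B B \<and>
     (\<forall>x \<in> carrier B. \<forall>y \<in> carrier B. d (x \<otimes>\<^bsub>B\<^esub> y) = d x \<otimes>\<^bsub>B\<^esub> y \<oplus>\<^bsub>B\<^esub> x \<otimes>\<^bsub>B\<^esub> d y)"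
  "zero (Der K B) = (\<lambda>x\<in>carrier B. \<zero>\<^bsub>B\<^esub>)"
  "add (Der K B) d e = (\<lambda>x\<in>carrier B. d x \<oplus>\<^bsub>B\<^esub> e x)"
  "smult (Der K B) c d = (\<lambda>x\<in>carrier B. c \<odot>\<^bsub>B\<^esub> d x)"
  "bracket (Der K B) d e = (\<lambda>x\<in>carrier B. d (e x) \<ominus>\<^bsub>B\<^esub> e (d x))"
  by (simp_all add: Der_def)

lemma Der_linear: "d \<in> carrier (Der K B) \<Longrightarrow> linear_map K B B d"
  by (simp add: Der_simps lin_hom_iff)

lemma Der_leibniz:
  "d \<in> carrier (Der K B) \<Longrightarrow> x \<in> carrier B \<Longrightarrow> y \<in> carrier B
    \<Longrightarrow> d (x \<otimes>\<^bsub>B\<^esub> y) = d x \<otimes>\<^bsub>B\<^esub> y \<oplus>\<^bsub>B\<^esub> x \<otimes>\<^bsub>B\<^esub> d y"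
  by (simp add: Der_simps)

lemma End_alg_minus:
  assumes "module K M" "f \<in> carrier (End_alg K M)" "g \<in> carrier (End_alg K M)"
  shows "f \<ominus>\<^bsub>End_alg K M\<^esub> g = (\<lambda>x\<in>carrier M. f x \<ominus>\<^bsub>M\<^esub> g x)"
proof -
  interpret M: module K M by fact
  interpret E: assoc_algebra K "End_alg K M" by (rule End_alg_assoc_algebra) fact
  have g: "g x \<in> carrier M" if "x \<in> carrier M" for x
    using assms(3) that by (auto simp: End_alg_simps lin_hom_iff linear_map_closed)
  \<comment> \<open>The additive inverse of a record is a definite description, whereas the scalar
    -1 acts explicitly on values.\<close>
  have "\<ominus>\<^bsub>End_alg K M\<^esub> g = (\<ominus>\<^bsub>K\<^esub> \<one>\<^bsub>K\<^esub>) \<odot>\<^bsub>End_alg K M\<^esub> g"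
    using assms(3) by (simp add: E.smult_l_minus)
  then show ?thesis
    by (auto simp: a_minus_def End_alg_simps(4-6) M.smult_l_minus g restrict_def)
qed

lemma Der_bracket_commutator:
  assumes "module K B" and d: "d \<in> carrier (Der K B)" and e: "e \<in> carrier (Der K B)"
  shows "bracket (Der K B) d e = d \<otimes>\<^bsub>End_alg K B\<^esub> e \<ominus>\<^bsub>End_alg K B\<^esub> e \<otimes>\<^bsub>End_alg K B\<^esub> d"
proof -
  interpret E: assoc_algebra K "End_alg K B" by (rule End_alg_assoc_algebra) fact
  have de: "d \<in> carrier (End_alg K B)" "e \<in> carrier (End_alg K B)"
    using d e by (simp_all add: Der_simps End_alg_simps)
  show ?thesis
    by (subst End_alg_minus[OF assms(1) E.M.m_closed[OF de] E.M.m_closed[OF de(2,1)]])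
      (auto intro!: restrict_ext simp: Der_simps End_alg_simps(4) compose_eq)
qed

text \<open>The one real check is that a commutator of derivations is a derivation: in the expansion
  at xy the mixed terms d(x)e(y) and e(x)d(y) occur with both signs and cancel.\<close>

lemma Der_lie_algebra:
  assumes B: "assoc_algebra K B" shows "lie_algebra K (Der K B)"
proof -
  interpret B: assoc_algebra K B by fact
  interpret E: assoc_algebra K "End_alg K B" by (rule End_alg_assoc_algebra[OF B.module_axioms])
  let ?E = "End_alg K B"
  show ?thesis
  proof (rule lie_subalgebra[OF commutator_lie_lie_algebra[OF E.assoc_algebra_axioms]], simp_all only: commutator_lie_simps)
    have E: "d \<in> carrier ?E" if "d \<in> carrier (Der K B)" for d using that by (simp add: Der_simps End_alg_simps)
    then show "carrier (Der K B) \<subseteq> carrier ?E" by blast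
    show "\<zero>\<^bsub>Der K B\<^esub> = \<zero>\<^bsub>?E\<^esub>" by (simp add: Der_simps End_alg_simps)
    have "\<zero>\<^bsub>?E\<^esub> \<in> carrier ?E" by simp
    then show "\<zero>\<^bsub>Der K B\<^esub> \<in> carrier (Der K B)" by (simp add: Der_simps End_alg_simps)
    fix d assume d: "d \<in> carrier (Der K B)"
    note dl = linear_mapD[OF Der_linear[OF d]] Der_leibniz[OF d]
    {
      fix c assume c: "c \<in> carrier K"
      have "c \<odot>\<^bsub>?E\<^esub> d \<in> carrier ?E" using c E[OF d] by simp
      then show "c \<odot>\<^bsub>Der K B\<^esub> d = c \<odot>\<^bsub>?E\<^esub> d \<and> c \<odot>\<^bsub>?E\<^esub> d \<in> carrier (Der K B)"
        using c by (simp add: Der_simps End_alg_simps dl B.smult_r_distr B.smult_mult_left B.smult_mult_right)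
    }
    fix e assume e: "e \<in> carrier (Der K B)"
    note el = linear_mapD[OF Der_linear[OF e]] Der_leibniz[OF e]
    have "d \<oplus>\<^bsub>?E\<^esub> e \<in> carrier ?E" using E[OF d] E[OF e] by simp
    then show "d \<oplus>\<^bsub>Der K B\<^esub> e = d \<oplus>\<^bsub>?E\<^esub> e \<and> d \<oplus>\<^bsub>?E\<^esub> e \<in> carrier (Der K B)"
      by (simp add: Der_simps End_alg_simps dl el B.M.l_distr B.M.r_distr B.M.a_ac)
    have c: "d \<otimes>\<^bsub>?E\<^esub> e \<ominus>\<^bsub>?E\<^esub> e \<otimes>\<^bsub>?E\<^esub> d \<in> carrier ?E" using E[OF d] E[OF e] by simp
    have eq: "bracket (Der K B) d e = d \<otimes>\<^bsub>?E\<^esub> e \<ominus>\<^bsub>?E\<^esub> e \<otimes>\<^bsub>?E\<^esub> d"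
      by (rule Der_bracket_commutator[OF B.module_axioms d e])
    have "bracket (Der K B) d e (x \<otimes>\<^bsub>B\<^esub> y) =
        bracket (Der K B) d e x \<otimes>\<^bsub>B\<^esub> y \<oplus>\<^bsub>B\<^esub> x \<otimes>\<^bsub>B\<^esub> bracket (Der K B) d e y"
      if xy: "x \<in> carrier B" "y \<in> carrier B" for x y
    proof -
      have cl: "d x \<in> carrier B" "d y \<in> carrier B" "e x \<in> carrier B" "e y \<in> carrier B"
        "d (e x) \<in> carrier B" "e (d x) \<in> carrier B" "d (e y) \<in> carrier B" "e (d y) \<in> carrier B"
        using xy by (simp_all add: dl el)
      have "((d (e x) \<otimes>\<^bsub>B\<^esub> y \<oplus>\<^bsub>B\<^esub> e x \<otimes>\<^bsub>B\<^esub> d y) \<oplus>\<^bsub>B\<^esub> (d x \<otimes>\<^bsub>B\<^esub> e y \<oplus>\<^bsub>B\<^esub> x \<otimes>\<^bsub>B\<^esub> d (e y))) \<ominus>\<^bsub>B\<^esub>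
          ((e (d x) \<otimes>\<^bsub>B\<^esub> y \<oplus>\<^bsub>B\<^esub> d x \<otimes>\<^bsub>B\<^esub> e y) \<oplus>\<^bsub>B\<^esub> (e x \<otimes>\<^bsub>B\<^esub> d y \<oplus>\<^bsub>B\<^esub> x \<otimes>\<^bsub>B\<^esub> e (d y))) =
          (d (e x) \<ominus>\<^bsub>B\<^esub> e (d x)) \<otimes>\<^bsub>B\<^esub> y \<oplus>\<^bsub>B\<^esub> x \<otimes>\<^bsub>B\<^esub> (d (e y) \<ominus>\<^bsub>B\<^esub> e (d y))"
        using xy cl by algebra
      then show ?thesis using xy cl by (simp add: Der_simps(5) dl el)
    qed
    then show "bracket (Der K B) d e = d \<otimes>\<^bsub>?E\<^esub> e \<ominus>\<^bsub>?E\<^esub> e \<otimes>\<^bsub>?E\<^esub> d \<and>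
        d \<otimes>\<^bsub>?E\<^esub> e \<ominus>\<^bsub>?E\<^esub> e \<otimes>\<^bsub>?E\<^esub> d \<in> carrier (Der K B)"
      using c by (simp add: eq Der_simps(1)) (simp add: End_alg_simps(1))
  qed
qed

lemma Der_eqI:
  assumes "d \<in> carrier (Der K B)" "e \<in> carrier (Der K B)" "\<And>x. x \<in> carrier B \<Longrightarrow> d x = e x"
  shows "d = e"
  using assms by (intro lin_hom_eqI[of d K B B e]) (auto simp: Der_simps)

section \<open>The enveloping algebra of an algebra\<close>

context
  fixes K :: "('k, 'kk) ring_scheme" and A :: "('k, 'a, 'aa) module_scheme"
  assumes A: "assoc_algebra K A"
begin

interpretation A: assoc_algebra K A by (rule A)

lemmas A_opp_modules = A.module_axioms assoc_algebra_module[OF opp_alg_assoc_algebra[OF A]]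

lemma env_alg_assoc_algebra: "assoc_algebra K (env_alg K A)"
  unfolding env_alg_def by (rule tensor_alg_assoc_algebra[OF A opp_alg_assoc_algebra[OF A]])

text \<open>Ae and the bare tensor product of A with its opposite share their linear structure and
  differ only as records. Rewriting towards Ae gives the general tensor lemmas the form in which
  \<open>env_alg\<close> occurs in the definitions.\<close>

lemma env_tensor_simps:
  "carrier (tensor K A (opp_alg A)) = carrier (env_alg K A)" "add (tensor K A (opp_alg A)) = add (env_alg K A)"
  "zero (tensor K A (opp_alg A)) = zero (env_alg K A)" "smult (tensor K A (opp_alg A)) = smult (env_alg K A)"
  by (simp_all add: env_alg_def tensor_alg_simps)

lemma env_lin_hom: "lin_hom K (tensor K A (opp_alg A)) P = lin_hom K (env_alg K A) P"
  by (simp add: lin_hom_def env_tensor_simps)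

lemma env_linear: "linear_map K (tensor K A (opp_alg A)) P = linear_map K (env_alg K A) P"
  by (simp add: linear_map_def env_tensor_simps fun_eq_iff)

lemma opp_bilinear: "bilinear_map K A (opp_alg A) P b = bilinear_map K A A P b"
  by (simp add: bilinear_map_def linear_map_def)

lemma env_pure_closed:
  "a \<in> carrier A \<Longrightarrow> b \<in> carrier A \<Longrightarrow> pure_tensor K A (opp_alg A) a b \<in> carrier (env_alg K A)"
  using pure_tensor_closed[OF A_opp_modules] by (simp add: env_tensor_simps)

lemma env_pure_bilinear: "bilinear_map K A A (env_alg K A) (pure_tensor K A (opp_alg A))"
  using pure_tensor_bilinear[OF A_opp_modules] by (simp add: bilinear_map_def linear_map_def env_tensor_simps)

lemma env_one: "\<one>\<^bsub>env_alg K A\<^esub> = pure_tensor K A (opp_alg A) \<one>\<^bsub>A\<^esub> \<one>\<^bsub>A\<^esub>"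
  by (simp add: env_alg_def tensor_alg_simps)

lemma env_mult_pure:
  "a \<in> carrier A \<Longrightarrow> b \<in> carrier A \<Longrightarrow> a' \<in> carrier A \<Longrightarrow> b' \<in> carrier A \<Longrightarrow>
   pure_tensor K A (opp_alg A) a b \<otimes>\<^bsub>env_alg K A\<^esub> pure_tensor K A (opp_alg A) a' b' =
   pure_tensor K A (opp_alg A) (a \<otimes>\<^bsub>A\<^esub> a') (b' \<otimes>\<^bsub>A\<^esub> b)"
  unfolding env_alg_def by (simp add: tensor_mult_pure[OF A opp_alg_assoc_algebra[OF A]])

lemma env_induct:
  assumes "x \<in> carrier (env_alg K A)"
    and "\<And>a b. a \<in> carrier A \<Longrightarrow> b \<in> carrier A \<Longrightarrow> Q (pure_tensor K A (opp_alg A) a b)"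
    and "\<And>x y. x \<in> carrier (env_alg K A) \<Longrightarrow> y \<in> carrier (env_alg K A) \<Longrightarrow> Q x \<Longrightarrow> Q y \<Longrightarrow> Q (x \<oplus>\<^bsub>env_alg K A\<^esub> y)"
  shows "Q x"
  using tensor_induct[OF A_opp_modules, of x Q] assms by (simp add: env_tensor_simps)

lemma env_linear_eq:
  assumes "linear_map K (env_alg K A) P f" "linear_map K (env_alg K A) P g"
    and "\<And>a b. a \<in> carrier A \<Longrightarrow> b \<in> carrier A \<Longrightarrow>
      f (pure_tensor K A (opp_alg A) a b) = g (pure_tensor K A (opp_alg A) a b)"
    and "x \<in> carrier (env_alg K A)"
  shows "f x = g x"
  using linear_map_eq_on_tensor[OF A_opp_modules, of P f g x] assms by (simp add: env_linear env_tensor_simps)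

lemma env_lift_hom:
  "module K P \<Longrightarrow> bilinear_map K A A P b \<Longrightarrow> tensor_lift K A (opp_alg A) P b \<in> lin_hom K (env_alg K A) P"
  using tensor_lift_hom[OF A_opp_modules, of P b] by (simp add: env_lin_hom opp_bilinear)

lemma env_lift_linear:
  "module K P \<Longrightarrow> bilinear_map K A A P b \<Longrightarrow> linear_map K (env_alg K A) P (tensor_lift K A (opp_alg A) P b)"
  using env_lift_hom[of P b] by (simp add: lin_hom_iff)

lemma env_lift_pure:
  "module K P \<Longrightarrow> bilinear_map K A A P b \<Longrightarrow> x \<in> carrier A \<Longrightarrow> y \<in> carrier A \<Longrightarrow>
   tensor_lift K A (opp_alg A) P b (pure_tensor K A (opp_alg A) x y) = b x y"
  using tensor_lift_pure[OF A_opp_modules, of P b x y] by (simp add: opp_bilinear)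

interpretation Ae: assoc_algebra K "env_alg K A" by (rule env_alg_assoc_algebra)

subsection \<open>Extending derivations to the enveloping algebra\<close>

lemma der_tensor_bilinear:
  assumes "linear_map K A A d"
  shows "bilinear_map K A A (env_alg K A)
    (\<lambda>a b. pure_tensor K A (opp_alg A) (d a) b \<oplus>\<^bsub>env_alg K A\<^esub> pure_tensor K A (opp_alg A) a (d b))"
  using linear_mapD[OF assms] bilinear_mapD[OF env_pure_bilinear]
  by (auto intro!: bilinear_mapI linear_mapI simp: Ae.smult_r_distr Ae.M.a_ac)

lemma der_tensor_linear: "linear_map K A A d \<Longrightarrow> linear_map K (env_alg K A) (env_alg K A) (der_tensor K A d)"
  unfolding der_tensor_def by (intro env_lift_linear Ae.module_axioms der_tensor_bilinear)

lemma der_tensor_pure: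
  "linear_map K A A d \<Longrightarrow> a \<in> carrier A \<Longrightarrow> b \<in> carrier A \<Longrightarrow>
   der_tensor K A d (pure_tensor K A (opp_alg A) a b) =
   pure_tensor K A (opp_alg A) (d a) b \<oplus>\<^bsub>env_alg K A\<^esub> pure_tensor K A (opp_alg A) a (d b)"
  unfolding der_tensor_def by (rule env_lift_pure[OF Ae.module_axioms der_tensor_bilinear])

text \<open>A derivation of A is also one of the opposite algebra, so on pure tensors both sides
  expand into the same four terms. Induction on x and then on y reduces to that case.\<close>

lemma der_tensor_Der:
  assumes d: "d \<in> carrier (Der K A)" shows "der_tensor K A d \<in> carrier (Der K (env_alg K A))"
proof -
  let ?D = "der_tensor K A d"
  note lin = Der_linear[OF d]
  note DL = linear_mapD[OF der_tensor_linear[OF lin]] and P = bilinear_mapD[OF env_pure_bilinear]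
  have "?D \<in> lin_hom K (env_alg K A) (env_alg K A)"
    unfolding der_tensor_def by (intro env_lift_hom Ae.module_axioms der_tensor_bilinear lin)
  moreover have "?D (x \<otimes>\<^bsub>env_alg K A\<^esub> y) =
      ?D x \<otimes>\<^bsub>env_alg K A\<^esub> y \<oplus>\<^bsub>env_alg K A\<^esub> x \<otimes>\<^bsub>env_alg K A\<^esub> ?D y"
    if x: "x \<in> carrier (env_alg K A)" and y: "y \<in> carrier (env_alg K A)" for x y
    using x
  proof (rule env_induct)
    fix a b assume ab: "a \<in> carrier A" "b \<in> carrier A"
    show "?D (pure_tensor K A (opp_alg A) a b \<otimes>\<^bsub>env_alg K A\<^esub> y) =
      ?D (pure_tensor K A (opp_alg A) a b) \<otimes>\<^bsub>env_alg K A\<^esub> y \<oplus>\<^bsub>env_alg K A\<^esub>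
      pure_tensor K A (opp_alg A) a b \<otimes>\<^bsub>env_alg K A\<^esub> ?D y"
      using y
    proof (rule env_induct)
      fix a' b' assume "a' \<in> carrier A" "b' \<in> carrier A"
      with ab show "?D (pure_tensor K A (opp_alg A) a b \<otimes>\<^bsub>env_alg K A\<^esub> pure_tensor K A (opp_alg A) a' b') =
        ?D (pure_tensor K A (opp_alg A) a b) \<otimes>\<^bsub>env_alg K A\<^esub> pure_tensor K A (opp_alg A) a' b' \<oplus>\<^bsub>env_alg K A\<^esub>
        pure_tensor K A (opp_alg A) a b \<otimes>\<^bsub>env_alg K A\<^esub> ?D (pure_tensor K A (opp_alg A) a' b')"
        by (simp add: env_mult_pure der_tensor_pure[OF lin] P linear_mapD[OF lin] Der_leibniz[OF d]
            Ae.M.l_distr Ae.M.r_distr Ae.M.a_ac)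
    qed (use ab in \<open>simp add: DL P Ae.M.r_distr Ae.M.a_ac\<close>)
  qed (use y in \<open>simp add: DL Ae.M.l_distr Ae.M.a_ac\<close>)
  ultimately show ?thesis by (simp add: Der_simps)
qed

text \<open>Together these say that passing from a derivation of A to one of Ae is a morphism of Lie
  algebras. This makes \<open>F_anch\<close> closed under its operations and lets the unit of the
  adjunction respect brackets.\<close>

lemma der_tensor_ops:
  assumes d: "d \<in> carrier (Der K A)" and e: "e \<in> carrier (Der K A)"
  shows "der_tensor K A (d \<oplus>\<^bsub>Der K A\<^esub> e) = der_tensor K A d \<oplus>\<^bsub>Der K (env_alg K A)\<^esub> der_tensor K A e"
    and "c \<in> carrier K \<Longrightarrow> der_tensor K A (c \<odot>\<^bsub>Der K A\<^esub> d) = c \<odot>\<^bsub>Der K (env_alg K A)\<^esub> der_tensor K A d"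
    and "der_tensor K A (bracket (Der K A) d e) =
      bracket (Der K (env_alg K A)) (der_tensor K A d) (der_tensor K A e)"
    and "der_tensor K A \<zero>\<^bsub>Der K A\<^esub> = \<zero>\<^bsub>Der K (env_alg K A)\<^esub>"
proof -
  interpret D: lie_algebra K "Der K A" by (rule Der_lie_algebra[OF A])
  interpret De: lie_algebra K "Der K (env_alg K A)" by (rule Der_lie_algebra[OF env_alg_assoc_algebra])
  note P = bilinear_mapD[OF env_pure_bilinear]
  note lin = Der_linear[OF d] Der_linear[OF e]
  note L = linear_mapD[OF lin(1)] linear_mapD[OF lin(2)]
  note EL = linear_mapD[OF der_tensor_linear[OF lin(1)]] linear_mapD[OF der_tensor_linear[OF lin(2)]]
  note DD = der_tensor_Der[OF d] der_tensor_Der[OF e]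
  have eqI: "D = E" if D: "D \<in> carrier (Der K (env_alg K A))" and E: "E \<in> carrier (Der K (env_alg K A))"
    and eq: "\<And>a b. a \<in> carrier A \<Longrightarrow> b \<in> carrier A \<Longrightarrow>
      D (pure_tensor K A (opp_alg A) a b) = E (pure_tensor K A (opp_alg A) a b)" for D E
    by (rule Der_eqI[OF D E env_linear_eq[OF Der_linear[OF D] Der_linear[OF E]]]) (simp_all add: eq)
  have sum: "d \<oplus>\<^bsub>Der K A\<^esub> e \<in> carrier (Der K A)" using d e by simp
  show "der_tensor K A (d \<oplus>\<^bsub>Der K A\<^esub> e) = der_tensor K A d \<oplus>\<^bsub>Der K (env_alg K A)\<^esub> der_tensor K A e"
    by (rule eqI[OF der_tensor_Der[OF sum]])
      (simp_all add: DD der_tensor_pure[OF Der_linear[OF sum]],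
        simp add: Der_simps(3) env_pure_closed der_tensor_pure[OF lin(1)] der_tensor_pure[OF lin(2)] P L Ae.M.a_ac)
  have br: "bracket (Der K A) d e \<in> carrier (Der K A)" using d e by (simp add: D.bracket_closed)
  have "der_tensor K A (bracket (Der K A) d e) (pure_tensor K A (opp_alg A) a b) =
      bracket (Der K (env_alg K A)) (der_tensor K A d) (der_tensor K A e) (pure_tensor K A (opp_alg A) a b)"
    if [simp]: "a \<in> carrier A" "b \<in> carrier A" for a b
  proof -
    let ?p = "pure_tensor K A (opp_alg A)"
    have minus: "?p (x \<ominus>\<^bsub>A\<^esub> y) z = ?p x z \<ominus>\<^bsub>env_alg K A\<^esub> ?p y z"
      "?p z (x \<ominus>\<^bsub>A\<^esub> y) = ?p z x \<ominus>\<^bsub>env_alg K A\<^esub> ?p z y"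
      if "x \<in> carrier A" "y \<in> carrier A" "z \<in> carrier A" for x y z
      using that linear_map_minus[OF A.module_axioms Ae.module_axioms bilinear_map_left[OF env_pure_bilinear]]
        linear_map_minus[OF A.module_axioms Ae.module_axioms bilinear_map_right[OF env_pure_bilinear]]
      by simp_all
    have cl: "d a \<in> carrier A" "d b \<in> carrier A" "e a \<in> carrier A" "e b \<in> carrier A" by (simp_all add: L)
    \<comment> \<open>Here u and v are the mixed terms e(a) \<otimes> d(b) and d(a) \<otimes> e(b),
      which occur in both composites of the two extended derivations and cancel in their
      difference.\<close>
    have arith: "(p \<ominus>\<^bsub>env_alg K A\<^esub> q) \<oplus>\<^bsub>env_alg K A\<^esub> (r \<ominus>\<^bsub>env_alg K A\<^esub> s) =
        ((p \<oplus>\<^bsub>env_alg K A\<^esub> u) \<oplus>\<^bsub>env_alg K A\<^esub> (v \<oplus>\<^bsub>env_alg K A\<^esub> r)) \<ominus>\<^bsub>env_alg K A\<^esub>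
        ((q \<oplus>\<^bsub>env_alg K A\<^esub> v) \<oplus>\<^bsub>env_alg K A\<^esub> (u \<oplus>\<^bsub>env_alg K A\<^esub> s))"
      if "p \<in> carrier (env_alg K A)" "q \<in> carrier (env_alg K A)" "r \<in> carrier (env_alg K A)"
        "s \<in> carrier (env_alg K A)" "u \<in> carrier (env_alg K A)" "v \<in> carrier (env_alg K A)" for p q r s u v
      using that by algebra
    have "der_tensor K A (bracket (Der K A) d e) (?p a b) =
        (?p (d (e a)) b \<ominus>\<^bsub>env_alg K A\<^esub> ?p (e (d a)) b) \<oplus>\<^bsub>env_alg K A\<^esub>
        (?p a (d (e b)) \<ominus>\<^bsub>env_alg K A\<^esub> ?p a (e (d b)))"
      by (simp add: der_tensor_pure[OF Der_linear[OF br]]) (simp add: Der_simps(5) minus L)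
    also have "\<dots> = ((?p (d (e a)) b \<oplus>\<^bsub>env_alg K A\<^esub> ?p (e a) (d b)) \<oplus>\<^bsub>env_alg K A\<^esub>
          (?p (d a) (e b) \<oplus>\<^bsub>env_alg K A\<^esub> ?p a (d (e b)))) \<ominus>\<^bsub>env_alg K A\<^esub>
        ((?p (e (d a)) b \<oplus>\<^bsub>env_alg K A\<^esub> ?p (d a) (e b)) \<oplus>\<^bsub>env_alg K A\<^esub>
          (?p (e a) (d b) \<oplus>\<^bsub>env_alg K A\<^esub> ?p a (e (d b))))"
      by (rule arith) (simp_all add: env_pure_closed L)
    also have "\<dots> = bracket (Der K (env_alg K A)) (der_tensor K A d) (der_tensor K A e) (?p a b)"
      by (simp add: Der_simps(5) env_pure_closed der_tensor_pure[OF lin(1)] der_tensor_pure[OF lin(2)] EL cl)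
    finally show ?thesis .
  qed
  then show "der_tensor K A (bracket (Der K A) d e) =
      bracket (Der K (env_alg K A)) (der_tensor K A d) (der_tensor K A e)"
    by (intro eqI der_tensor_Der br De.bracket_closed DD)
  have zero: "\<zero>\<^bsub>Der K A\<^esub> \<in> carrier (Der K A)" by simp
  show "der_tensor K A \<zero>\<^bsub>Der K A\<^esub> = \<zero>\<^bsub>Der K (env_alg K A)\<^esub>"
  proof (rule eqI[OF der_tensor_Der[OF zero]])
    fix a b assume [simp]: "a \<in> carrier A" "b \<in> carrier A"
    have "pure_tensor K A (opp_alg A) \<zero>\<^bsub>A\<^esub> b = \<zero>\<^bsub>env_alg K A\<^esub>" "pure_tensor K A (opp_alg A) a \<zero>\<^bsub>A\<^esub> = \<zero>\<^bsub>env_alg K A\<^esub>"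
      using linear_map_zero[OF A.module_axioms Ae.module_axioms bilinear_map_left[OF env_pure_bilinear, of b]]
        linear_map_zero[OF A.module_axioms Ae.module_axioms bilinear_map_right[OF env_pure_bilinear, of a]] by simp_all
    then show "der_tensor K A \<zero>\<^bsub>Der K A\<^esub> (pure_tensor K A (opp_alg A) a b) =
        \<zero>\<^bsub>Der K (env_alg K A)\<^esub> (pure_tensor K A (opp_alg A) a b)"
      by (simp add: der_tensor_pure[OF Der_linear[OF zero]]) (simp add: Der_simps(2) env_pure_closed)
  qed simp
  assume c: "c \<in> carrier K"
  have sc: "c \<odot>\<^bsub>Der K A\<^esub> d \<in> carrier (Der K A)" using c d by simp
  show "der_tensor K A (c \<odot>\<^bsub>Der K A\<^esub> d) = c \<odot>\<^bsub>Der K (env_alg K A)\<^esub> der_tensor K A d"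
    by (rule eqI[OF der_tensor_Der[OF sc]])
      (simp_all add: c DD der_tensor_pure[OF Der_linear[OF sc]],
        simp add: c Der_simps(4) env_pure_closed der_tensor_pure[OF lin(1)] P L Ae.smult_r_distr)
qed

end

section \<open>The right adjoint\<close>

lemma L_ring_simps:
  "(r, d) \<in> carrier (L_ring K B R) \<longleftrightarrow> r \<in> carrier R \<and> d \<in> carrier (Der K B) \<and>
     (\<forall>b \<in> carrier B. r \<otimes>\<^bsub>R\<^esub> str R b \<ominus>\<^bsub>R\<^esub> str R b \<otimes>\<^bsub>R\<^esub> r = str R (d b))"
  "zero (L_ring K B R) = (\<zero>\<^bsub>R\<^esub>, \<zero>\<^bsub>Der K B\<^esub>)"
  "add (L_ring K B R) (r, d) (s, e) = (r \<oplus>\<^bsub>R\<^esub> s, d \<oplus>\<^bsub>Der K B\<^esub> e)"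
  "smult (L_ring K B R) c (r, d) = (c \<odot>\<^bsub>R\<^esub> r, c \<odot>\<^bsub>Der K B\<^esub> d)"
  "bracket (L_ring K B R) (r, d) (s, e) = (r \<otimes>\<^bsub>R\<^esub> s \<ominus>\<^bsub>R\<^esub> s \<otimes>\<^bsub>R\<^esub> r, bracket (Der K B) d e)"
  "(r, d) \<in> carrier (L_ring K B R) \<Longrightarrow> anchor (L_ring K B R) (r, d) = d"
  by (simp_all add: L_ring_def Let_def)

lemma anchor_extensional: "anchor (L_ring K B R) \<in> extensional (carrier (L_ring K B R))"
  by (simp add: L_ring_def Let_def)

lemma L_ring_anch_lie:
  assumes B: "assoc_algebra K B" and R: "is_b_ring K B R"
  shows "is_anch_lie K B (L_ring K B R)"
proof -
  have RA: "assoc_algebra K R" and hom: "str R \<in> alg_hom K B R" using R by (simp_all add: is_b_ring_def)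
  interpret B: assoc_algebra K B by fact
  interpret R: assoc_algebra K R by (rule RA)
  interpret D: lie_algebra K "Der K B" by (rule Der_lie_algebra[OF B])
  let ?L = "L_ring K B R"
  note h = alg_homD[OF hom]
  have Dv: "d b \<in> carrier B" if "d \<in> carrier (Der K B)" "b \<in> carrier B" for d b
    by (rule linear_map_closed[OF Der_linear[OF that(1)] that(2)])
  have hminus: "str R (x \<ominus>\<^bsub>B\<^esub> y) = str R x \<ominus>\<^bsub>R\<^esub> str R y" if "x \<in> carrier B" "y \<in> carrier B" for x y
    using that by (rule linear_map_minus[OF B.module_axioms R.module_axioms alg_hom_linear[OF hom]])
  have hzero: "str R \<zero>\<^bsub>B\<^esub> = \<zero>\<^bsub>R\<^esub>"
    by (rule linear_map_zero[OF B.module_axioms R.module_axioms alg_hom_linear[OF hom]])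
  have "lie_algebra K ?L"
  proof (rule lie_subalgebra[OF prod_lie_lie_algebra[OF commutator_lie_lie_algebra[OF RA] Der_lie_algebra[OF B]]])
    show "carrier ?L \<subseteq> carrier (prod_lie (commutator_lie R) (Der K B))"
      by (auto simp: L_ring_simps prod_lie_def commutator_lie_simps)
    show "\<zero>\<^bsub>?L\<^esub> = \<zero>\<^bsub>prod_lie (commutator_lie R) (Der K B)\<^esub>"
      by (simp add: L_ring_simps prod_lie_def commutator_lie_simps)
    show "\<zero>\<^bsub>?L\<^esub> \<in> carrier ?L"
      by (simp add: L_ring_simps h) (simp add: Der_simps h hzero a_minus_def)
    fix p assume p: "p \<in> carrier ?L"
    obtain r d where rd: "p = (r, d)" "r \<in> carrier R" "d \<in> carrier (Der K B)"
      "\<And>b. b \<in> carrier B \<Longrightarrow> r \<otimes>\<^bsub>R\<^esub> str R b \<ominus>\<^bsub>R\<^esub> str R b \<otimes>\<^bsub>R\<^esub> r = str R (d b)"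
      using p by (cases p) (auto simp: L_ring_simps)
    {
      fix c assume c: "c \<in> carrier K"
      have "(c \<odot>\<^bsub>R\<^esub> r) \<otimes>\<^bsub>R\<^esub> str R b \<ominus>\<^bsub>R\<^esub> str R b \<otimes>\<^bsub>R\<^esub> (c \<odot>\<^bsub>R\<^esub> r) = str R (c \<odot>\<^bsub>B\<^esub> d b)"
        if b: "b \<in> carrier B" for b
      proof -
        have "(c \<odot>\<^bsub>R\<^esub> r) \<otimes>\<^bsub>R\<^esub> str R b \<ominus>\<^bsub>R\<^esub> str R b \<otimes>\<^bsub>R\<^esub> (c \<odot>\<^bsub>R\<^esub> r) =
            c \<odot>\<^bsub>R\<^esub> (r \<otimes>\<^bsub>R\<^esub> str R b \<ominus>\<^bsub>R\<^esub> str R b \<otimes>\<^bsub>R\<^esub> r)"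
          using c b rd(2) by (simp add: h a_minus_def R.smult_mult_left R.smult_mult_right R.smult_r_distr R.smult_r_minus)
        with c b rd show ?thesis by (simp add: h Dv)
      qed
      then have "(c \<odot>\<^bsub>R\<^esub> r, c \<odot>\<^bsub>Der K B\<^esub> d) \<in> carrier ?L"
        using c rd(2,3) D.smult_closed[OF c rd(3)] by (simp add: L_ring_simps) (simp add: Der_simps(4))
      then show "c \<odot>\<^bsub>?L\<^esub> p = c \<odot>\<^bsub>prod_lie (commutator_lie R) (Der K B)\<^esub> p \<and>
          c \<odot>\<^bsub>prod_lie (commutator_lie R) (Der K B)\<^esub> p \<in> carrier ?L"
        by (simp add: rd(1) L_ring_simps(4) prod_lie_def commutator_lie_simps)
    }
    fix q assume q: "q \<in> carrier ?L"
    obtain s e where se: "q = (s, e)" "s \<in> carrier R" "e \<in> carrier (Der K B)"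
      "\<And>b. b \<in> carrier B \<Longrightarrow> s \<otimes>\<^bsub>R\<^esub> str R b \<ominus>\<^bsub>R\<^esub> str R b \<otimes>\<^bsub>R\<^esub> s = str R (e b)"
      using q by (cases q) (auto simp: L_ring_simps)
    have "(r \<oplus>\<^bsub>R\<^esub> s) \<otimes>\<^bsub>R\<^esub> str R b \<ominus>\<^bsub>R\<^esub> str R b \<otimes>\<^bsub>R\<^esub> (r \<oplus>\<^bsub>R\<^esub> s) = str R (d b \<oplus>\<^bsub>B\<^esub> e b)"
      if b: "b \<in> carrier B" for b
    proof -
      have "(r \<oplus>\<^bsub>R\<^esub> s) \<otimes>\<^bsub>R\<^esub> x \<ominus>\<^bsub>R\<^esub> x \<otimes>\<^bsub>R\<^esub> (r \<oplus>\<^bsub>R\<^esub> s) =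
          (r \<otimes>\<^bsub>R\<^esub> x \<ominus>\<^bsub>R\<^esub> x \<otimes>\<^bsub>R\<^esub> r) \<oplus>\<^bsub>R\<^esub> (s \<otimes>\<^bsub>R\<^esub> x \<ominus>\<^bsub>R\<^esub> x \<otimes>\<^bsub>R\<^esub> s)" if "x \<in> carrier R" for x
        using that rd(2) se(2) by algebra
      with b rd se show ?thesis by (simp add: h Dv)
    qed
    then have "(r \<oplus>\<^bsub>R\<^esub> s, d \<oplus>\<^bsub>Der K B\<^esub> e) \<in> carrier ?L"
      using rd(2,3) se(2,3) D.M.a_closed[OF rd(3) se(3)] by (simp add: L_ring_simps) (simp add: Der_simps(3))
    then show "p \<oplus>\<^bsub>?L\<^esub> q = p \<oplus>\<^bsub>prod_lie (commutator_lie R) (Der K B)\<^esub> q \<and>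
        p \<oplus>\<^bsub>prod_lie (commutator_lie R) (Der K B)\<^esub> q \<in> carrier ?L"
      by (simp add: rd(1) se(1) L_ring_simps(3) prod_lie_def commutator_lie_simps)
    have "(r \<otimes>\<^bsub>R\<^esub> s \<ominus>\<^bsub>R\<^esub> s \<otimes>\<^bsub>R\<^esub> r) \<otimes>\<^bsub>R\<^esub> str R b \<ominus>\<^bsub>R\<^esub> str R b \<otimes>\<^bsub>R\<^esub> (r \<otimes>\<^bsub>R\<^esub> s \<ominus>\<^bsub>R\<^esub> s \<otimes>\<^bsub>R\<^esub> r) =
        str R (d (e b) \<ominus>\<^bsub>B\<^esub> e (d b))"
      if b: "b \<in> carrier B" for b
    proof -
      \<comment> \<open>The Jacobi identity as [[r, s], x] = [r, [s, x]] - [s, [r, x]]. With x in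
        the image of the structure map, the inner commutators lie again in that image, and the
        conditions on r and s apply a second time.\<close>
      have "(r \<otimes>\<^bsub>R\<^esub> s \<ominus>\<^bsub>R\<^esub> s \<otimes>\<^bsub>R\<^esub> r) \<otimes>\<^bsub>R\<^esub> x \<ominus>\<^bsub>R\<^esub> x \<otimes>\<^bsub>R\<^esub> (r \<otimes>\<^bsub>R\<^esub> s \<ominus>\<^bsub>R\<^esub> s \<otimes>\<^bsub>R\<^esub> r) =
          (r \<otimes>\<^bsub>R\<^esub> (s \<otimes>\<^bsub>R\<^esub> x \<ominus>\<^bsub>R\<^esub> x \<otimes>\<^bsub>R\<^esub> s) \<ominus>\<^bsub>R\<^esub> (s \<otimes>\<^bsub>R\<^esub> x \<ominus>\<^bsub>R\<^esub> x \<otimes>\<^bsub>R\<^esub> s) \<otimes>\<^bsub>R\<^esub> r) \<ominus>\<^bsub>R\<^esub>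
          (s \<otimes>\<^bsub>R\<^esub> (r \<otimes>\<^bsub>R\<^esub> x \<ominus>\<^bsub>R\<^esub> x \<otimes>\<^bsub>R\<^esub> r) \<ominus>\<^bsub>R\<^esub> (r \<otimes>\<^bsub>R\<^esub> x \<ominus>\<^bsub>R\<^esub> x \<otimes>\<^bsub>R\<^esub> r) \<otimes>\<^bsub>R\<^esub> s)"
        if "x \<in> carrier R" for x
        using that rd(2) se(2) by algebra
      with b rd se show ?thesis by (simp add: h Dv hminus)
    qed
    then have "(r \<otimes>\<^bsub>R\<^esub> s \<ominus>\<^bsub>R\<^esub> s \<otimes>\<^bsub>R\<^esub> r, bracket (Der K B) d e) \<in> carrier ?L"
      using rd(2,3) se(2,3) D.bracket_closed[OF rd(3) se(3)] by (simp add: L_ring_simps) (simp add: Der_simps(5))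
    then show "bracket ?L p q = bracket (prod_lie (commutator_lie R) (Der K B)) p q \<and>
        bracket (prod_lie (commutator_lie R) (Der K B)) p q \<in> carrier ?L"
      by (simp add: rd(1) se(1) L_ring_simps(5) prod_lie_def commutator_lie_simps)
  qed
  then interpret L: lie_algebra K ?L .
  have fst: "snd p \<in> carrier (Der K B) \<and> anchor ?L p = snd p" if "p \<in> carrier ?L" for p
    using that by (cases p) (simp add: L_ring_simps(6), simp add: L_ring_simps(1))
  have "anchor ?L \<in> lie_hom K ?L (Der K B)"
    unfolding lie_hom_def lin_hom_iff using anchor_extensional
    by (auto intro!: linear_mapI simp: fst L.bracket_closed)
      (auto simp: L_ring_simps(1,3-5))
  then show ?thesis by (simp add: is_anch_lie_def L.lie_algebra_axioms)
qed

lemma F_anch_simps: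
  "(x, d) \<in> carrier (F_anch K A M) \<longleftrightarrow> x \<in> carrier M \<and> d \<in> carrier (Der K A) \<and> anchor M x = der_tensor K A d"
  "zero (F_anch K A M) = (\<zero>\<^bsub>M\<^esub>, \<zero>\<^bsub>Der K A\<^esub>)"
  "add (F_anch K A M) (x, d) (y, e) = (x \<oplus>\<^bsub>M\<^esub> y, d \<oplus>\<^bsub>Der K A\<^esub> e)"
  "smult (F_anch K A M) c (x, d) = (c \<odot>\<^bsub>M\<^esub> x, c \<odot>\<^bsub>Der K A\<^esub> d)"
  "bracket (F_anch K A M) (x, d) (y, e) = (bracket M x y, bracket (Der K A) d e)"
  "(x, d) \<in> carrier (F_anch K A M) \<Longrightarrow> anchor (F_anch K A M) (x, d) = d"
  by (simp_all add: F_anch_def Let_def)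

text \<open>The pairs form the fibre product of \<open>anchor M\<close> and
  \<open>der_tensor\<close> over the derivations of Ae. Closure under the operations says that both
  maps are morphisms of Lie algebras.\<close>

lemma F_anch_anch_lie:
  assumes A: "assoc_algebra K A" and M: "is_anch_lie K (env_alg K A) M"
  shows "is_anch_lie K A (F_anch K A M)"
proof -
  have lieM: "lie_algebra K M" and anch: "anchor M \<in> lie_hom K M (Der K (env_alg K A))"
    using M by (simp_all add: is_anch_lie_def)
  interpret M: lie_algebra K M by (rule lieM)
  interpret D: lie_algebra K "Der K A" by (rule Der_lie_algebra[OF A])
  interpret De: lie_algebra K "Der K (env_alg K A)" by (rule Der_lie_algebra[OF env_alg_assoc_algebra[OF A]])
  let ?L = "F_anch K A M"
  have lin: "linear_map K M (Der K (env_alg K A)) (anchor M)"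
    and br: "\<And>x y. x \<in> carrier M \<Longrightarrow> y \<in> carrier M
      \<Longrightarrow> anchor M (bracket M x y) = bracket (Der K (env_alg K A)) (anchor M x) (anchor M y)"
    using anch by (auto simp: lie_hom_def lin_hom_iff)
  note ops = der_tensor_ops[OF A]
  have "lie_algebra K ?L"
  proof (rule lie_subalgebra[OF prod_lie_lie_algebra[OF lieM Der_lie_algebra[OF A]]])
    have z: "\<zero>\<^bsub>Der K A\<^esub> \<in> carrier (Der K A)" by simp
    show "\<zero>\<^bsub>?L\<^esub> \<in> carrier ?L"
      by (simp add: F_anch_simps linear_map_zero[OF M.module_axioms De.module_axioms lin] ops(4)[OF z z])
  qed (auto simp: F_anch_simps prod_lie_def M.bracket_closed D.bracket_closed linear_mapD[OF lin] ops(1-3) br)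
  then interpret L: lie_algebra K ?L .
  have snd: "snd p \<in> carrier (Der K A) \<and> anchor ?L p = snd p" if "p \<in> carrier ?L" for p
    using that by (cases p) (simp add: F_anch_simps(6), simp add: F_anch_simps(1))
  have "anchor ?L \<in> extensional (carrier ?L)" by (simp add: F_anch_def Let_def)
  then have "anchor ?L \<in> lie_hom K ?L (Der K A)"
    unfolding lie_hom_def lin_hom_iff
    by (auto intro!: linear_mapI simp: snd L.bracket_closed) (auto simp: F_anch_simps(1,3-5))
  then show ?thesis by (simp add: is_anch_lie_def L.lie_algebra_axioms)
qed

section \<open>The composite functor \<open>LA\<close> on objects and on morphisms\<close>

context
  fixes K :: "('k, 'kk) ring_scheme" and A :: "('k, 'a, 'aa) module_scheme"
  assumes A: "assoc_algebra K A"
begin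

lemma LA_anch_lie: "is_b_ring K (env_alg K A) R \<Longrightarrow> is_anch_lie K A (LA K A R)"
  unfolding LA_def by (intro F_anch_anch_lie L_ring_anch_lie A env_alg_assoc_algebra)

text \<open>The middle component D is determined by d, and \<open>der_tensor_Der\<close> supplies
  its being a derivation. An element is thus in substance a pair (r, d) such that commutation with r
  induces the extension of d on the image of Ae.\<close>

lemma LA_carrier:
  "((r, D), d) \<in> carrier (LA K A R) \<longleftrightarrow> r \<in> carrier R \<and> d \<in> carrier (Der K A) \<and> D = der_tensor K A d \<and>
     (\<forall>x \<in> carrier (env_alg K A). r \<otimes>\<^bsub>R\<^esub> str R x \<ominus>\<^bsub>R\<^esub> str R x \<otimes>\<^bsub>R\<^esub> r = str R (D x))"
proof -
  have "((r, D), d) \<in> carrier (LA K A R) \<longleftrightarrow>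
      (r, D) \<in> carrier (L_ring K (env_alg K A) R) \<and> d \<in> carrier (Der K A) \<and> D = der_tensor K A d"
    unfolding LA_def F_anch_simps(1) by (auto simp: L_ring_simps(6))
  then show ?thesis using der_tensor_Der[OF A] by (auto simp: L_ring_simps(1))
qed

lemma LA_ops:
  "add (LA K A R) ((r, D), d) ((s, E), e) = ((r \<oplus>\<^bsub>R\<^esub> s, D \<oplus>\<^bsub>Der K (env_alg K A)\<^esub> E), d \<oplus>\<^bsub>Der K A\<^esub> e)"
  "smult (LA K A R) c ((r, D), d) = ((c \<odot>\<^bsub>R\<^esub> r, c \<odot>\<^bsub>Der K (env_alg K A)\<^esub> D), c \<odot>\<^bsub>Der K A\<^esub> d)"
  "bracket (LA K A R) ((r, D), d) ((s, E), e) =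
    ((r \<otimes>\<^bsub>R\<^esub> s \<ominus>\<^bsub>R\<^esub> s \<otimes>\<^bsub>R\<^esub> r, bracket (Der K (env_alg K A)) D E), bracket (Der K A) d e)"
  by (simp_all add: LA_def F_anch_simps(3-5) L_ring_simps(3-5))

lemma LA_anchor: "((r, D), d) \<in> carrier (LA K A R) \<Longrightarrow> anchor (LA K A R) ((r, D), d) = d"
  by (simp add: LA_def F_anch_simps(6))

lemma LA_map_apply:
  assumes "((r, D), d) \<in> carrier (LA K A R)" shows "LA_map K A R h ((r, D), d) = ((h r, D), d)"
proof -
  have "(r, D) \<in> carrier (L_ring K (env_alg K A) R)"
    using assms unfolding LA_def F_anch_simps(1) by simp
  with assms show ?thesis
    by (simp add: LA_map_def F_anch_map_def L_ring_map_def LA_def)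
qed

lemma LA_map_extensional: "LA_map K A R h \<in> extensional (carrier (LA K A R))"
  by (simp add: LA_map_def F_anch_map_def LA_def)

lemma LA_map_id: "LA_map K A R (\<lambda>x\<in>carrier R. x) = (\<lambda>x\<in>carrier (LA K A R). x)"
proof (rule extensionalityI[OF LA_map_extensional restrict_extensional])
  fix p assume "p \<in> carrier (LA K A R)"
  moreover obtain r D d where "p = ((r, D), d)" by (metis prod.collapse)
  ultimately show "LA_map K A R (\<lambda>x\<in>carrier R. x) p = (\<lambda>x\<in>carrier (LA K A R). x) p"
    by (simp add: LA_map_apply) (simp add: LA_carrier)
qed

text \<open>Applying h to the commutator condition for r gives the condition for h r, since h
  carries one structure map to the other.\<close>

lemma LA_map_closed:
  assumes R: "is_b_ring K (env_alg K A) R" and R': "is_b_ring K (env_alg K A) R'"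
    and h: "h \<in> b_ring_hom K (env_alg K A) R R'" and p: "((r, D), d) \<in> carrier (LA K A R)"
  shows "((h r, D), d) \<in> carrier (LA K A R')"
proof -
  interpret R: assoc_algebra K R using R by (simp add: is_b_ring_def)
  interpret R': assoc_algebra K R' using R' by (simp add: is_b_ring_def)
  have hom: "h \<in> alg_hom K R R'" and str: "\<And>x. x \<in> carrier (env_alg K A) \<Longrightarrow> h (str R x) = str R' x"
    using h by (auto simp: b_ring_hom_def)
  note hm = alg_homD[OF hom]
  have "str R \<in> alg_hom K (env_alg K A) R" using R by (simp add: is_b_ring_def)
  then have sc: "str R x \<in> carrier R" if "x \<in> carrier (env_alg K A)" for x using that by (rule alg_hom_closed)
  have rd: "r \<in> carrier R" "d \<in> carrier (Der K A)" "D = der_tensor K A d"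
    "\<And>x. x \<in> carrier (env_alg K A) \<Longrightarrow> r \<otimes>\<^bsub>R\<^esub> str R x \<ominus>\<^bsub>R\<^esub> str R x \<otimes>\<^bsub>R\<^esub> r = str R (D x)"
    using p by (auto simp: LA_carrier)
  have "h r \<otimes>\<^bsub>R'\<^esub> str R' x \<ominus>\<^bsub>R'\<^esub> str R' x \<otimes>\<^bsub>R'\<^esub> h r = str R' (D x)"
    if x: "x \<in> carrier (env_alg K A)" for x
  proof -
    have Dx: "D x \<in> carrier (env_alg K A)"
      unfolding rd(3) by (rule linear_map_closed[OF Der_linear[OF der_tensor_Der[OF A rd(2)]] x])
    have "h (r \<otimes>\<^bsub>R\<^esub> str R x \<ominus>\<^bsub>R\<^esub> str R x \<otimes>\<^bsub>R\<^esub> r) = h r \<otimes>\<^bsub>R'\<^esub> str R' x \<ominus>\<^bsub>R'\<^esub> str R' x \<otimes>\<^bsub>R'\<^esub> h r"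
      using x rd(1) sc[OF x]
      by (simp add: linear_map_minus[OF R.module_axioms R'.module_axioms alg_hom_linear[OF hom]] hm str)
    then show ?thesis using rd(4)[OF x] str[OF Dx] by simp
  qed
  then show ?thesis using rd by (simp add: LA_carrier hm)
qed

lemma LA_map_hom:
  assumes R: "is_b_ring K (env_alg K A) R" and R': "is_b_ring K (env_alg K A) R'"
    and h: "h \<in> b_ring_hom K (env_alg K A) R R'"
  shows "LA_map K A R h \<in> anch_hom K (LA K A R) (LA K A R')"
proof -
  interpret R: assoc_algebra K R using R by (simp add: is_b_ring_def)
  interpret R': assoc_algebra K R' using R' by (simp add: is_b_ring_def)
  interpret LR: lie_algebra K "LA K A R" using LA_anch_lie[OF R] by (simp add: is_anch_lie_def)
  have hom: "h \<in> alg_hom K R R'" using h by (auto simp: b_ring_hom_def)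
  note hm = alg_homD[OF hom] linear_map_minus[OF R.module_axioms R'.module_axioms alg_hom_linear[OF hom]]
  note cl = LA_map_closed[OF R R' h]
  have cases: thesis if "p \<in> carrier (LA K A R)"
    "\<And>r D d. p = ((r, D), d) \<Longrightarrow> ((r, D), d) \<in> carrier (LA K A R) \<Longrightarrow> r \<in> carrier R \<Longrightarrow> thesis" for p thesis
    using that by (cases p; cases "fst p") (auto simp: LA_carrier)
  have "LA_map K A R h \<in> lie_hom K (LA K A R) (LA K A R')"
    unfolding lie_hom_def lin_hom_iff
  proof (intro CollectI conjI ballI linear_mapI LA_map_extensional)
    fix p assume p: "p \<in> carrier (LA K A R)"
    then obtain r D d where rd: "p = ((r, D), d)" "((r, D), d) \<in> carrier (LA K A R)" "r \<in> carrier R"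
      by (rule cases)
    show "LA_map K A R h p \<in> carrier (LA K A R')" using rd(2) by (simp add: rd(1) LA_map_apply cl)
    {
      fix c assume c: "c \<in> carrier K"
      show "LA_map K A R h (c \<odot>\<^bsub>LA K A R\<^esub> p) = c \<odot>\<^bsub>LA K A R'\<^esub> LA_map K A R h p"
        using LR.smult_closed[OF c p] rd c by (simp add: LA_ops LA_map_apply hm)
    }
    fix q assume q: "q \<in> carrier (LA K A R)"
    then obtain s E e where se: "q = ((s, E), e)" "((s, E), e) \<in> carrier (LA K A R)" "s \<in> carrier R"
      by (rule cases)
    show "LA_map K A R h (p \<oplus>\<^bsub>LA K A R\<^esub> q) = LA_map K A R h p \<oplus>\<^bsub>LA K A R'\<^esub> LA_map K A R h q"
      using LR.M.a_closed[OF p q] rd se by (simp add: LA_ops LA_map_apply hm)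
    show "LA_map K A R h (bracket (LA K A R) p q) = bracket (LA K A R') (LA_map K A R h p) (LA_map K A R h q)"
      using LR.bracket_closed[OF p q] rd se by (simp add: LA_ops LA_map_apply hm)
  qed
  moreover have "anchor (LA K A R') (LA_map K A R h p) = anchor (LA K A R) p" if "p \<in> carrier (LA K A R)" for p
    using that by (rule cases) (simp add: LA_map_apply cl LA_anchor)
  ultimately show ?thesis by (simp add: anch_hom_def)
qed

lemma LA_map_compose:
  assumes R: "is_b_ring K (env_alg K A) R" and R': "is_b_ring K (env_alg K A) R'"
    and h: "h \<in> b_ring_hom K (env_alg K A) R R'"
  shows "LA_map K A R (compose (carrier R) h' h) = compose (carrier (LA K A R)) (LA_map K A R' h') (LA_map K A R h)"
proof (rule extensionalityI[OF LA_map_extensional compose_extensional])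
  fix p assume p: "p \<in> carrier (LA K A R)"
  moreover obtain r D d where "p = ((r, D), d)" by (metis prod.collapse)
  moreover have "r \<in> carrier R" using calculation by (simp add: LA_carrier)
  ultimately show "LA_map K A R (compose (carrier R) h' h) p =
      compose (carrier (LA K A R)) (LA_map K A R' h') (LA_map K A R h) p"
    using LA_map_closed[OF R R' h] by (simp add: compose_eq LA_map_apply)
qed

end

section \<open>Representations of the universal enveloping algebra\<close>

text \<open>A representation is a bilinear map in two curried arguments rather than an algebra
  morphism into \<open>End_alg\<close>: the lemmas on bilinear maps then apply to it, and no
  extensionality is imposed on the operators.\<close>

definition uea_rep ::
  "('k, 'kk) ring_scheme \<Rightarrow> ('k, 'l, 'll) lie_scheme \<Rightarrow> ('k, 'm, 'mm) module_scheme
     \<Rightarrow> (('k, 'l) env \<Rightarrow> 'm \<Rightarrow> 'm) \<Rightarrow> bool" where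
  "uea_rep K L M \<rho> \<longleftrightarrow> bilinear_map K (uea K L) M M \<rho> \<and>
     (\<forall>m \<in> carrier M. \<rho> \<one>\<^bsub>uea K L\<^esub> m = m) \<and>
     (\<forall>u \<in> carrier (uea K L). \<forall>v \<in> carrier (uea K L). \<forall>m \<in> carrier M.
        \<rho> (u \<otimes>\<^bsub>uea K L\<^esub> v) m = \<rho> u (\<rho> v m))"

lemma uea_rep_bilinear: "uea_rep K L M \<rho> \<Longrightarrow> bilinear_map K (uea K L) M M \<rho>"
  and uea_rep_one: "uea_rep K L M \<rho> \<Longrightarrow> m \<in> carrier M \<Longrightarrow> \<rho> \<one>\<^bsub>uea K L\<^esub> m = m"
  and uea_rep_mult:
    "uea_rep K L M \<rho> \<Longrightarrow> u \<in> carrier (uea K L) \<Longrightarrow> v \<in> carrier (uea K L) \<Longrightarrow> m \<in> carrier M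
      \<Longrightarrow> \<rho> (u \<otimes>\<^bsub>uea K L\<^esub> v) m = \<rho> u (\<rho> v m)"
  by (auto simp: uea_rep_def)

lemma uea_rep_cong:
  assumes "uea_rep K L M \<rho>" "carrier M' = carrier M" "add M' = add M" "smult M' = smult M"
  shows "uea_rep K L M' \<rho>"
  using assms by (simp add: uea_rep_def bilinear_map_def linear_map_def)

text \<open>The tensor product of two representations, that is, the factorwise action of U \<otimes>
  U restricted along \<Delta>.\<close>

definition tensor_act ::
  "('k, 'kk) ring_scheme \<Rightarrow> ('k, 'l, 'll) lie_scheme \<Rightarrow> ('k, 'm, 'mm) module_scheme \<Rightarrow> ('k, 'n, 'nn) module_scheme
     \<Rightarrow> (('k, 'l) env \<Rightarrow> 'm \<Rightarrow> 'm) \<Rightarrow> (('k, 'l) env \<Rightarrow> 'n \<Rightarrow> 'n)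
     \<Rightarrow> ('k, 'l) env \<Rightarrow> ('k, 'm, 'n) tens \<Rightarrow> ('k, 'm, 'n) tens" where
  "tensor_act K L M N \<rho> \<sigma> u t =
     tensor_lift K (uea K L) (uea K L) (tensor K M N) (\<lambda>u1 u2.
       tensor_lift K M N (tensor K M N) (\<lambda>m n. pure_tensor K M N (\<rho> u1 m) (\<sigma> u2 n)) t) (comult K L u)"

context
  fixes K :: "('k, 'kk) ring_scheme" and L :: "('k, 'l, 'll) lie_scheme"
  assumes L: "lie_algebra K L"
begin

interpretation L: lie_algebra K L by (rule L)
interpretation U: assoc_algebra K "uea K L" by (rule uea_assoc_algebra[OF L])
interpretation UU: assoc_algebra K "tensor_alg K (uea K L) (uea K L)"
  by (rule tensor_alg_assoc_algebra[OF U.assoc_algebra_axioms U.assoc_algebra_axioms])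

lemmas U_U = U.module_axioms U.module_axioms

text \<open>The intertwining identity is linear in u and passes from u to xu, because
  \<open>gen\<close> may be applied at the vector \<open>\<rho> u m\<close>. Hence it spreads from
  the generators to all of U(L). Every comparison of Sweedler formulas below is reduced to
  generators through this lemma.\<close>

lemma uea_rep_equivariant:
  assumes \<rho>: "uea_rep K L M \<rho>" and \<sigma>: "uea_rep K L N \<sigma>" and \<Phi>: "linear_map K M N \<Phi>"
    and gen: "\<And>x m. x \<in> carrier L \<Longrightarrow> m \<in> carrier M \<Longrightarrow> \<Phi> (\<rho> (uea_gen K L x) m) = \<sigma> (uea_gen K L x) (\<Phi> m)"
    and u: "u \<in> carrier (uea K L)" and m: "m \<in> carrier M"
  shows "\<Phi> (\<rho> u m) = \<sigma> u (\<Phi> m)"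
proof -
  note b = bilinear_mapD[OF uea_rep_bilinear[OF \<rho>]] bilinear_mapD[OF uea_rep_bilinear[OF \<sigma>]]
  note l = linear_mapD[OF \<Phi>]
  have "\<forall>m \<in> carrier M. \<Phi> (\<rho> u m) = \<sigma> u (\<Phi> m)"
    by (rule uea_induct[OF L u])
      (auto simp: b l uea_rep_one[OF \<rho>] uea_rep_one[OF \<sigma>] uea_rep_mult[OF \<rho>] uea_rep_mult[OF \<sigma>]
        uea_gen_closed[OF L] gen)
  with m show ?thesis by blast
qed

lemma comult_gen_linear:
  "linear_map K L (tensor_alg K (uea K L) (uea K L)) (\<lambda>x.
     pure_tensor K (uea K L) (uea K L) (uea_gen K L x) \<one>\<^bsub>uea K L\<^esub> \<oplus>\<^bsub>tensor_alg K (uea K L) (uea K L)\<^esub>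
     pure_tensor K (uea K L) (uea K L) \<one>\<^bsub>uea K L\<^esub> (uea_gen K L x))"
proof -
  have "bilinear_map K (uea K L) (uea K L) (tensor_alg K (uea K L) (uea K L)) (pure_tensor K (uea K L) (uea K L))"
    using pure_tensor_bilinear[OF U_U] by (simp add: bilinear_map_def linear_map_def tensor_alg_simps)
  then show ?thesis
    by (intro linear_map_plus[OF UU.module_axioms] linear_map_comp[OF uea_gen_linear[OF L]])
      (auto intro: bilinear_map_left bilinear_map_right)
qed

text \<open>The elements x \<otimes> 1 commute with the elements 1 \<otimes> y. The commutator of
  two primitive elements therefore has only the terms [x, y] \<otimes> 1 and 1 \<otimes> [x, y], as
  the universal property of U(L) requires.\<close>

lemma comult_spec:
  "comult K L \<in> alg_hom K (uea K L) (tensor_alg K (uea K L) (uea K L)) \<and>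
   (\<forall>x \<in> carrier L. comult K L (uea_gen K L x) =
      pure_tensor K (uea K L) (uea K L) (uea_gen K L x) \<one>\<^bsub>uea K L\<^esub> \<oplus>\<^bsub>tensor_alg K (uea K L) (uea K L)\<^esub>
      pure_tensor K (uea K L) (uea K L) \<one>\<^bsub>uea K L\<^esub> (uea_gen K L x))"
proof -
  let ?T = "tensor_alg K (uea K L) (uea K L)" and ?p = "pure_tensor K (uea K L) (uea K L)" and ?U = "uea K L"
  define f where "f = (\<lambda>x. ?p (uea_gen K L x) \<one>\<^bsub>?U\<^esub> \<oplus>\<^bsub>?T\<^esub> ?p \<one>\<^bsub>?U\<^esub> (uea_gen K L x))"
  have pc: "?p u v \<in> carrier ?T" if "u \<in> carrier ?U" "v \<in> carrier ?U" for u v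
    using pure_tensor_closed[OF U_U that] by (simp add: tensor_alg_simps)
  have pm: "?p u v \<otimes>\<^bsub>?T\<^esub> ?p u' v' = ?p (u \<otimes>\<^bsub>?U\<^esub> u') (v \<otimes>\<^bsub>?U\<^esub> v')"
    if "u \<in> carrier ?U" "v \<in> carrier ?U" "u' \<in> carrier ?U" "v' \<in> carrier ?U" for u v u' v'
    using tensor_mult_pure[OF U.assoc_algebra_axioms U.assoc_algebra_axioms that] .
  have lin: "linear_map K ?U ?T (\<lambda>u. ?p u \<one>\<^bsub>?U\<^esub>)" "linear_map K ?U ?T (?p \<one>\<^bsub>?U\<^esub>)"
    using bilinear_map_left[OF pure_tensor_bilinear[OF U_U], of "\<one>\<^bsub>?U\<^esub>"]
      bilinear_map_right[OF pure_tensor_bilinear[OF U_U], of "\<one>\<^bsub>?U\<^esub>"]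
    by (simp_all add: linear_map_def tensor_alg_simps)
  note mi = linear_map_minus[OF U.module_axioms UU.module_axioms lin(1)]
    linear_map_minus[OF U.module_axioms UU.module_axioms lin(2)]
  have "f (bracket L x y) = f x \<otimes>\<^bsub>?T\<^esub> f y \<ominus>\<^bsub>?T\<^esub> f y \<otimes>\<^bsub>?T\<^esub> f x" if x: "x \<in> carrier L" and y: "y \<in> carrier L" for x y
  proof -
    let ?x = "uea_gen K L x" and ?y = "uea_gen K L y"
    note g [simp] = uea_gen_closed[OF L x] uea_gen_closed[OF L y]
    \<comment> \<open>Here p and q are the cross terms y \<otimes> x and x \<otimes> y, which appear
      in both products and cancel.\<close>
    have arith: "(a \<ominus>\<^bsub>?T\<^esub> b) \<oplus>\<^bsub>?T\<^esub> (c \<ominus>\<^bsub>?T\<^esub> d) =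
        ((a \<oplus>\<^bsub>?T\<^esub> p) \<oplus>\<^bsub>?T\<^esub> (q \<oplus>\<^bsub>?T\<^esub> c)) \<ominus>\<^bsub>?T\<^esub> ((b \<oplus>\<^bsub>?T\<^esub> q) \<oplus>\<^bsub>?T\<^esub> (p \<oplus>\<^bsub>?T\<^esub> d))"
      if "a \<in> carrier ?T" "b \<in> carrier ?T" "c \<in> carrier ?T" "d \<in> carrier ?T" "p \<in> carrier ?T" "q \<in> carrier ?T"
      for a b c d p q
      using that by algebra
    have "f (bracket L x y) =
        (?p (?x \<otimes>\<^bsub>?U\<^esub> ?y) \<one>\<^bsub>?U\<^esub> \<ominus>\<^bsub>?T\<^esub> ?p (?y \<otimes>\<^bsub>?U\<^esub> ?x) \<one>\<^bsub>?U\<^esub>) \<oplus>\<^bsub>?T\<^esub>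
        (?p \<one>\<^bsub>?U\<^esub> (?x \<otimes>\<^bsub>?U\<^esub> ?y) \<ominus>\<^bsub>?T\<^esub> ?p \<one>\<^bsub>?U\<^esub> (?y \<otimes>\<^bsub>?U\<^esub> ?x))"
      by (simp add: f_def uea_gen_bracket[OF L x y] mi)
    also have "\<dots> = ((?p (?x \<otimes>\<^bsub>?U\<^esub> ?y) \<one>\<^bsub>?U\<^esub> \<oplus>\<^bsub>?T\<^esub> ?p ?y ?x) \<oplus>\<^bsub>?T\<^esub> (?p ?x ?y \<oplus>\<^bsub>?T\<^esub> ?p \<one>\<^bsub>?U\<^esub> (?x \<otimes>\<^bsub>?U\<^esub> ?y))) \<ominus>\<^bsub>?T\<^esub>
        ((?p (?y \<otimes>\<^bsub>?U\<^esub> ?x) \<one>\<^bsub>?U\<^esub> \<oplus>\<^bsub>?T\<^esub> ?p ?x ?y) \<oplus>\<^bsub>?T\<^esub> (?p ?y ?x \<oplus>\<^bsub>?T\<^esub> ?p \<one>\<^bsub>?U\<^esub> (?y \<otimes>\<^bsub>?U\<^esub> ?x)))"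
      by (rule arith) (simp_all add: pc)
    also have "\<dots> = f x \<otimes>\<^bsub>?T\<^esub> f y \<ominus>\<^bsub>?T\<^esub> f y \<otimes>\<^bsub>?T\<^esub> f x"
      by (simp add: f_def UU.M.l_distr UU.M.r_distr pm pc)
    finally show ?thesis .
  qed
  then have "uea_lift K L ?T f \<in> alg_hom K ?U ?T \<and> (\<forall>x \<in> carrier L. uea_lift K L ?T f (uea_gen K L x) = f x)"
    using comult_gen_linear unfolding f_def[symmetric]
    by (intro uea_lift_spec[OF L UU.assoc_algebra_axioms])
  moreover have "comult K L = uea_lift K L ?T f" by (simp add: comult_def f_def Let_def)
  ultimately show ?thesis by (simp add: f_def)
qed

lemma comult_linear: "linear_map K (uea K L) (tensor K (uea K L) (uea K L)) (comult K L)"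
  using comult_spec by (simp add: alg_hom_iff linear_map_def tensor_alg_simps)

lemma comult_closed: "u \<in> carrier (uea K L) \<Longrightarrow> comult K L u \<in> carrier (tensor K (uea K L) (uea K L))"
  by (rule linear_map_closed[OF comult_linear])

lemma left_mult_rep: "uea_rep K L (uea K L) (mult (uea K L))"
  by (simp add: uea_rep_def mult_bilinear[OF U.assoc_algebra_axioms] U.M.m_assoc)

section \<open>The tensor product of two representations\<close>

context
  fixes M :: "('k, 'm, 'mm) module_scheme" and N :: "('k, 'n, 'nn) module_scheme" and \<rho> \<sigma>
  assumes M: "module K M" and N: "module K N" and \<rho>: "uea_rep K L M \<rho>" and \<sigma>: "uea_rep K L N \<sigma>"
begin

interpretation MN: module K "tensor K M N" by (rule tensor_module[OF M N])

text \<open>On a pure tensor the action becomes a single Sweedler sum, the shape in which the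
  innermost lifts of \<open>smash_mult\<close> and \<open>cm_mult\<close> are written.\<close>

lemma tensor_act_pure:
  assumes u: "u \<in> carrier (uea K L)" and m: "m \<in> carrier M" and n: "n \<in> carrier N"
  shows "tensor_act K L M N \<rho> \<sigma> u (pure_tensor K M N m n) =
    tensor_lift K (uea K L) (uea K L) (tensor K M N) (\<lambda>u1 u2. pure_tensor K M N (\<rho> u1 m) (\<sigma> u2 n)) (comult K L u)"
  unfolding tensor_act_def
  by (rule fun_cong[OF tensor_lift_cong[OF U_U]], rule tensor_lift_pure[OF M N MN.module_axioms])
    (auto intro: m n pair_pure_bilinear_right[OF U_U M N M N uea_rep_bilinear[OF \<rho>] uea_rep_bilinear[OF \<sigma>]])

text \<open>E is the factorwise action of U \<otimes> U. It is unital and multiplicative, as is seen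
  on pure tensors in all three arguments, and composing it with the algebra morphism \<Delta>
  preserves both properties.\<close>

lemma tensor_act_rep: "uea_rep K L (tensor K M N) (tensor_act K L M N \<rho> \<sigma>)"
proof -
  let ?U = "uea K L" and ?T = "tensor_alg K (uea K L) (uea K L)"
  define E where "E s t = tensor_lift K ?U ?U (tensor K M N) (\<lambda>u1 u2.
       tensor_lift K M N (tensor K M N) (\<lambda>m n. pure_tensor K M N (\<rho> u1 m) (\<sigma> u2 n)) t) s" for s t
  note R = uea_rep_bilinear[OF \<rho>] and S = uea_rep_bilinear[OF \<sigma>]
  have E: "bilinear_map K (tensor K ?U ?U) (tensor K M N) (tensor K M N) E"
    unfolding E_def by (rule tensor_pairing_bilinear[OF U_U M N M N R S])
  have Ep: "E (pure_tensor K ?U ?U u v) (pure_tensor K M N m n) = pure_tensor K M N (\<rho> u m) (\<sigma> v n)"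
    if "u \<in> carrier ?U" "v \<in> carrier ?U" "m \<in> carrier M" "n \<in> carrier N" for u v m n
    unfolding E_def using that by (rule tensor_pairing_pure[OF U_U M N M N R S])
  note b = bilinear_mapD[OF E] bilinear_mapD[OF R] bilinear_mapD[OF S] pure_tensor_closed[OF U_U] pure_tensor_closed[OF M N]
  have one: "E \<one>\<^bsub>?T\<^esub> t = t" if "t \<in> carrier (tensor K M N)" for t
    using linear_map_eq_on_tensor[OF M N bilinear_map_right[OF E] linear_map_id _ that, of "\<one>\<^bsub>?T\<^esub>"]
    by (simp add: tensor_alg_simps b Ep uea_rep_one[OF \<rho>] uea_rep_one[OF \<sigma>])
  have tm: "bilinear_map K (tensor K ?U ?U) (tensor K ?U ?U) (tensor K ?U ?U) (mult ?T)"
    by (rule tensor_mult_bilinear[OF U.assoc_algebra_axioms U.assoc_algebra_axioms])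
  note b' = bilinear_mapD[OF tm] tensor_mult_pure[OF U.assoc_algebra_axioms U.assoc_algebra_axioms]
  have mult: "E (r \<otimes>\<^bsub>?T\<^esub> s) t = E r (E s t)"
    if r: "r \<in> carrier (tensor K ?U ?U)" and s: "s \<in> carrier (tensor K ?U ?U)" and t: "t \<in> carrier (tensor K M N)" for r s t
    using r
  proof (induction rule: tensor_induct[OF U_U, consumes 1, case_names pure add])
    case r: (pure u v)
    show ?case using s
    proof (induction rule: tensor_induct[OF U_U, consumes 1, case_names pure add])
      case s: (pure u' v')
      show ?case using t
        by (induction rule: tensor_induct[OF M N, consumes 1, case_names pure add])
          (use r s in \<open>simp_all add: b b' Ep uea_rep_mult[OF \<rho>] uea_rep_mult[OF \<sigma>]\<close>)
    next
      case (add p q)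
      then show ?case using r t by (simp add: b b')
    qed
  next
    case (add p q)
    then show ?case using s t by (simp add: b b')
  qed
  have act: "tensor_act K L M N \<rho> \<sigma> = (\<lambda>u t. E (comult K L u) t)" by (simp add: tensor_act_def E_def fun_eq_iff)
  note hom = comult_spec[THEN conjunct1]
  show ?thesis unfolding uea_rep_def act
    using bilinear_map_compose[OF E comult_linear linear_map_id linear_map_id]
    by (simp add: alg_hom_one[OF hom] alg_hom_mult[OF hom] one mult comult_closed)
qed

lemma tensor_act_gen:
  assumes x: "x \<in> carrier L" and m: "m \<in> carrier M" and n: "n \<in> carrier N"
  shows "tensor_act K L M N \<rho> \<sigma> (uea_gen K L x) (pure_tensor K M N m n) =
    pure_tensor K M N (\<rho> (uea_gen K L x) m) n \<oplus>\<^bsub>tensor K M N\<^esub> pure_tensor K M N m (\<sigma> (uea_gen K L x) n)"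
proof -
  let ?U = "uea K L"
  note g = uea_gen_closed[OF L x]
  have b: "bilinear_map K ?U ?U (tensor K M N) (\<lambda>u1 u2. pure_tensor K M N (\<rho> u1 m) (\<sigma> u2 n))"
    by (rule bilinear_map_compose[OF pure_tensor_bilinear[OF M N] bilinear_map_left[OF uea_rep_bilinear[OF \<rho>] m]
        bilinear_map_left[OF uea_rep_bilinear[OF \<sigma>] n] linear_map_id])
  note lin = linear_mapD[OF tensor_lift_linear[OF U_U MN.module_axioms b]]
  have "comult K L (uea_gen K L x) =
      pure_tensor K ?U ?U (uea_gen K L x) \<one>\<^bsub>?U\<^esub> \<oplus>\<^bsub>tensor K ?U ?U\<^esub> pure_tensor K ?U ?U \<one>\<^bsub>?U\<^esub> (uea_gen K L x)"
    using comult_spec x by (simp add: tensor_alg_simps)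
  then show ?thesis
    using g m n by (simp add: tensor_act_pure lin pure_tensor_closed[OF U_U] tensor_lift_pure[OF U_U MN.module_axioms b]
        uea_rep_one[OF \<rho>] uea_rep_one[OF \<sigma>])
qed

end

end

section \<open>The smash product\<close>

text \<open>A lift depends on its target only through the linear structure. This bridges
  \<open>act_env\<close>, which lands in Ae, and \<open>tensor_act\<close>, which lands in the bare
  tensor product.\<close>

lemma tensor_lift_codomain_cong:
  assumes "carrier P' = carrier P" "add P' = add P" "smult P' = smult P"
  shows "tensor_lift K M N P' b = tensor_lift K M N P b"
proof -
  have "lin_hom K (tensor K M N) P' = lin_hom K (tensor K M N) P" by (simp add: lin_hom_def assms)
  then show ?thesis by (simp add: tensor_lift_def)
qed

locale anchored =
  fixes K :: "('k, 'kk) ring_scheme" and A :: "('k, 'a, 'aa) module_scheme" and L :: "('k, 'l, 'a) anch_lie"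
  assumes A: "assoc_algebra K A" and L: "is_anch_lie K A L"
begin

abbreviation "U \<equiv> uea K L"
abbreviation "Ae \<equiv> env_alg K A"
abbreviation "V \<equiv> smash_space K A L"
abbreviation "pure \<equiv> pure_tensor K A (opp_alg A)"

lemma lie: "lie_algebra K L" and anchor_hom: "anchor L \<in> lie_hom K L (Der K A)"
  using L by (simp_all add: is_anch_lie_def)

sublocale A: assoc_algebra K A by (rule A)
sublocale L: lie_algebra K L by (rule lie)
sublocale U: assoc_algebra K U by (rule uea_assoc_algebra[OF lie])
sublocale Ae: assoc_algebra K Ae by (rule env_alg_assoc_algebra[OF A])

lemmas gen_closed [simp] = uea_gen_closed[OF lie]
lemmas U_modules = U.module_axioms U.module_axioms
lemmas Ae_U_modules = Ae.module_axioms U.module_axioms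

lemma anchor_Der: "x \<in> carrier L \<Longrightarrow> anchor L x \<in> carrier (Der K A)"
  using linear_map_closed[of K L "Der K A" "anchor L"] anchor_hom by (simp add: lie_hom_def lin_hom_iff)

text \<open>The bracket of derivations is the commutator of endomorphisms, so the anchor is a Lie
  morphism into \<open>End_alg\<close> and the universal property of U(L) applies.\<close>

lemma act_spec:
  "act K A L \<in> alg_hom K U (End_alg K A) \<and> (\<forall>x \<in> carrier L. act K A L (uea_gen K L x) = anchor L x)"
  unfolding act_def
proof (rule uea_lift_spec[OF lie End_alg_assoc_algebra[OF A.module_axioms]])
  have lin: "linear_map K L (Der K A) (anchor L)"
    and br: "\<And>x y. x \<in> carrier L \<Longrightarrow> y \<in> carrier L \<Longrightarrow> anchor L (bracket L x y) = bracket (Der K A) (anchor L x) (anchor L y)"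
    using anchor_hom by (auto simp: lie_hom_def lin_hom_iff)
  have "d \<in> carrier (End_alg K A)" if "d \<in> carrier (Der K A)" for d
    using that by (simp add: Der_simps(1) End_alg_simps(1))
  then show "linear_map K L (End_alg K A) (anchor L)"
    by (intro linear_mapI) (simp_all add: linear_mapD[OF lin], simp_all add: Der_simps End_alg_simps)
  fix x y assume "x \<in> carrier L" "y \<in> carrier L"
  then show "anchor L (bracket L x y) =
      anchor L x \<otimes>\<^bsub>End_alg K A\<^esub> anchor L y \<ominus>\<^bsub>End_alg K A\<^esub> anchor L y \<otimes>\<^bsub>End_alg K A\<^esub> anchor L x"
    by (simp add: br Der_bracket_commutator[OF A.module_axioms] linear_mapD[OF lin])
qed

lemma act_gen: "x \<in> carrier L \<Longrightarrow> act K A L (uea_gen K L x) = anchor L x"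
  using act_spec by simp

lemma act_rep: "uea_rep K L A (act K A L)"
proof -
  note hom = act_spec[THEN conjunct1]
  have lin: "linear_map K A A (act K A L u)" if "u \<in> carrier U" for u
    using alg_hom_closed[OF hom that] by (simp add: End_alg_simps lin_hom_iff)
  show ?thesis
    unfolding uea_rep_def
    by (auto intro!: bilinear_mapI lin linear_mapI
        simp: linear_map_closed[OF lin] alg_homD(2-)[OF hom] End_alg_simps compose_eq)
qed

abbreviation "A_opp \<equiv> tensor K A (opp_alg A)"

lemma act_opp_rep: "uea_rep K L (opp_alg A) (act K A L)"
  by (rule uea_rep_cong[OF act_rep]) simp_all

lemmas modules_A_opp = A_opp_modules[OF A]

text \<open>Recognising the action on Ae as the tensor product of two copies of the action on A
  yields at once that it is a representation.\<close>

lemma act_env_eq: "act_env K A L = tensor_act K L A (opp_alg A) (act K A L) (act K A L)"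
  unfolding act_env_def tensor_act_def fun_eq_iff
  by (simp add: tensor_lift_codomain_cong[of "env_alg K A" A_opp] env_tensor_simps[OF A])

lemma act_env_rep: "uea_rep K L Ae (act_env K A L)"
  unfolding act_env_eq
  by (rule uea_rep_cong[OF tensor_act_rep[OF lie modules_A_opp act_rep act_opp_rep]])
    (simp_all add: env_tensor_simps[OF A])

lemma act_env_gen_pure:
  assumes x: "x \<in> carrier L" and ab: "a \<in> carrier A" "b \<in> carrier A"
  shows "act_env K A L (uea_gen K L x) (pure a b) = pure (anchor L x a) b \<oplus>\<^bsub>Ae\<^esub> pure a (anchor L x b)"
  using tensor_act_gen[OF lie modules_A_opp act_rep act_opp_rep x, of a b] ab
  by (simp add: act_env_eq act_gen x env_tensor_simps[OF A])

text \<open>The link between the two sides of the adjunction: the action that defines the smash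
  product is, on generators, the derivation that the right adjoint asks for.\<close>

lemma act_env_gen:
  assumes x: "x \<in> carrier L" and y: "y \<in> carrier Ae"
  shows "act_env K A L (uea_gen K L x) y = der_tensor K A (anchor L x) y"
  by (rule env_linear_eq[OF A bilinear_map_right[OF uea_rep_bilinear[OF act_env_rep]] der_tensor_linear[OF A]])
    (use x y in \<open>simp_all add: Der_linear[OF anchor_Der] act_env_gen_pure der_tensor_pure[OF A]\<close>)

text \<open>The module algebra axiom for a primitive element, and the only form of it that the smash
  product uses.\<close>

lemma act_env_leibniz:
  assumes "x \<in> carrier L" "y \<in> carrier Ae" "z \<in> carrier Ae"
  shows "act_env K A L (uea_gen K L x) (y \<otimes>\<^bsub>Ae\<^esub> z) =
    act_env K A L (uea_gen K L x) y \<otimes>\<^bsub>Ae\<^esub> z \<oplus>\<^bsub>Ae\<^esub> y \<otimes>\<^bsub>Ae\<^esub> act_env K A L (uea_gen K L x) z"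
  using assms by (simp add: act_env_gen Der_leibniz[OF der_tensor_Der[OF A anchor_Der]])

text \<open>A derivation kills the unit: the Leibniz rule at 1 = 1 * 1 gives d = d + d.\<close>

lemma act_env_gen_one:
  assumes x: "x \<in> carrier L" shows "act_env K A L (uea_gen K L x) \<one>\<^bsub>Ae\<^esub> = \<zero>\<^bsub>Ae\<^esub>"
proof -
  let ?d = "act_env K A L (uea_gen K L x) \<one>\<^bsub>Ae\<^esub>"
  have c: "?d \<in> carrier Ae" using x bilinear_map_closed[OF uea_rep_bilinear[OF act_env_rep]] by simp
  have "?d \<oplus>\<^bsub>Ae\<^esub> ?d = ?d" using act_env_leibniz[OF x, of "\<one>\<^bsub>Ae\<^esub>" "\<one>\<^bsub>Ae\<^esub>"] c by simp
  then show ?thesis using c by (metis Ae.M.add.r_cancel_one')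
qed

section \<open>The space Ae \<otimes> U(L) with its two structures\<close>

sublocale V: module K V unfolding smash_space_def by (rule tensor_module[OF Ae_U_modules])

lemma V_pure_bilinear: "bilinear_map K Ae U V (smash_pure K A L)"
  unfolding smash_space_def smash_pure_def by (rule pure_tensor_bilinear[OF Ae_U_modules])

lemmas V_pure = bilinear_mapD[OF V_pure_bilinear]

lemma V_linear_eq:
  assumes "linear_map K V P f" "linear_map K V P g"
    and "\<And>x u. x \<in> carrier Ae \<Longrightarrow> u \<in> carrier U \<Longrightarrow> f (smash_pure K A L x u) = g (smash_pure K A L x u)"
    and "t \<in> carrier V"
  shows "f t = g t"
  using assms unfolding smash_space_def smash_pure_def by (rule linear_map_eq_on_tensor[OF Ae_U_modules])

lemma V_lift_apply:
  assumes "linear_map K V P f"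
    and "\<And>x u. x \<in> carrier Ae \<Longrightarrow> u \<in> carrier U \<Longrightarrow> f (smash_pure K A L x u) = b x u"
    and "t \<in> carrier V"
  shows "tensor_lift K Ae U P b t = f t"
  using assms unfolding smash_space_def smash_pure_def by (rule tensor_lift_apply[OF Ae_U_modules])

lemma V_lift_linear: "module K P \<Longrightarrow> bilinear_map K Ae U P b \<Longrightarrow> linear_map K V P (tensor_lift K Ae U P b)"
  unfolding smash_space_def by (rule tensor_lift_linear[OF Ae_U_modules])

lemma V_lift_pure:
  "module K P \<Longrightarrow> bilinear_map K Ae U P b \<Longrightarrow> x \<in> carrier Ae \<Longrightarrow> u \<in> carrier U \<Longrightarrow>
   tensor_lift K Ae U P b (smash_pure K A L x u) = b x u"
  unfolding smash_pure_def by (rule tensor_lift_pure[OF Ae_U_modules])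

text \<open>The two factors of \<open>(x \<otimes> u) t = x T\<^sub>u(t)\<close>: multiplication by \<open>x\<close>, and \<open>T\<close>.\<close>

definition env_smult where
  "env_smult x = tensor_lift K Ae U V (\<lambda>y v. smash_pure K A L (x \<otimes>\<^bsub>Ae\<^esub> y) v)"

definition smash_act where
  "smash_act = tensor_act K L Ae U (act_env K A L) (mult U)"

lemma env_smult_bilinear: "bilinear_map K Ae V V env_smult"
  unfolding env_smult_def smash_space_def smash_pure_def
  by (rule left_factor_action_bilinear[OF Ae.module_axioms Ae.module_axioms U.module_axioms Ae.module_axioms
        mult_bilinear[OF Ae.assoc_algebra_axioms]])

lemma env_smult_pure:
  "x \<in> carrier Ae \<Longrightarrow> y \<in> carrier Ae \<Longrightarrow> v \<in> carrier U \<Longrightarrow>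
   env_smult x (smash_pure K A L y v) = smash_pure K A L (x \<otimes>\<^bsub>Ae\<^esub> y) v"
  unfolding env_smult_def smash_space_def smash_pure_def
  by (rule left_factor_action_pure[OF Ae.module_axioms Ae.module_axioms U.module_axioms Ae.module_axioms
        mult_bilinear[OF Ae.assoc_algebra_axioms]])

lemma smash_act_rep: "uea_rep K L V smash_act"
  unfolding smash_act_def smash_space_def
  by (rule tensor_act_rep[OF lie Ae_U_modules act_env_rep left_mult_rep[OF lie]])

lemma smash_act_gen:
  "x \<in> carrier L \<Longrightarrow> y \<in> carrier Ae \<Longrightarrow> v \<in> carrier U \<Longrightarrow>
   smash_act (uea_gen K L x) (smash_pure K A L y v) =
   smash_pure K A L (act_env K A L (uea_gen K L x) y) v \<oplus>\<^bsub>V\<^esub> smash_pure K A L y (uea_gen K L x \<otimes>\<^bsub>U\<^esub> v)"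
  unfolding smash_act_def smash_space_def smash_pure_def
  by (rule tensor_act_gen[OF lie Ae_U_modules act_env_rep left_mult_rep[OF lie]])

lemmas env_smult_simps = bilinear_mapD[OF env_smult_bilinear]
lemmas smash_act_simps = bilinear_mapD[OF uea_rep_bilinear[OF smash_act_rep]]
lemmas act_env_simps = bilinear_mapD[OF uea_rep_bilinear[OF act_env_rep]]

lemma env_smult_mult:
  assumes "x \<in> carrier Ae" "y \<in> carrier Ae" "t \<in> carrier V"
  shows "env_smult (x \<otimes>\<^bsub>Ae\<^esub> y) t = env_smult x (env_smult y t)"
  by (rule V_linear_eq[OF bilinear_map_right[OF env_smult_bilinear]
        linear_map_comp[OF bilinear_map_right[OF env_smult_bilinear] bilinear_map_right[OF env_smult_bilinear]]])
    (use assms in \<open>simp_all add: env_smult_pure Ae.M.m_assoc\<close>)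

lemma env_smult_one:
  assumes "t \<in> carrier V" shows "env_smult \<one>\<^bsub>Ae\<^esub> t = t"
  by (rule V_linear_eq[OF bilinear_map_right[OF env_smult_bilinear] linear_map_id _ assms])
    (simp_all add: env_smult_pure)

text \<open>The Leibniz rule for a generator x against multiplication by y. On a pure tensor y'
  \<otimes> v both sides consist of (x.y)y' \<otimes> v, y(x.y') \<otimes> v and yy' \<otimes> xv;
  the first two come from the derivation property on Ae.\<close>

lemma smash_act_env_smult:
  assumes x: "x \<in> carrier L" and y: "y \<in> carrier Ae" and t: "t \<in> carrier V"
  shows "smash_act (uea_gen K L x) (env_smult y t) =
    env_smult (act_env K A L (uea_gen K L x) y) t \<oplus>\<^bsub>V\<^esub> env_smult y (smash_act (uea_gen K L x) t)"
proof -
  note S = bilinear_map_right[OF env_smult_bilinear] and T = bilinear_map_right[OF uea_rep_bilinear[OF smash_act_rep]]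
  show ?thesis
    by (rule V_linear_eq[OF linear_map_comp[OF S T] linear_map_plus[OF V.module_axioms S linear_map_comp[OF T S]] _ t])
      (use x y in \<open>simp_all add: env_smult_pure smash_act_gen act_env_leibniz act_env_simps env_smult_simps V_pure V.M.add.m_assoc\<close>)
qed

text \<open>The nested lifts are removed from the inside out. Multiplication by x is pulled out of
  the Sweedler sum, and what remains there is the tensor product action on y \<otimes> v; the lift
  over y and v is then identified by linearity in t.\<close>

lemma smash_mult_expand:
  assumes s: "s \<in> carrier V" and t: "t \<in> carrier V"
  shows "smash_mult K A L s t = tensor_lift K Ae U V (\<lambda>x u. env_smult x (smash_act u t)) s"
proof -
  have inner: "tensor_lift K U U V (\<lambda>u1 u2. smash_pure K A L (x \<otimes>\<^bsub>Ae\<^esub> act_env K A L u1 y) (u2 \<otimes>\<^bsub>U\<^esub> v)) (comult K L u) =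
      env_smult x (smash_act u (smash_pure K A L y v))"
    if xu: "x \<in> carrier Ae" "u \<in> carrier U" and yv: "y \<in> carrier Ae" "v \<in> carrier U" for x u y v
  proof -
    let ?b = "\<lambda>u1 u2. smash_pure K A L (act_env K A L u1 y) (u2 \<otimes>\<^bsub>U\<^esub> v)"
    have b: "bilinear_map K U U V ?b"
      by (rule bilinear_map_compose[OF V_pure_bilinear bilinear_map_left[OF uea_rep_bilinear[OF act_env_rep] yv(1)]
            bilinear_map_left[OF mult_bilinear[OF U.assoc_algebra_axioms] yv(2)] linear_map_id])
    have "tensor_lift K U U V (\<lambda>u1 u2. smash_pure K A L (x \<otimes>\<^bsub>Ae\<^esub> act_env K A L u1 y) (u2 \<otimes>\<^bsub>U\<^esub> v)) (comult K L u) =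
        tensor_lift K U U V (\<lambda>u1 u2. env_smult x (?b u1 u2)) (comult K L u)"
      using xu yv by (intro fun_cong[OF tensor_lift_cong[OF U_modules]]) (simp add: env_smult_pure act_env_simps)
    also have "\<dots> = env_smult x (tensor_lift K U U V ?b (comult K L u))"
      by (rule tensor_lift_comp[OF U_modules V.module_axioms b bilinear_map_right[OF env_smult_bilinear xu(1)]
            comult_closed[OF lie xu(2)]])
    also have "tensor_lift K U U V ?b (comult K L u) = smash_act u (smash_pure K A L y v)"
      unfolding smash_act_def smash_pure_def smash_space_def
      by (rule tensor_act_pure[OF lie Ae_U_modules act_env_rep left_mult_rep[OF lie] xu(2) yv, symmetric])
    finally show ?thesis .
  qed
  have "tensor_lift K Ae U V (\<lambda>y v. tensor_lift K U U V (\<lambda>u1 u2.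
      smash_pure K A L (x \<otimes>\<^bsub>Ae\<^esub> act_env K A L u1 y) (u2 \<otimes>\<^bsub>U\<^esub> v)) (comult K L u)) t = env_smult x (smash_act u t)"
    if xu: "x \<in> carrier Ae" "u \<in> carrier U" for x u
    by (rule V_lift_apply[OF linear_map_comp[OF bilinear_map_right[OF uea_rep_bilinear[OF smash_act_rep] xu(2)]
          bilinear_map_right[OF env_smult_bilinear xu(1)]] _ t]) (simp add: inner xu)
  then show ?thesis
    unfolding smash_mult_def Let_def
    by (intro fun_cong[OF tensor_lift_cong[OF Ae_U_modules]]) simp
qed

lemma smash_mult_param_bilinear:
  assumes t: "t \<in> carrier V" shows "bilinear_map K Ae U V (\<lambda>x u. env_smult x (smash_act u t))"
  by (rule bilinear_map_compose[OF env_smult_bilinear linear_map_id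
        bilinear_map_left[OF uea_rep_bilinear[OF smash_act_rep] t] linear_map_id])

lemma smash_mult_pure:
  "x \<in> carrier Ae \<Longrightarrow> u \<in> carrier U \<Longrightarrow> t \<in> carrier V \<Longrightarrow>
   smash_mult K A L (smash_pure K A L x u) t = env_smult x (smash_act u t)"
  by (simp add: smash_mult_expand V_pure V_lift_pure V.module_axioms smash_mult_param_bilinear)

lemma smash_mult_bilinear: "bilinear_map K V V V (smash_mult K A L)"
proof (rule bilinear_mapI)
  fix t assume t: "t \<in> carrier V"
  show "linear_map K V V (\<lambda>s. smash_mult K A L s t)"
    by (rule linear_map_cong[OF V_lift_linear[OF V.module_axioms smash_mult_param_bilinear[OF t]] _ V.module_axioms])
      (simp add: smash_mult_expand t)
next
  fix s assume s: "s \<in> carrier V"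
  have "linear_map K V V (\<lambda>t. tensor_lift K Ae U V (\<lambda>x u. env_smult x (smash_act u t)) s)"
    by (rule tensor_lift_linear_param[OF Ae_U_modules V.module_axioms V.module_axioms s[unfolded smash_space_def] smash_mult_param_bilinear])
      (auto intro: linear_map_comp[OF bilinear_map_right[OF uea_rep_bilinear[OF smash_act_rep]]
        bilinear_map_right[OF env_smult_bilinear]])
  then show "linear_map K V V (smash_mult K A L s)"
    by (rule linear_map_cong[OF _ _ V.module_axioms]) (simp add: smash_mult_expand s)
qed

lemmas smash_mult_simps = bilinear_mapD[OF smash_mult_bilinear]

lemma smash_mult_env_smult:
  assumes x: "x \<in> carrier Ae" and s: "s \<in> carrier V" and t: "t \<in> carrier V"
  shows "smash_mult K A L (env_smult x s) t = env_smult x (smash_mult K A L s t)"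
  by (rule V_linear_eq[OF linear_map_comp[OF bilinear_map_right[OF env_smult_bilinear] bilinear_map_left[OF smash_mult_bilinear]]
        linear_map_comp[OF bilinear_map_left[OF smash_mult_bilinear] bilinear_map_right[OF env_smult_bilinear]] _ s])
    (use x t in \<open>simp_all add: env_smult_pure smash_mult_pure env_smult_mult smash_act_simps\<close>)

text \<open>Associativity in disguise: right multiplication by t commutes with T, and by
  \<open>smash_mult_env_smult\<close> with multiplication by Ae, hence with every x \<otimes> u. For
  a generator x and s = y \<otimes> v both sides are (x.y) T_v(t) + y T_(xv)(t), which is the
  preceding Leibniz rule applied to the vector T_v(t).\<close>

lemma smash_mult_smash_act:
  assumes u: "u \<in> carrier U" and s: "s \<in> carrier V" and t: "t \<in> carrier V"
  shows "smash_mult K A L (smash_act u s) t = smash_act u (smash_mult K A L s t)"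
proof (rule uea_rep_equivariant[OF lie smash_act_rep smash_act_rep bilinear_map_left[OF smash_mult_bilinear t] _ u s])
  fix x s assume x: "x \<in> carrier L" and s: "s \<in> carrier V"
  note R = bilinear_map_right[OF uea_rep_bilinear[OF smash_act_rep]] and M = bilinear_map_left[OF smash_mult_bilinear]
  show "smash_mult K A L (smash_act (uea_gen K L x) s) t = smash_act (uea_gen K L x) (smash_mult K A L s t)"
    by (rule V_linear_eq[OF linear_map_comp[OF R M] linear_map_comp[OF M R] _ s])
      (use x t in \<open>simp_all add: smash_act_gen smash_mult_simps V_pure act_env_simps smash_mult_pure smash_act_env_smult smash_act_simps uea_rep_mult[OF smash_act_rep]\<close>)
qed

text \<open>Generators kill the unit of Ae, so v \<mapsto> 1 \<otimes> v intertwines left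
  multiplication on U(L) with T. Writing u as u times the unit makes it the result of acting on 1,
  where this equivariance applies.\<close>

lemma smash_act_one:
  assumes u: "u \<in> carrier U"
  shows "smash_act u (smash_pure K A L \<one>\<^bsub>Ae\<^esub> \<one>\<^bsub>U\<^esub>) = smash_pure K A L \<one>\<^bsub>Ae\<^esub> u"
proof -
  have z: "smash_pure K A L \<zero>\<^bsub>Ae\<^esub> v = \<zero>\<^bsub>V\<^esub>" if "v \<in> carrier U" for v
    by (rule linear_map_zero[OF Ae.module_axioms V.module_axioms bilinear_map_left[OF V_pure_bilinear that]])
  have "smash_pure K A L \<one>\<^bsub>Ae\<^esub> (u \<otimes>\<^bsub>U\<^esub> \<one>\<^bsub>U\<^esub>) = smash_act u (smash_pure K A L \<one>\<^bsub>Ae\<^esub> \<one>\<^bsub>U\<^esub>)"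
    by (rule uea_rep_equivariant[OF lie left_mult_rep[OF lie] smash_act_rep bilinear_map_right[OF V_pure_bilinear] _ u])
      (simp_all add: smash_act_gen act_env_gen_one z V_pure)
  then show ?thesis using u by simp
qed

section \<open>The smash product as an Ae-ring, and morphisms out of it\<close>

lemma smash_simps:
  "carrier (smash K A L) = carrier V" "add (smash K A L) = add V" "zero (smash K A L) = zero V"
  "smult (smash K A L) = smult V" "mult (smash K A L) = smash_mult K A L"
  "one (smash K A L) = smash_pure K A L \<one>\<^bsub>Ae\<^esub> \<one>\<^bsub>U\<^esub>"
  "str (smash K A L) = (\<lambda>x\<in>carrier Ae. smash_pure K A L x \<one>\<^bsub>U\<^esub>)"
  by (simp_all add: smash_def module.extend_def)

lemma smash_assoc_algebra: "assoc_algebra K (smash K A L)"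
proof (rule assoc_algebraI)
  show "module K (smash K A L)" by (rule module_cong[OF V.module_axioms]) (simp_all add: smash_simps)
  show "bilinear_map K (smash K A L) (smash K A L) (smash K A L) (mult (smash K A L))"
    using smash_mult_bilinear by (simp add: bilinear_map_def linear_map_def smash_simps)
  show "\<one>\<^bsub>smash K A L\<^esub> \<in> carrier (smash K A L)" by (simp add: smash_simps V_pure)
  fix r assume "r \<in> carrier (smash K A L)"
  then have r: "r \<in> carrier V" by (simp add: smash_simps)
  show "\<one>\<^bsub>smash K A L\<^esub> \<otimes>\<^bsub>smash K A L\<^esub> r = r"
    using r by (simp add: smash_simps smash_mult_pure uea_rep_one[OF smash_act_rep] env_smult_one)
  show "r \<otimes>\<^bsub>smash K A L\<^esub> \<one>\<^bsub>smash K A L\<^esub> = r"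
    unfolding smash_simps
    by (rule V_linear_eq[OF bilinear_map_left[OF smash_mult_bilinear] linear_map_id _ r])
      (simp_all add: V_pure smash_mult_pure smash_act_one env_smult_pure)
  fix s t assume "s \<in> carrier (smash K A L)" "t \<in> carrier (smash K A L)"
  then have s: "s \<in> carrier V" and t: "t \<in> carrier V" by (simp_all add: smash_simps)
  note M = bilinear_map_left[OF smash_mult_bilinear]
  show "(r \<otimes>\<^bsub>smash K A L\<^esub> s) \<otimes>\<^bsub>smash K A L\<^esub> t = r \<otimes>\<^bsub>smash K A L\<^esub> (s \<otimes>\<^bsub>smash K A L\<^esub> t)"
    unfolding smash_simps by (rule V_linear_eq[OF linear_map_comp[OF M M] M _ r])
      (use s t in \<open>simp_all add: smash_mult_pure smash_mult_simps smash_act_simps smash_mult_env_smult smash_mult_smash_act\<close>)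
qed

lemma smash_b_ring: "is_b_ring K Ae (smash K A L)"
proof -
  have "linear_map K Ae (smash K A L) (\<lambda>x. smash_pure K A L x \<one>\<^bsub>U\<^esub>)"
    using bilinear_map_left[OF V_pure_bilinear U.M.one_closed] by (simp add: linear_map_def smash_simps)
  then have "linear_map K Ae (smash K A L) (str (smash K A L))"
    by (rule linear_map_cong[OF _ _ Ae.module_axioms]) (simp add: smash_simps)
  then have "str (smash K A L) \<in> alg_hom K Ae (smash K A L)"
    unfolding alg_hom_iff
    by (auto simp: smash_simps V_pure smash_mult_pure uea_rep_one[OF smash_act_rep] env_smult_pure)
  then show ?thesis by (simp add: is_b_ring_def smash_assoc_algebra)
qed

lemma smash_pure_factor:
  assumes "x \<in> carrier Ae" "u \<in> carrier U"
  shows "smash_pure K A L x u = smash_mult K A L (smash_pure K A L x \<one>\<^bsub>U\<^esub>) (smash_pure K A L \<one>\<^bsub>Ae\<^esub> u)"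
  using assms by (simp add: smash_mult_pure V_pure uea_rep_one[OF smash_act_rep] env_smult_pure)

text \<open>T_u carries 1 \<otimes> 1 to 1 \<otimes> u, so multiplicativity of u \<mapsto> 1
  \<otimes> u is the representation law T_(uv) = T_u T_v evaluated at the unit.\<close>

lemma smash_pure_env_one_hom: "(\<lambda>u\<in>carrier U. smash_pure K A L \<one>\<^bsub>Ae\<^esub> u) \<in> alg_hom K U (smash K A L)"
proof -
  have "smash_pure K A L \<one>\<^bsub>Ae\<^esub> (u \<otimes>\<^bsub>U\<^esub> v) = smash_mult K A L (smash_pure K A L \<one>\<^bsub>Ae\<^esub> u) (smash_pure K A L \<one>\<^bsub>Ae\<^esub> v)"
    if uv: "u \<in> carrier U" "v \<in> carrier U" for u v
  proof -
    have "smash_act (u \<otimes>\<^bsub>U\<^esub> v) (smash_pure K A L \<one>\<^bsub>Ae\<^esub> \<one>\<^bsub>U\<^esub>) =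
        smash_act u (smash_act v (smash_pure K A L \<one>\<^bsub>Ae\<^esub> \<one>\<^bsub>U\<^esub>))"
      using uv by (simp only: uea_rep_mult[OF smash_act_rep] V_pure Ae.M.one_closed U.M.one_closed)
    then have "smash_pure K A L \<one>\<^bsub>Ae\<^esub> (u \<otimes>\<^bsub>U\<^esub> v) = smash_act u (smash_pure K A L \<one>\<^bsub>Ae\<^esub> v)"
      using uv by (simp add: smash_act_one)
    then show ?thesis using uv by (simp add: smash_mult_pure V_pure env_smult_one smash_act_simps)
  qed
  moreover have "linear_map K U (smash K A L) (smash_pure K A L \<one>\<^bsub>Ae\<^esub>)"
    using bilinear_map_right[OF V_pure_bilinear Ae.M.one_closed] by (simp add: linear_map_def smash_simps)
  then have "linear_map K U (smash K A L) (\<lambda>u\<in>carrier U. smash_pure K A L \<one>\<^bsub>Ae\<^esub> u)"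
    by (rule linear_map_cong[OF _ _ U.module_axioms]) simp
  ultimately show ?thesis
    by (simp add: alg_hom_iff) (simp add: smash_simps)
qed

text \<open>The relation Xy = X.y + yX, which \<open>smash_lift\<close> in turn demands of the
  images of X and y in R.\<close>

lemma smash_commute:
  assumes "x \<in> carrier L" "y \<in> carrier Ae"
  shows "smash_mult K A L (smash_pure K A L \<one>\<^bsub>Ae\<^esub> (uea_gen K L x)) (smash_pure K A L y \<one>\<^bsub>U\<^esub>) =
    smash_pure K A L (act_env K A L (uea_gen K L x) y) \<one>\<^bsub>U\<^esub> \<oplus>\<^bsub>V\<^esub>
    smash_mult K A L (smash_pure K A L y \<one>\<^bsub>U\<^esub>) (smash_pure K A L \<one>\<^bsub>Ae\<^esub> (uea_gen K L x))"
  using assms by (simp add: smash_pure_factor[symmetric])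
    (simp add: smash_mult_pure V_pure smash_act_gen env_smult_one act_env_simps)

text \<open>R carries the same two structures as the smash product: multiplication by \<phi>(x), and
  the representation of U(L) by left multiplication through \<rho>. The linear map g respects the
  first by multiplicativity of \<phi>. It respects the second because it does so on generators,
  which is exactly \<open>comm\<close>. Multiplicativity of g then follows from s t = x T_u(t) for s
  = x \<otimes> u.\<close>

lemma smash_lift:
  assumes R: "assoc_algebra K R" and \<phi>: "\<phi> \<in> alg_hom K Ae R" and \<rho>: "\<rho> \<in> alg_hom K U R"
    and comm: "\<And>x y. x \<in> carrier L \<Longrightarrow> y \<in> carrier Ae \<Longrightarrow>
      \<rho> (uea_gen K L x) \<otimes>\<^bsub>R\<^esub> \<phi> y = \<phi> (act_env K A L (uea_gen K L x) y) \<oplus>\<^bsub>R\<^esub> \<phi> y \<otimes>\<^bsub>R\<^esub> \<rho> (uea_gen K L x)"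
  shows "\<exists>g \<in> alg_hom K (smash K A L) R. \<forall>x \<in> carrier Ae. \<forall>u \<in> carrier U. g (smash_pure K A L x u) = \<phi> x \<otimes>\<^bsub>R\<^esub> \<rho> u"
proof -
  interpret R: assoc_algebra K R by (rule R)
  note p = alg_homD[OF \<phi>] alg_homD[OF \<rho>]
  define g where "g = tensor_lift K Ae U R (\<lambda>x u. \<phi> x \<otimes>\<^bsub>R\<^esub> \<rho> u)"
  have b: "bilinear_map K Ae U R (\<lambda>x u. \<phi> x \<otimes>\<^bsub>R\<^esub> \<rho> u)"
    by (rule bilinear_map_compose[OF mult_bilinear[OF R] alg_hom_linear[OF \<phi>] alg_hom_linear[OF \<rho>] linear_map_id])
  have g: "linear_map K V R g" unfolding g_def by (rule V_lift_linear[OF R.module_axioms b])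
  have gp: "g (smash_pure K A L x u) = \<phi> x \<otimes>\<^bsub>R\<^esub> \<rho> u" if "x \<in> carrier Ae" "u \<in> carrier U" for x u
    unfolding g_def by (rule V_lift_pure[OF R.module_axioms b that])
  note gl = linear_mapD[OF g]
  have gs: "g (env_smult x t) = \<phi> x \<otimes>\<^bsub>R\<^esub> g t" if "x \<in> carrier Ae" and t: "t \<in> carrier V" for x t
    by (rule V_linear_eq[OF linear_map_comp[OF bilinear_map_right[OF env_smult_bilinear] g]
          linear_map_comp[OF g bilinear_map_right[OF mult_bilinear[OF R]]] _ t])
      (use that(1) in \<open>simp_all add: p env_smult_pure gp R.M.m_assoc\<close>)
  have rep: "uea_rep K L R (\<lambda>u r. \<rho> u \<otimes>\<^bsub>R\<^esub> r)"
    using bilinear_map_compose[OF mult_bilinear[OF R] alg_hom_linear[OF \<rho>] linear_map_id linear_map_id]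
    by (simp add: uea_rep_def p R.M.m_assoc)
  have ga: "g (smash_act u t) = \<rho> u \<otimes>\<^bsub>R\<^esub> g t" if u: "u \<in> carrier U" and t: "t \<in> carrier V" for u t
  proof (rule uea_rep_equivariant[OF lie smash_act_rep rep g _ u t])
    fix x t assume x: "x \<in> carrier L" and t: "t \<in> carrier V"
    have pure: "g (smash_act (uea_gen K L x) (smash_pure K A L y v)) = \<rho> (uea_gen K L x) \<otimes>\<^bsub>R\<^esub> g (smash_pure K A L y v)"
      if yv: "y \<in> carrier Ae" "v \<in> carrier U" for y v
    proof -
      have "g (smash_act (uea_gen K L x) (smash_pure K A L y v)) =
          (\<phi> (act_env K A L (uea_gen K L x) y) \<oplus>\<^bsub>R\<^esub> \<phi> y \<otimes>\<^bsub>R\<^esub> \<rho> (uea_gen K L x)) \<otimes>\<^bsub>R\<^esub> \<rho> v"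
        using x yv by (simp add: smash_act_gen gl V_pure act_env_simps gp p R.M.l_distr R.M.m_assoc)
      also have "\<dots> = \<rho> (uea_gen K L x) \<otimes>\<^bsub>R\<^esub> g (smash_pure K A L y v)"
        using x yv by (simp add: comm[symmetric] gp p R.M.m_assoc)
      finally show ?thesis .
    qed
    show "g (smash_act (uea_gen K L x) t) = \<rho> (uea_gen K L x) \<otimes>\<^bsub>R\<^esub> g t"
      by (rule V_linear_eq[OF linear_map_comp[OF bilinear_map_right[OF uea_rep_bilinear[OF smash_act_rep]] g]
            linear_map_comp[OF g bilinear_map_right[OF mult_bilinear[OF R]]] _ t]) (use x in \<open>simp_all add: p pure\<close>)
  qed
  have gm: "g (smash_mult K A L s t) = g s \<otimes>\<^bsub>R\<^esub> g t" if s: "s \<in> carrier V" and t: "t \<in> carrier V" for s t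
    by (rule V_linear_eq[OF linear_map_comp[OF bilinear_map_left[OF smash_mult_bilinear] g]
          linear_map_comp[OF g bilinear_map_left[OF mult_bilinear[OF R]]] _ s])
      (use t in \<open>simp_all add: gl smash_mult_pure gs ga smash_act_simps gp p R.M.m_assoc\<close>)
  have "g \<in> alg_hom K (smash K A L) R"
    unfolding alg_hom_iff
  proof (intro conjI ballI)
    show "linear_map K (smash K A L) R g" using g by (simp add: linear_map_def smash_simps)
    show "g \<in> extensional (carrier (smash K A L))"
      using tensor_lift_hom[OF Ae_U_modules R.module_axioms b]
      by (simp add: g_def lin_hom_iff smash_simps smash_space_def)
  qed (simp_all add: smash_simps gm gp p)
  with gp show ?thesis by blast
qed

end

section \<open>The Connes-Moscovici construction\<close>

lemma assoc_algebra_transport: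
  assumes X: "assoc_algebra K X" and Y: "module K Y"
    and \<Phi>: "linear_map K X Y \<Phi>" and \<Psi>: "linear_map K Y X \<Psi>"
    and \<Phi>\<Psi>: "\<And>y. y \<in> carrier Y \<Longrightarrow> \<Phi> (\<Psi> y) = y" and \<Psi>\<Phi>: "\<And>x. x \<in> carrier X \<Longrightarrow> \<Psi> (\<Phi> x) = x"
    and mult: "\<And>p q. p \<in> carrier Y \<Longrightarrow> q \<in> carrier Y \<Longrightarrow> p \<otimes>\<^bsub>Y\<^esub> q = \<Phi> (\<Psi> p \<otimes>\<^bsub>X\<^esub> \<Psi> q)"
    and one: "\<one>\<^bsub>Y\<^esub> = \<Phi> \<one>\<^bsub>X\<^esub>"
  shows "assoc_algebra K Y"
proof -
  interpret X: assoc_algebra K X by fact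
  interpret Y: module K Y by fact
  note c = linear_map_closed[OF \<Phi>] linear_map_closed[OF \<Psi>]
  have b: "bilinear_map K Y Y Y (\<lambda>p q. \<Phi> (\<Psi> p \<otimes>\<^bsub>X\<^esub> \<Psi> q))"
    by (rule bilinear_map_compose[OF mult_bilinear[OF X] \<Psi> \<Psi> \<Phi>])
  show ?thesis
  proof (rule assoc_algebraI[OF Y])
    show "bilinear_map K Y Y Y (mult Y)"
      by (intro bilinear_mapI linear_mapI) (simp_all add: mult bilinear_mapD[OF b])
  qed (simp_all add: mult one c \<Psi>\<Phi> \<Phi>\<Psi> X.M.m_assoc)
qed

section \<open>Maps out of a triple tensor product\<close>

context
  fixes K :: "('k, 'kk) ring_scheme"
    and M :: "('k, 'm, 'mm) module_scheme" and N :: "('k, 'n, 'nn) module_scheme" and Q :: "('k, 'q, 'qq) module_scheme"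
  assumes M: "module K M" and N: "module K N" and Q: "module K Q"
begin

abbreviation (input) "MNQ \<equiv> tensor K M (tensor K N Q)"
abbreviation (input) "pure3 x y z \<equiv> pure_tensor K M (tensor K N Q) x (pure_tensor K N Q y z)"

lemmas NQ = tensor_module[OF N Q]
lemmas M_NQ = M NQ

lemma linear_map_eq_on_tensor3:
  assumes f: "linear_map K MNQ P f" and g: "linear_map K MNQ P g"
    and eq: "\<And>x y z. x \<in> carrier M \<Longrightarrow> y \<in> carrier N \<Longrightarrow> z \<in> carrier Q \<Longrightarrow> f (pure3 x y z) = g (pure3 x y z)"
    and t: "t \<in> carrier MNQ"
  shows "f t = g t"
proof (rule linear_map_eq_on_tensor[OF M_NQ f g _ t])
  fix x q assume x: "x \<in> carrier M" and q: "q \<in> carrier (tensor K N Q)"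
  note lin = bilinear_map_right[OF pure_tensor_bilinear[OF M_NQ] x]
  show "f (pure_tensor K M (tensor K N Q) x q) = g (pure_tensor K M (tensor K N Q) x q)"
    by (rule linear_map_eq_on_tensor[OF N Q linear_map_comp[OF lin f] linear_map_comp[OF lin g] _ q]) (simp add: eq x)
qed

lemma tensor_lift3_eq:
  assumes g: "g \<in> lin_hom K MNQ P"
    and eq: "\<And>x y z. x \<in> carrier M \<Longrightarrow> y \<in> carrier N \<Longrightarrow> z \<in> carrier Q \<Longrightarrow> g (pure3 x y z) = b x y z"
  shows "tensor_lift3 K M N Q P b = g"
  unfolding tensor_lift3_def
proof (rule tensor_lift_eq[OF M_NQ g])
  fix x q assume x: "x \<in> carrier M" and q: "q \<in> carrier (tensor K N Q)"
  have gl: "linear_map K MNQ P g" using g by (simp add: lin_hom_iff)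
  show "g (pure_tensor K M (tensor K N Q) x q) = tensor_lift K N Q P (b x) q"
    by (rule tensor_lift_apply[OF N Q linear_map_comp[OF bilinear_map_right[OF pure_tensor_bilinear[OF M_NQ] x] gl] _ q, symmetric])
      (simp add: eq x)
qed

lemma tensor_lift3_apply:
  assumes f: "linear_map K MNQ P f"
    and eq: "\<And>x y z. x \<in> carrier M \<Longrightarrow> y \<in> carrier N \<Longrightarrow> z \<in> carrier Q \<Longrightarrow> f (pure3 x y z) = b x y z"
    and t: "t \<in> carrier MNQ"
  shows "tensor_lift3 K M N Q P b t = f t"
proof -
  have "tensor_lift3 K M N Q P b = (\<lambda>t\<in>carrier MNQ. f t)"
    by (rule tensor_lift3_eq[OF restrict_lin_hom[OF tensor_module[OF M_NQ] f]])
      (simp add: eq pure_tensor_closed[OF M_NQ] pure_tensor_closed[OF N Q])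
  with t show ?thesis by simp
qed

lemma tensor_lift3_trilinear:
  assumes P: "module K P" and b: "\<And>x. x \<in> carrier M \<Longrightarrow> bilinear_map K N Q P (b x)"
    and l: "\<And>y z. y \<in> carrier N \<Longrightarrow> z \<in> carrier Q \<Longrightarrow> linear_map K M P (\<lambda>x. b x y z)"
  shows "linear_map K MNQ P (tensor_lift3 K M N Q P b)"
    and "x \<in> carrier M \<Longrightarrow> y \<in> carrier N \<Longrightarrow> z \<in> carrier Q \<Longrightarrow> tensor_lift3 K M N Q P b (pure3 x y z) = b x y z"
proof -
  have *: "bilinear_map K M (tensor K N Q) P (\<lambda>x. tensor_lift K N Q P (b x))"
  proof (rule bilinear_mapI)
    fix q assume q: "q \<in> carrier (tensor K N Q)"
    show "linear_map K M P (\<lambda>x. tensor_lift K N Q P (b x) q)"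
      by (rule tensor_lift_linear_param[OF N Q P M q b l])
  qed (rule tensor_lift_linear[OF N Q P b])
  show "linear_map K MNQ P (tensor_lift3 K M N Q P b)"
    unfolding tensor_lift3_def by (rule tensor_lift_linear[OF M_NQ P *])
  assume "x \<in> carrier M" "y \<in> carrier N" "z \<in> carrier Q"
  then show "tensor_lift3 K M N Q P b (pure3 x y z) = b x y z"
    unfolding tensor_lift3_def
    by (simp add: tensor_lift_pure[OF M_NQ P *] pure_tensor_closed[OF N Q] tensor_lift_pure[OF N Q P b])
qed

end

section \<open>Comparison of the Connes-Moscovici space with the smash product\<close>

context anchored
begin

abbreviation "W \<equiv> cm_space K A L"
abbreviation "UA \<equiv> tensor K U A"

lemmas A_U_A_modules = A.module_axioms U.module_axioms A.module_axioms
lemmas UA_module = tensor_module[OF U.module_axioms A.module_axioms]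
lemmas A_UA_modules = A.module_axioms UA_module

sublocale W: module K W unfolding cm_space_def by (rule tensor_module[OF A_UA_modules])

lemma W_pure_bilinear: "bilinear_map K A UA W (pure_tensor K A UA)"
  unfolding cm_space_def by (rule pure_tensor_bilinear[OF A_UA_modules])

lemmas UA_pure_bilinear = pure_tensor_bilinear[OF U.module_axioms A.module_axioms]

lemma cm_pure_linear:
  "u \<in> carrier U \<Longrightarrow> b \<in> carrier A \<Longrightarrow> linear_map K A W (\<lambda>a. cm_pure K A L a u b)"
  "a \<in> carrier A \<Longrightarrow> b \<in> carrier A \<Longrightarrow> linear_map K U W (\<lambda>u. cm_pure K A L a u b)"
  "a \<in> carrier A \<Longrightarrow> u \<in> carrier U \<Longrightarrow> linear_map K A W (cm_pure K A L a u)"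
proof -
  show "linear_map K A W (\<lambda>a. cm_pure K A L a u b)" if "u \<in> carrier U" "b \<in> carrier A"
    unfolding cm_pure_def using that by (intro bilinear_map_left[OF W_pure_bilinear] bilinear_map_closed[OF UA_pure_bilinear])
  show "linear_map K U W (\<lambda>u. cm_pure K A L a u b)" if "a \<in> carrier A" "b \<in> carrier A"
    unfolding cm_pure_def
    by (rule linear_map_comp[OF bilinear_map_left[OF UA_pure_bilinear that(2)] bilinear_map_right[OF W_pure_bilinear that(1)]])
  show "linear_map K A W (cm_pure K A L a u)" if "a \<in> carrier A" "u \<in> carrier U"
    unfolding cm_pure_def
    by (rule linear_map_comp[OF bilinear_map_right[OF UA_pure_bilinear that(2)] bilinear_map_right[OF W_pure_bilinear that(1)]])
qed

lemma cm_pure_closed: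
  "a \<in> carrier A \<Longrightarrow> u \<in> carrier U \<Longrightarrow> b \<in> carrier A \<Longrightarrow> cm_pure K A L a u b \<in> carrier W"
  by (rule linear_map_closed[OF cm_pure_linear(3)])

lemma W_linear_eq:
  assumes "linear_map K W P f" "linear_map K W P g"
    and "\<And>a u b. a \<in> carrier A \<Longrightarrow> u \<in> carrier U \<Longrightarrow> b \<in> carrier A \<Longrightarrow> f (cm_pure K A L a u b) = g (cm_pure K A L a u b)"
    and "t \<in> carrier W"
  shows "f t = g t"
  using assms unfolding cm_space_def cm_pure_def by (rule linear_map_eq_on_tensor3[OF A_U_A_modules])

lemma W_lift_eq:
  assumes "g \<in> lin_hom K W P"
    and "\<And>a u b. a \<in> carrier A \<Longrightarrow> u \<in> carrier U \<Longrightarrow> b \<in> carrier A \<Longrightarrow> g (cm_pure K A L a u b) = c a u b"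
  shows "tensor_lift3 K A U A P c = g"
  using assms unfolding cm_space_def cm_pure_def by (rule tensor_lift3_eq[OF A_U_A_modules])

lemma W_lift_apply:
  assumes "linear_map K W P f"
    and "\<And>a u b. a \<in> carrier A \<Longrightarrow> u \<in> carrier U \<Longrightarrow> b \<in> carrier A \<Longrightarrow> f (cm_pure K A L a u b) = c a u b"
    and "t \<in> carrier W"
  shows "tensor_lift3 K A U A P c t = f t"
  using assms unfolding cm_space_def cm_pure_def by (rule tensor_lift3_apply[OF A_U_A_modules])

lemma cm_pure_bilinear: "u \<in> carrier U \<Longrightarrow> bilinear_map K A A W (\<lambda>a b. cm_pure K A L a u b)"
  by (intro bilinear_mapI cm_pure_linear)

lemmas env_pure = env_pure_closed[OF A]

lemma smash_to_cm_bilinear: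
  "bilinear_map K Ae U W (\<lambda>x u. tensor_lift K A (opp_alg A) W (\<lambda>a b. cm_pure K A L a u b) x)"
proof (rule bilinear_mapI)
  fix x assume x: "x \<in> carrier Ae"
  show "linear_map K U W (\<lambda>u. tensor_lift K A (opp_alg A) W (\<lambda>a b. cm_pure K A L a u b) x)"
    by (rule tensor_lift_linear_param[OF modules_A_opp W.module_axioms U.module_axioms])
      (simp_all add: x env_tensor_simps[OF A] opp_bilinear[OF A] cm_pure_bilinear cm_pure_linear)
qed (rule env_lift_linear[OF A W.module_axioms cm_pure_bilinear])

lemma smash_to_cm_linear: "linear_map K V W (smash_to_cm K A L)"
  unfolding smash_to_cm_def by (rule V_lift_linear[OF W.module_axioms smash_to_cm_bilinear])

lemma smash_to_cm_pure:
  "a \<in> carrier A \<Longrightarrow> b \<in> carrier A \<Longrightarrow> u \<in> carrier U \<Longrightarrow>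
   smash_to_cm K A L (smash_pure K A L (pure a b) u) = cm_pure K A L a u b"
  unfolding smash_to_cm_def
  by (simp add: V_lift_pure[OF W.module_axioms smash_to_cm_bilinear] env_pure
      env_lift_pure[OF A W.module_axioms cm_pure_bilinear])

definition cm_to_smash where
  "cm_to_smash = tensor_lift3 K A U A V (\<lambda>a u b. smash_pure K A L (pure a b) u)"

lemma cm_to_smash_spec:
  "linear_map K W V cm_to_smash"
  "a \<in> carrier A \<Longrightarrow> u \<in> carrier U \<Longrightarrow> b \<in> carrier A \<Longrightarrow>
   cm_to_smash (cm_pure K A L a u b) = smash_pure K A L (pure a b) u"
proof -
  note P = env_pure_bilinear[OF A]
  have b: "bilinear_map K U A V (\<lambda>u b. smash_pure K A L (pure a b) u)" if a: "a \<in> carrier A" for a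
    by (intro bilinear_mapI linear_map_comp[OF bilinear_map_right[OF P a] bilinear_map_left[OF V_pure_bilinear]]
        bilinear_map_right[OF V_pure_bilinear] bilinear_map_closed[OF P a])
  have l: "linear_map K A V (\<lambda>a. smash_pure K A L (pure a b) u)" if "u \<in> carrier U" "b \<in> carrier A" for u b
    by (rule linear_map_comp[OF bilinear_map_left[OF P that(2)] bilinear_map_left[OF V_pure_bilinear that(1)]])
  show "linear_map K W V cm_to_smash"
    unfolding cm_to_smash_def cm_space_def by (rule tensor_lift3_trilinear(1)[OF A_U_A_modules V.module_axioms b l])
  show "a \<in> carrier A \<Longrightarrow> u \<in> carrier U \<Longrightarrow> b \<in> carrier A \<Longrightarrow>
      cm_to_smash (cm_pure K A L a u b) = smash_pure K A L (pure a b) u"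
    unfolding cm_to_smash_def cm_pure_def by (rule tensor_lift3_trilinear(2)[OF A_U_A_modules V.module_axioms b l])
qed

lemma V_linear_eq_pure:
  assumes f: "linear_map K V P f" and g: "linear_map K V P g"
    and eq: "\<And>a b u. a \<in> carrier A \<Longrightarrow> b \<in> carrier A \<Longrightarrow> u \<in> carrier U \<Longrightarrow>
      f (smash_pure K A L (pure a b) u) = g (smash_pure K A L (pure a b) u)"
    and t: "t \<in> carrier V"
  shows "f t = g t"
proof (rule V_linear_eq[OF f g _ t])
  fix x u assume x: "x \<in> carrier Ae" and u: "u \<in> carrier U"
  note l = bilinear_map_left[OF V_pure_bilinear u]
  show "f (smash_pure K A L x u) = g (smash_pure K A L x u)"
    by (rule env_linear_eq[OF A linear_map_comp[OF l f] linear_map_comp[OF l g] _ x]) (simp add: eq u)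
qed

lemma cm_to_smash_to_cm: "t \<in> carrier V \<Longrightarrow> cm_to_smash (smash_to_cm K A L t) = t"
  by (rule V_linear_eq_pure[OF linear_map_comp[OF smash_to_cm_linear cm_to_smash_spec(1)] linear_map_id])
    (simp_all add: smash_to_cm_pure cm_to_smash_spec)

lemma smash_to_cm_to_smash: "t \<in> carrier W \<Longrightarrow> smash_to_cm K A L (cm_to_smash t) = t"
  by (rule W_linear_eq[OF linear_map_comp[OF cm_to_smash_spec(1) smash_to_cm_linear] linear_map_id])
    (simp_all add: smash_to_cm_pure cm_to_smash_spec)

lemmas smash_to_cm_simps = linear_mapD[OF smash_to_cm_linear]
lemmas cm_to_smash_simps = linear_mapD[OF cm_to_smash_spec(1)]

definition right_act where "right_act = tensor_act K L U A (mult U) (act K A L)"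

text \<open>The diagonal action on A \<otimes> (U \<otimes> A). Its second factor is itself a tensor
  product representation, so \<Delta> is iterated on the second leg, exactly as in
  \<open>cm_mult\<close>.\<close>

definition cm_act where "cm_act = tensor_act K L A UA (act K A L) right_act"

lemma right_act_rep: "uea_rep K L UA right_act"
  unfolding right_act_def
  by (rule tensor_act_rep[OF lie U.module_axioms A.module_axioms left_mult_rep[OF lie] act_rep])

lemma cm_act_rep: "uea_rep K L W cm_act"
  unfolding cm_act_def cm_space_def by (rule tensor_act_rep[OF lie A_UA_modules act_rep right_act_rep])

lemma cm_act_gen:
  assumes x: "x \<in> carrier L" and a: "a \<in> carrier A" and v: "v \<in> carrier U" and b: "b \<in> carrier A"
  shows "cm_act (uea_gen K L x) (cm_pure K A L a v b) =
    cm_pure K A L (anchor L x a) v b \<oplus>\<^bsub>W\<^esub>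
    (cm_pure K A L a (uea_gen K L x \<otimes>\<^bsub>U\<^esub> v) b \<oplus>\<^bsub>W\<^esub> cm_pure K A L a v (anchor L x b))"
proof -
  have r: "right_act (uea_gen K L x) (pure_tensor K U A v b) =
      pure_tensor K U A (uea_gen K L x \<otimes>\<^bsub>U\<^esub> v) b \<oplus>\<^bsub>UA\<^esub> pure_tensor K U A v (anchor L x b)"
    unfolding right_act_def
    using tensor_act_gen[OF lie U.module_axioms A.module_axioms left_mult_rep[OF lie] act_rep x v b]
    by (simp add: act_gen x)
  have ac: "anchor L x b \<in> carrier A" by (rule linear_map_closed[OF Der_linear[OF anchor_Der[OF x]] b])
  have "cm_act (uea_gen K L x) (cm_pure K A L a v b) =
      cm_pure K A L (anchor L x a) v b \<oplus>\<^bsub>W\<^esub>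
      pure_tensor K A UA a (right_act (uea_gen K L x) (pure_tensor K U A v b))"
    unfolding cm_act_def cm_pure_def
    using tensor_act_gen[OF lie A_UA_modules act_rep right_act_rep x a bilinear_map_closed[OF UA_pure_bilinear v b]]
    by (simp add: act_gen x cm_space_def)
  also have "pure_tensor K A UA a (right_act (uea_gen K L x) (pure_tensor K U A v b)) =
      cm_pure K A L a (uea_gen K L x \<otimes>\<^bsub>U\<^esub> v) b \<oplus>\<^bsub>W\<^esub> cm_pure K A L a v (anchor L x b)"
    unfolding r cm_pure_def using x a v b ac
    by (intro linear_map_add[OF bilinear_map_right[OF W_pure_bilinear a]] bilinear_map_closed[OF UA_pure_bilinear]) simp_all
  finally show ?thesis .
qed

text \<open>The place where cocommutativity would be expected, since the map exchanges U(L) with the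
  second copy of A. For a generator both sides are the same three terms, and only their order has to
  be adjusted.\<close>

lemma smash_to_cm_act:
  assumes u: "u \<in> carrier U" and t: "t \<in> carrier V"
  shows "smash_to_cm K A L (smash_act u t) = cm_act u (smash_to_cm K A L t)"
proof (rule uea_rep_equivariant[OF lie smash_act_rep cm_act_rep smash_to_cm_linear _ u t])
  fix x t assume x: "x \<in> carrier L" and t: "t \<in> carrier V"
  note P = bilinear_mapD[OF env_pure_bilinear[OF A]]
  have ac: "anchor L x a \<in> carrier A" if "a \<in> carrier A" for a
    by (rule linear_map_closed[OF Der_linear[OF anchor_Der[OF x]] that])
  show "smash_to_cm K A L (smash_act (uea_gen K L x) t) = cm_act (uea_gen K L x) (smash_to_cm K A L t)"
    by (rule V_linear_eq_pure[OF linear_map_comp[OF bilinear_map_right[OF uea_rep_bilinear[OF smash_act_rep]] smash_to_cm_linear]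
          linear_map_comp[OF smash_to_cm_linear bilinear_map_right[OF uea_rep_bilinear[OF cm_act_rep]]] _ t])
      (simp_all add: x smash_act_gen act_env_gen_pure P V_pure smash_to_cm_simps smash_to_cm_pure ac cm_act_gen cm_pure_closed W.M.add.m_ac)
qed

text \<open>The double Sweedler sum is \<open>cm_act u\<close> followed by outer multiplications.
  Since \<open>smash_to_cm\<close> intertwines the two actions, the result is carried over from the
  corresponding product in the smash product.\<close>

lemma cm_mult_pure_aux:
  assumes a: "a \<in> carrier A" and u: "u \<in> carrier U" and b: "b \<in> carrier A"
    and a': "a' \<in> carrier A" and v: "v \<in> carrier U" and b': "b' \<in> carrier A"
  shows "tensor_lift K U U W (\<lambda>u1 w. tensor_lift K U U W (\<lambda>u2 u3.
      cm_pure K A L (a \<otimes>\<^bsub>A\<^esub> act K A L u1 a') (u2 \<otimes>\<^bsub>U\<^esub> v) (act K A L u3 b' \<otimes>\<^bsub>A\<^esub> b)) (comult K L w)) (comult K L u) =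
    smash_to_cm K A L (smash_mult K A L (smash_pure K A L (pure a b) u) (smash_pure K A L (pure a' b') v))"
proof -
  \<comment> \<open>\<kappa> multiplies the left copy of A by a from the left and the right copy by
    b from the right. It is borrowed from multiplication by a \<otimes> b on the smash side, so its
    linearity is already known and it can be pulled out of both sums at once.\<close>
  define \<kappa> where "\<kappa> t = smash_to_cm K A L (env_smult (pure a b) (cm_to_smash t))" for t
  have \<kappa>: "linear_map K W W \<kappa>"
    unfolding \<kappa>_def
    by (rule linear_map_comp[OF linear_map_comp[OF cm_to_smash_spec(1)
            bilinear_map_right[OF env_smult_bilinear env_pure[OF a b]]] smash_to_cm_linear])
  have \<kappa>p: "\<kappa> (cm_pure K A L p q r) = cm_pure K A L (a \<otimes>\<^bsub>A\<^esub> p) q (r \<otimes>\<^bsub>A\<^esub> b)"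
    if "p \<in> carrier A" "q \<in> carrier U" "r \<in> carrier A" for p q r
    using that a b by (simp add: \<kappa>_def cm_to_smash_spec env_smult_pure env_pure env_mult_pure[OF A] smash_to_cm_pure)
  note act = bilinear_mapD[OF uea_rep_bilinear[OF act_rep]]
  note R = uea_rep_bilinear[OF right_act_rep]
  let ?q = "pure_tensor K U A v b'"
  have q: "?q \<in> carrier UA" by (rule bilinear_map_closed[OF UA_pure_bilinear v b'])
  have b1: "bilinear_map K U U UA (\<lambda>u2 u3. pure_tensor K U A (u2 \<otimes>\<^bsub>U\<^esub> v) (act K A L u3 b'))"
    by (rule bilinear_map_compose[OF UA_pure_bilinear bilinear_map_left[OF mult_bilinear[OF U.assoc_algebra_axioms] v]
          bilinear_map_left[OF uea_rep_bilinear[OF act_rep] b'] linear_map_id])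
  have inner: "tensor_lift K U U W (\<lambda>u2 u3.
      cm_pure K A L (a \<otimes>\<^bsub>A\<^esub> act K A L u1 a') (u2 \<otimes>\<^bsub>U\<^esub> v) (act K A L u3 b' \<otimes>\<^bsub>A\<^esub> b)) (comult K L w) =
      \<kappa> (pure_tensor K A UA (act K A L u1 a') (right_act w ?q))"
    if u1: "u1 \<in> carrier U" and w: "w \<in> carrier U" for u1 w
  proof -
    have p: "act K A L u1 a' \<in> carrier A" using u1 a' by (simp add: act)
    have "tensor_lift K U U W (\<lambda>u2 u3.
        cm_pure K A L (a \<otimes>\<^bsub>A\<^esub> act K A L u1 a') (u2 \<otimes>\<^bsub>U\<^esub> v) (act K A L u3 b' \<otimes>\<^bsub>A\<^esub> b)) (comult K L w) =
      tensor_lift K U U W (\<lambda>u2 u3.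
        \<kappa> (pure_tensor K A UA (act K A L u1 a') (pure_tensor K U A (u2 \<otimes>\<^bsub>U\<^esub> v) (act K A L u3 b')))) (comult K L w)"
      using v b' p
      by (intro fun_cong[OF tensor_lift_cong[OF U_modules]])
        (simp add: \<kappa>p[unfolded cm_pure_def] cm_pure_def act)
    also have "\<dots> = \<kappa> (pure_tensor K A UA (act K A L u1 a')
        (tensor_lift K U U UA (\<lambda>u2 u3. pure_tensor K U A (u2 \<otimes>\<^bsub>U\<^esub> v) (act K A L u3 b')) (comult K L w)))"
      by (rule tensor_lift_comp[OF U_modules UA_module b1
            linear_map_comp[OF bilinear_map_right[OF W_pure_bilinear p] \<kappa>] comult_closed[OF lie w]])
    also have "tensor_lift K U U UA (\<lambda>u2 u3. pure_tensor K U A (u2 \<otimes>\<^bsub>U\<^esub> v) (act K A L u3 b')) (comult K L w) = right_act w ?q"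
      unfolding right_act_def
      by (rule tensor_act_pure[OF lie U.module_axioms A.module_axioms left_mult_rep[OF lie] act_rep w v b', symmetric])
    finally show ?thesis .
  qed
  have b2: "bilinear_map K U U W (\<lambda>u1 w. pure_tensor K A UA (act K A L u1 a') (right_act w ?q))"
    by (rule bilinear_map_compose[OF W_pure_bilinear bilinear_map_left[OF uea_rep_bilinear[OF act_rep] a']
          bilinear_map_left[OF R q] linear_map_id])
  have "tensor_lift K U U W (\<lambda>u1 w. tensor_lift K U U W (\<lambda>u2 u3.
      cm_pure K A L (a \<otimes>\<^bsub>A\<^esub> act K A L u1 a') (u2 \<otimes>\<^bsub>U\<^esub> v) (act K A L u3 b' \<otimes>\<^bsub>A\<^esub> b)) (comult K L w)) (comult K L u) =
      tensor_lift K U U W (\<lambda>u1 w. \<kappa> (pure_tensor K A UA (act K A L u1 a') (right_act w ?q))) (comult K L u)"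
    by (intro fun_cong[OF tensor_lift_cong[OF U_modules]] inner)
  also have "\<dots> = \<kappa> (tensor_lift K U U W (\<lambda>u1 w. pure_tensor K A UA (act K A L u1 a') (right_act w ?q)) (comult K L u))"
    by (rule tensor_lift_comp[OF U_modules W.module_axioms b2 \<kappa> comult_closed[OF lie u]])
  also have "tensor_lift K U U W (\<lambda>u1 w. pure_tensor K A UA (act K A L u1 a') (right_act w ?q)) (comult K L u) =
      cm_act u (cm_pure K A L a' v b')"
    unfolding cm_act_def cm_pure_def cm_space_def
    by (rule tensor_act_pure[OF lie A_UA_modules act_rep right_act_rep u a' q, symmetric])
  also have "\<kappa> (cm_act u (cm_pure K A L a' v b')) =
      smash_to_cm K A L (smash_mult K A L (smash_pure K A L (pure a b) u) (smash_pure K A L (pure a' b') v))"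
    using a b u a' v b'
    by (simp add: \<kappa>_def smash_to_cm_pure[symmetric] smash_to_cm_act[symmetric] V_pure env_pure cm_to_smash_to_cm smash_act_simps
        smash_mult_pure)
  finally show ?thesis .
qed

text \<open>The product transported from the smash product is linear in each argument, hence it can
  serve as the candidate for both triple lifts; only the values of \<open>cm_mult_pure_aux\<close>
  have to be matched.\<close>

lemma cm_mult_eq:
  assumes s: "s \<in> carrier W" and t: "t \<in> carrier W"
  shows "cm_mult K A L s t = smash_to_cm K A L (smash_mult K A L (cm_to_smash s) (cm_to_smash t))"
  unfolding cm_mult_def Let_def
proof (rule W_lift_apply[OF linear_map_comp[OF linear_map_comp[OF cm_to_smash_spec(1)
          bilinear_map_left[OF smash_mult_bilinear cm_to_smash_simps(1)[OF t]]] smash_to_cm_linear] _ s])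
  fix a u b assume aub: "a \<in> carrier A" "u \<in> carrier U" "b \<in> carrier A"
  have c: "smash_pure K A L (pure a b) u \<in> carrier V" using aub by (simp add: V_pure env_pure)
  have "tensor_lift3 K A U A W (\<lambda>a' v b'. tensor_lift K U U W (\<lambda>u1 w. tensor_lift K U U W (\<lambda>u2 u3.
      cm_pure K A L (a \<otimes>\<^bsub>A\<^esub> act K A L u1 a') (u2 \<otimes>\<^bsub>U\<^esub> v) (act K A L u3 b' \<otimes>\<^bsub>A\<^esub> b)) (comult K L w)) (comult K L u)) t =
      smash_to_cm K A L (smash_mult K A L (smash_pure K A L (pure a b) u) (cm_to_smash t))"
    by (rule W_lift_apply[OF linear_map_comp[OF linear_map_comp[OF cm_to_smash_spec(1)
            bilinear_map_right[OF smash_mult_bilinear c]] smash_to_cm_linear] _ t])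
      (simp add: cm_mult_pure_aux aub cm_to_smash_spec)
  then show "smash_to_cm K A L (smash_mult K A L (cm_to_smash (cm_pure K A L a u b)) (cm_to_smash t)) =
      tensor_lift3 K A U A W (\<lambda>a' v b'. tensor_lift K U U W (\<lambda>u1 w. tensor_lift K U U W (\<lambda>u2 u3.
      cm_pure K A L (a \<otimes>\<^bsub>A\<^esub> act K A L u1 a') (u2 \<otimes>\<^bsub>U\<^esub> v) (act K A L u3 b' \<otimes>\<^bsub>A\<^esub> b)) (comult K L w)) (comult K L u)) t"
    using aub by (simp add: cm_to_smash_spec)
qed

section \<open>The Connes-Moscovici ring, the isomorphism, and morphisms out of the ring\<close>

lemma cm_simps:
  "carrier (cm K A L) = carrier W" "add (cm K A L) = add W" "zero (cm K A L) = zero W"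
  "smult (cm K A L) = smult W" "mult (cm K A L) = cm_mult K A L"
  "one (cm K A L) = cm_pure K A L \<one>\<^bsub>A\<^esub> \<one>\<^bsub>U\<^esub> \<one>\<^bsub>A\<^esub>"
  "str (cm K A L) = tensor_lift K A (opp_alg A) W (\<lambda>a b. cm_pure K A L a \<one>\<^bsub>U\<^esub> b)"
  by (simp_all add: cm_def module.extend_def)

lemma smash_to_cm_one: "smash_to_cm K A L (smash_pure K A L \<one>\<^bsub>Ae\<^esub> u) = cm_pure K A L \<one>\<^bsub>A\<^esub> u \<one>\<^bsub>A\<^esub>"
  if "u \<in> carrier U"
  using that by (simp add: env_one[OF A] smash_to_cm_pure)

lemma cm_assoc_algebra: "assoc_algebra K (cm K A L)"
proof (rule assoc_algebra_transport[OF smash_assoc_algebra])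
  show "module K (cm K A L)" by (rule module_cong[OF W.module_axioms]) (simp_all add: cm_simps)
  show "linear_map K (smash K A L) (cm K A L) (smash_to_cm K A L)"
    using smash_to_cm_linear by (simp add: linear_map_def cm_simps smash_simps)
  show "linear_map K (cm K A L) (smash K A L) cm_to_smash"
    using cm_to_smash_spec(1) by (simp add: linear_map_def cm_simps smash_simps)
qed (simp_all add: cm_simps smash_simps cm_to_smash_to_cm smash_to_cm_to_smash cm_mult_eq smash_to_cm_one)

lemma smash_to_cm_mult:
  "s \<in> carrier V \<Longrightarrow> t \<in> carrier V \<Longrightarrow>
   smash_to_cm K A L (smash_mult K A L s t) = cm_mult K A L (smash_to_cm K A L s) (smash_to_cm K A L t)"
  by (simp add: cm_mult_eq smash_to_cm_simps cm_to_smash_to_cm)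

lemma smash_to_cm_hom: "smash_to_cm K A L \<in> alg_hom K (smash K A L) (cm K A L)"
  unfolding alg_hom_iff
proof (intro conjI ballI)
  show "linear_map K (smash K A L) (cm K A L) (smash_to_cm K A L)"
    using smash_to_cm_linear by (simp add: linear_map_def cm_simps smash_simps)
  show "smash_to_cm K A L \<in> extensional (carrier (smash K A L))"
    using tensor_lift_hom[OF Ae_U_modules W.module_axioms smash_to_cm_bilinear]
    by (simp add: smash_to_cm_def lin_hom_iff smash_simps smash_space_def)
qed (simp_all add: cm_simps smash_simps smash_to_cm_one smash_to_cm_mult)

lemma cm_str_eq:
  assumes x: "x \<in> carrier Ae"
  shows "str (cm K A L) x = smash_to_cm K A L (str (smash K A L) x)"
proof -
  have "str (cm K A L) x = smash_to_cm K A L (smash_pure K A L x \<one>\<^bsub>U\<^esub>)"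
    unfolding cm_simps
    by (rule env_linear_eq[OF A env_lift_linear[OF A W.module_axioms cm_pure_bilinear]
          linear_map_comp[OF bilinear_map_left[OF V_pure_bilinear] smash_to_cm_linear] _ x])
      (simp_all add: env_lift_pure[OF A W.module_axioms cm_pure_bilinear] smash_to_cm_pure)
  with x show ?thesis by (simp add: smash_simps)
qed

lemma cm_b_ring: "is_b_ring K Ae (cm K A L)"
proof -
  have s: "str (smash K A L) \<in> alg_hom K Ae (smash K A L)" using smash_b_ring by (simp add: is_b_ring_def)
  have "str (cm K A L) \<in> extensional (carrier Ae)"
    using env_lift_hom[OF A W.module_axioms cm_pure_bilinear[OF U.M.one_closed]] by (simp add: cm_simps lin_hom_iff)
  then have "str (cm K A L) = compose (carrier Ae) (smash_to_cm K A L) (str (smash K A L))"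
    by (rule extensionalityI[OF _ compose_extensional]) (simp add: compose_eq cm_str_eq)
  then have "str (cm K A L) \<in> alg_hom K Ae (cm K A L)"
    using alg_hom_compose[OF Ae.assoc_algebra_axioms s smash_to_cm_hom] by simp
  then show ?thesis by (simp add: is_b_ring_def cm_assoc_algebra)
qed

lemma smash_to_cm_iso: "smash_to_cm K A L \<in> b_ring_iso K Ae (smash K A L) (cm K A L)"
proof -
  have "bij_betw (smash_to_cm K A L) (carrier V) (carrier W)"
    by (rule bij_betw_byWitness[where f' = cm_to_smash])
      (auto simp: cm_to_smash_to_cm smash_to_cm_to_smash smash_to_cm_simps cm_to_smash_simps)
  then show ?thesis
    by (simp add: b_ring_iso_def b_ring_hom_def smash_to_cm_hom cm_str_eq cm_simps(1) smash_simps(1))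
qed

lemma cm_pure_factor:
  assumes "a \<in> carrier A" "u \<in> carrier U" "b \<in> carrier A"
  shows "cm_pure K A L a u b = cm_mult K A L (str (cm K A L) (pure a b)) (cm_pure K A L \<one>\<^bsub>A\<^esub> u \<one>\<^bsub>A\<^esub>)"
proof -
  have "cm_pure K A L a u b = smash_to_cm K A L (smash_pure K A L (pure a b) u)"
    using assms by (simp add: smash_to_cm_pure)
  also have "\<dots> = smash_to_cm K A L (smash_mult K A L (smash_pure K A L (pure a b) \<one>\<^bsub>U\<^esub>) (smash_pure K A L \<one>\<^bsub>Ae\<^esub> u))"
    using assms by (simp only: smash_pure_factor[OF env_pure])
  finally show ?thesis
    using assms by (simp add: smash_to_cm_mult V_pure env_pure cm_str_eq smash_simps(7) smash_to_cm_one)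
qed

lemma cm_unit_hom: "(\<lambda>u\<in>carrier U. cm_pure K A L \<one>\<^bsub>A\<^esub> u \<one>\<^bsub>A\<^esub>) \<in> alg_hom K U (cm K A L)"
proof -
  have "(\<lambda>u\<in>carrier U. cm_pure K A L \<one>\<^bsub>A\<^esub> u \<one>\<^bsub>A\<^esub>) =
      compose (carrier U) (smash_to_cm K A L) (\<lambda>u\<in>carrier U. smash_pure K A L \<one>\<^bsub>Ae\<^esub> u)"
    by (auto intro!: restrict_ext simp: compose_def smash_to_cm_one)
  then show ?thesis
    using alg_hom_compose[OF U.assoc_algebra_axioms smash_pure_env_one_hom smash_to_cm_hom] by simp
qed

text \<open>\<open>smash_commute\<close> carried over, with the action of the generator written as
  \<open>der_tensor\<close> so that it can be read as the membership condition of
  \<open>LA\<close>.\<close>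

lemma cm_commute:
  assumes x: "x \<in> carrier L" and y: "y \<in> carrier Ae"
  shows "cm_mult K A L (cm_pure K A L \<one>\<^bsub>A\<^esub> (uea_gen K L x) \<one>\<^bsub>A\<^esub>) (str (cm K A L) y) =
    str (cm K A L) (der_tensor K A (anchor L x) y) \<oplus>\<^bsub>W\<^esub>
    cm_mult K A L (str (cm K A L) y) (cm_pure K A L \<one>\<^bsub>A\<^esub> (uea_gen K L x) \<one>\<^bsub>A\<^esub>)"
proof -
  have d: "act_env K A L (uea_gen K L x) y \<in> carrier Ae" using x y by (simp add: act_env_simps)
  have "smash_to_cm K A L (smash_mult K A L (smash_pure K A L \<one>\<^bsub>Ae\<^esub> (uea_gen K L x)) (smash_pure K A L y \<one>\<^bsub>U\<^esub>)) =
      smash_to_cm K A L (smash_pure K A L (act_env K A L (uea_gen K L x) y) \<one>\<^bsub>U\<^esub> \<oplus>\<^bsub>V\<^esub>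
        smash_mult K A L (smash_pure K A L y \<one>\<^bsub>U\<^esub>) (smash_pure K A L \<one>\<^bsub>Ae\<^esub> (uea_gen K L x)))"
    by (simp only: smash_commute[OF x y])
  then show ?thesis
    using x y d
    by (simp add: smash_to_cm_simps smash_to_cm_mult V_pure smash_mult_simps cm_str_eq smash_simps(7) smash_to_cm_one)
      (simp add: act_env_gen cm_str_eq smash_simps(7))
qed

text \<open>The extension obtained for the smash product, composed with the inverse of the
  isomorphism.\<close>

lemma cm_lift:
  assumes R: "assoc_algebra K R" and \<phi>: "\<phi> \<in> alg_hom K Ae R" and \<rho>: "\<rho> \<in> alg_hom K U R"
    and comm: "\<And>x y. x \<in> carrier L \<Longrightarrow> y \<in> carrier Ae \<Longrightarrow>
      \<rho> (uea_gen K L x) \<otimes>\<^bsub>R\<^esub> \<phi> y = \<phi> (der_tensor K A (anchor L x) y) \<oplus>\<^bsub>R\<^esub> \<phi> y \<otimes>\<^bsub>R\<^esub> \<rho> (uea_gen K L x)"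
  shows "\<exists>g \<in> alg_hom K (cm K A L) R. (\<forall>y \<in> carrier Ae. g (str (cm K A L) y) = \<phi> y) \<and>
    (\<forall>a \<in> carrier A. \<forall>u \<in> carrier U. \<forall>b \<in> carrier A. g (cm_pure K A L a u b) = \<phi> (pure a b) \<otimes>\<^bsub>R\<^esub> \<rho> u)"
proof -
  interpret R: assoc_algebra K R by (rule R)
  interpret C: assoc_algebra K "cm K A L" by (rule cm_assoc_algebra)
  obtain g where g: "g \<in> alg_hom K (smash K A L) R"
    and gp: "\<And>x u. x \<in> carrier Ae \<Longrightarrow> u \<in> carrier U \<Longrightarrow> g (smash_pure K A L x u) = \<phi> x \<otimes>\<^bsub>R\<^esub> \<rho> u"
    using smash_lift[OF R \<phi> \<rho>] comm by (auto simp: act_env_gen)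
  \<comment> \<open>Membership in \<open>alg_hom\<close> includes extensionality, while
    \<open>cm_to_smash_spec\<close> records linearity and values only; hence the explicit
    restriction.\<close>
  have "(\<lambda>t\<in>carrier W. cm_to_smash t) \<in> alg_hom K (cm K A L) (smash K A L)"
    unfolding alg_hom_iff
  proof (intro conjI ballI)
    show "linear_map K (cm K A L) (smash K A L) (\<lambda>t\<in>carrier W. cm_to_smash t)"
      by (rule linear_map_cong[OF _ _ C.module_axioms, of _ cm_to_smash])
        (use cm_to_smash_spec(1) in \<open>simp_all add: linear_map_def cm_simps smash_simps\<close>)
    have "cm_to_smash (cm_pure K A L \<one>\<^bsub>A\<^esub> \<one>\<^bsub>U\<^esub> \<one>\<^bsub>A\<^esub>) = smash_pure K A L \<one>\<^bsub>Ae\<^esub> \<one>\<^bsub>U\<^esub>"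
      by (simp add: cm_to_smash_spec env_one[OF A])
    then show "(\<lambda>t\<in>carrier W. cm_to_smash t) \<one>\<^bsub>cm K A L\<^esub> = \<one>\<^bsub>smash K A L\<^esub>"
      by (simp add: cm_simps smash_simps cm_pure_closed)
    fix s t assume "s \<in> carrier (cm K A L)" "t \<in> carrier (cm K A L)"
    then have st: "s \<in> carrier W" "t \<in> carrier W" by (simp_all add: cm_simps)
    then show "(\<lambda>t\<in>carrier W. cm_to_smash t) (s \<otimes>\<^bsub>cm K A L\<^esub> t) =
        (\<lambda>t\<in>carrier W. cm_to_smash t) s \<otimes>\<^bsub>smash K A L\<^esub> (\<lambda>t\<in>carrier W. cm_to_smash t) t"
      by (simp add: cm_simps(5) smash_simps(5) cm_mult_eq smash_to_cm_simps cm_to_smash_simps smash_mult_simps cm_to_smash_to_cm)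
  qed (simp add: cm_simps)
  then have h: "compose (carrier W) g (\<lambda>t\<in>carrier W. cm_to_smash t) \<in> alg_hom K (cm K A L) R"
    using alg_hom_compose[OF C.assoc_algebra_axioms _ g] by (simp add: cm_simps(1))
  show ?thesis
  proof (intro bexI[OF _ h] conjI ballI)
    fix y assume y: "y \<in> carrier Ae"
    then show "compose (carrier W) g (\<lambda>t\<in>carrier W. cm_to_smash t) (str (cm K A L) y) = \<phi> y"
      by (simp add: compose_eq cm_str_eq smash_simps(7) smash_to_cm_simps V_pure cm_to_smash_to_cm gp alg_homD[OF \<phi>] alg_homD[OF \<rho>])
  next
    fix a u b assume "a \<in> carrier A" "u \<in> carrier U" "b \<in> carrier A"
    then show "compose (carrier W) g (\<lambda>t\<in>carrier W. cm_to_smash t) (cm_pure K A L a u b) = \<phi> (pure a b) \<otimes>\<^bsub>R\<^esub> \<rho> u"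
      by (simp add: compose_eq cm_pure_closed cm_to_smash_spec gp env_pure)
  qed
qed

lemma cm_hom_pure:
  assumes g: "g \<in> b_ring_hom K Ae (cm K A L) R" and "a \<in> carrier A" "u \<in> carrier U" "b \<in> carrier A"
  shows "g (cm_pure K A L a u b) = str R (pure a b) \<otimes>\<^bsub>R\<^esub> g (cm_pure K A L \<one>\<^bsub>A\<^esub> u \<one>\<^bsub>A\<^esub>)"
proof -
  have h: "g \<in> alg_hom K (cm K A L) R" and s: "g (str (cm K A L) (pure a b)) = str R (pure a b)"
    using g assms(2,4) env_pure by (auto simp: b_ring_hom_def)
  have "str (cm K A L) (pure a b) \<in> carrier W"
    using assms(2,4) by (simp add: cm_str_eq env_pure smash_simps(7) smash_to_cm_simps V_pure)
  then have "g (cm_mult K A L (str (cm K A L) (pure a b)) (cm_pure K A L \<one>\<^bsub>A\<^esub> u \<one>\<^bsub>A\<^esub>)) =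
      str R (pure a b) \<otimes>\<^bsub>R\<^esub> g (cm_pure K A L \<one>\<^bsub>A\<^esub> u \<one>\<^bsub>A\<^esub>)"
    using alg_hom_mult[OF h, of "str (cm K A L) (pure a b)" "cm_pure K A L \<one>\<^bsub>A\<^esub> u \<one>\<^bsub>A\<^esub>"] assms(3)
    by (simp add: cm_simps(1,5) cm_pure_closed s)
  then show ?thesis using cm_pure_factor[OF assms(2-4)] by simp
qed

end

section \<open>The adjunction\<close>

text \<open>Passes between the commutator condition in \<open>L_ring\<close> and its
  subtraction-free form in \<open>cm_commute\<close> and \<open>cm_lift\<close>.\<close>

lemma (in abelian_group) minus_eq_iff_eq_add:
  assumes "x \<in> carrier G" "y \<in> carrier G" "z \<in> carrier G"
  shows "x \<ominus> y = z \<longleftrightarrow> x = z \<oplus> y"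
proof
  assume "x \<ominus> y = z"
  then have "z \<oplus> y = (x \<ominus> y) \<oplus> y" by simp
  also have "\<dots> = x" using assms by (simp add: a_minus_def a_assoc l_neg)
  finally show "x = z \<oplus> y" by simp
next
  assume "x = z \<oplus> y"
  then show "x \<ominus> y = z" using assms by (simp add: a_minus_def a_assoc r_neg)
qed

lemma lie_hom_closed: "f \<in> lie_hom K L M \<Longrightarrow> x \<in> carrier L \<Longrightarrow> f x \<in> carrier M"
  by (auto simp: lie_hom_def lin_hom_iff linear_map_def)

lemma anch_hom_compose:
  assumes "lie_algebra K L" "f \<in> anch_hom K L M" "g \<in> anch_hom K M N"
  shows "compose (carrier L) g f \<in> anch_hom K L N"
proof -
  interpret L: lie_algebra K L by fact
  have f: "linear_map K L M f" and g: "linear_map K M N g"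
    using assms(2,3) by (auto simp: anch_hom_def lie_hom_def lin_hom_iff)
  have "linear_map K L N (compose (carrier L) g f)"
    by (rule linear_map_cong[OF linear_map_comp[OF f g] _ L.module_axioms]) (simp add: compose_eq)
  with assms(2,3) linear_map_closed[OF f] show ?thesis
    by (auto simp: anch_hom_def lie_hom_def lin_hom_iff compose_eq L.bracket_closed)
qed

lemma uea_map_spec:
  assumes L: "lie_algebra K L" and M: "lie_algebra K M" and f: "f \<in> lie_hom K L M"
  shows "uea_map K L M f \<in> alg_hom K (uea K L) (uea K M) \<and>
    (\<forall>x \<in> carrier L. uea_map K L M f (uea_gen K L x) = uea_gen K M (f x))"
  unfolding uea_map_def
proof (rule uea_lift_spec[OF L uea_assoc_algebra[OF M]])
  have lin: "linear_map K L M f"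
    and br: "\<And>x y. x \<in> carrier L \<Longrightarrow> y \<in> carrier L \<Longrightarrow> f (bracket L x y) = bracket M (f x) (f y)"
    using f by (auto simp: lie_hom_def lin_hom_iff)
  show "linear_map K L (uea K M) (\<lambda>x. uea_gen K M (f x))"
    by (rule linear_map_comp[OF lin uea_gen_linear[OF M]])
  fix x y assume "x \<in> carrier L" "y \<in> carrier L"
  then show "uea_gen K M (f (bracket L x y)) =
      uea_gen K M (f x) \<otimes>\<^bsub>uea K M\<^esub> uea_gen K M (f y) \<ominus>\<^bsub>uea K M\<^esub> uea_gen K M (f y) \<otimes>\<^bsub>uea K M\<^esub> uea_gen K M (f x)"
    by (simp add: br uea_gen_bracket[OF M] linear_map_closed[OF lin])
qed

section \<open>Unit of the adjunction and bijectivity of the transpose\<close>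

context anchored
begin

text \<open>Restricted to the elements 1 \<otimes> u \<otimes> 1, both morphisms become algebra
  morphisms on U(L), which are determined by the generators. The outer factors then contribute only
  values of \<open>str R\<close>, which are the same for g and h.\<close>

lemma cm_hom_eqI:
  assumes g: "g \<in> b_ring_hom K Ae (cm K A L) R" and h: "h \<in> b_ring_hom K Ae (cm K A L) R"
    and eq: "\<And>x. x \<in> carrier L \<Longrightarrow>
      g (cm_pure K A L \<one>\<^bsub>A\<^esub> (uea_gen K L x) \<one>\<^bsub>A\<^esub>) = h (cm_pure K A L \<one>\<^bsub>A\<^esub> (uea_gen K L x) \<one>\<^bsub>A\<^esub>)"
  shows "g = h"
proof -
  have ga: "g \<in> alg_hom K (cm K A L) R" and ha: "h \<in> alg_hom K (cm K A L) R"
    using g h by (simp_all add: b_ring_hom_def)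
  let ?\<eta> = "\<lambda>u\<in>carrier U. cm_pure K A L \<one>\<^bsub>A\<^esub> u \<one>\<^bsub>A\<^esub>"
  have "compose (carrier U) g ?\<eta> = compose (carrier U) h ?\<eta>"
    by (rule uea_alg_hom_eq[OF lie alg_hom_compose[OF U.assoc_algebra_axioms cm_unit_hom ga]
          alg_hom_compose[OF U.assoc_algebra_axioms cm_unit_hom ha]]) (simp add: compose_eq eq)
  then have u: "g (cm_pure K A L \<one>\<^bsub>A\<^esub> u \<one>\<^bsub>A\<^esub>) = h (cm_pure K A L \<one>\<^bsub>A\<^esub> u \<one>\<^bsub>A\<^esub>)" if "u \<in> carrier U" for u
    using that by (auto simp: compose_def fun_eq_iff split: if_splits dest: spec[of _ u])
  have lin: "linear_map K W R g" "linear_map K W R h"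
    using alg_hom_linear[OF ga] alg_hom_linear[OF ha] by (simp_all add: linear_map_def cm_simps)
  show ?thesis
  proof (rule extensionalityI[OF alg_hom_extensional[OF ga] alg_hom_extensional[OF ha]])
    fix t assume "t \<in> carrier (cm K A L)"
    then have t: "t \<in> carrier W" by (simp add: cm_simps)
    show "g t = h t"
    proof (rule W_linear_eq[OF lin _ t])
      fix a u b assume aub: "a \<in> carrier A" "u \<in> carrier U" "b \<in> carrier A"
      show "g (cm_pure K A L a u b) = h (cm_pure K A L a u b)"
        using cm_hom_pure[OF g aub] cm_hom_pure[OF h aub] u[OF aub(2)] by simp
    qed
  qed
qed

lemma cm_unit_apply:
  "x \<in> carrier L \<Longrightarrow> cm_unit K A L x =
    ((cm_pure K A L \<one>\<^bsub>A\<^esub> (uea_gen K L x) \<one>\<^bsub>A\<^esub>, der_tensor K A (anchor L x)), anchor L x)"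
  by (simp add: cm_unit_def)

lemma cm_unit_closed:
  assumes x: "x \<in> carrier L" shows "cm_unit K A L x \<in> carrier (LA K A (cm K A L))"
proof -
  interpret C: assoc_algebra K "cm K A L" by (rule cm_assoc_algebra)
  let ?g = "cm_pure K A L \<one>\<^bsub>A\<^esub> (uea_gen K L x) \<one>\<^bsub>A\<^esub>"
  have hom: "str (cm K A L) \<in> alg_hom K Ae (cm K A L)" using cm_b_ring by (simp add: is_b_ring_def)
  have g: "?g \<in> carrier (cm K A L)" using x by (simp add: cm_simps cm_pure_closed)
  have "?g \<otimes>\<^bsub>cm K A L\<^esub> str (cm K A L) y \<ominus>\<^bsub>cm K A L\<^esub> str (cm K A L) y \<otimes>\<^bsub>cm K A L\<^esub> ?g =
      str (cm K A L) (der_tensor K A (anchor L x) y)" if y: "y \<in> carrier Ae" for y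
  proof -
    have d: "der_tensor K A (anchor L x) y \<in> carrier Ae"
      by (rule linear_map_closed[OF der_tensor_linear[OF A Der_linear[OF anchor_Der[OF x]]] y])
    show ?thesis
      using g alg_hom_closed[OF hom y] alg_hom_closed[OF hom d]
        cm_commute[OF x y, folded cm_simps(2,5)]
      by (simp add: C.M.minus_eq_iff_eq_add)
  qed
  with g show ?thesis by (simp add: cm_unit_apply x LA_carrier[OF A] anchor_Der)
qed

text \<open>Brackets are checked in three components: the first by the defining relation of U(L),
  the second by \<open>der_tensor_ops\<close>, the third because the anchor is a Lie
  morphism.\<close>

lemma cm_unit_anch_hom: "cm_unit K A L \<in> anch_hom K L (LA K A (cm K A L))"
proof -
  have ah: "linear_map K L (Der K A) (anchor L)"
    and br: "\<And>x y. x \<in> carrier L \<Longrightarrow> y \<in> carrier L \<Longrightarrow> anchor L (bracket L x y) = bracket (Der K A) (anchor L x) (anchor L y)"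
    using anchor_hom by (auto simp: lie_hom_def lin_hom_iff)
  interpret C: assoc_algebra K "cm K A L" by (rule cm_assoc_algebra)
  define \<eta> where "\<eta> x = cm_pure K A L \<one>\<^bsub>A\<^esub> (uea_gen K L x) \<one>\<^bsub>A\<^esub>" for x
  have "linear_map K U W (\<lambda>u. cm_pure K A L \<one>\<^bsub>A\<^esub> u \<one>\<^bsub>A\<^esub>)" by (rule cm_pure_linear) simp_all
  then have Ulin: "linear_map K U (cm K A L) (\<lambda>u. cm_pure K A L \<one>\<^bsub>A\<^esub> u \<one>\<^bsub>A\<^esub>)" by (simp add: linear_map_def cm_simps)
  then have lin: "linear_map K L (cm K A L) \<eta>"
    unfolding \<eta>_def by (rule linear_map_comp[OF uea_gen_linear[OF lie]])
  have mult: "cm_pure K A L \<one>\<^bsub>A\<^esub> (u \<otimes>\<^bsub>U\<^esub> v) \<one>\<^bsub>A\<^esub> =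
      cm_pure K A L \<one>\<^bsub>A\<^esub> u \<one>\<^bsub>A\<^esub> \<otimes>\<^bsub>cm K A L\<^esub> cm_pure K A L \<one>\<^bsub>A\<^esub> v \<one>\<^bsub>A\<^esub>"
    if "u \<in> carrier U" "v \<in> carrier U" for u v
    using alg_hom_mult[OF cm_unit_hom that] that by simp
  have brk: "\<eta> (bracket L x y) = \<eta> x \<otimes>\<^bsub>cm K A L\<^esub> \<eta> y \<ominus>\<^bsub>cm K A L\<^esub> \<eta> y \<otimes>\<^bsub>cm K A L\<^esub> \<eta> x"
    if "x \<in> carrier L" "y \<in> carrier L" for x y
    using that
    by (simp add: \<eta>_def uea_gen_bracket[OF lie] linear_map_minus[OF U.module_axioms C.module_axioms Ulin] mult)
  note [simp] = cm_unit_apply[folded \<eta>_def] linear_mapD[OF lin] linear_mapD[OF ah]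
  have "cm_unit K A L \<in> lie_hom K L (LA K A (cm K A L))"
    unfolding lie_hom_def lin_hom_iff
  proof (intro CollectI conjI ballI linear_mapI cm_unit_closed)
    fix x assume x: "x \<in> carrier L"
    fix c assume c: "c \<in> carrier K"
    show "cm_unit K A L (c \<odot>\<^bsub>L\<^esub> x) = c \<odot>\<^bsub>LA K A (cm K A L)\<^esub> cm_unit K A L x"
      using x c by (simp add: LA_ops[OF A] der_tensor_ops(2)[OF A anchor_Der anchor_Der])
  next
    fix x y assume x: "x \<in> carrier L" and y: "y \<in> carrier L"
    show "cm_unit K A L (x \<oplus>\<^bsub>L\<^esub> y) = cm_unit K A L x \<oplus>\<^bsub>LA K A (cm K A L)\<^esub> cm_unit K A L y"
      using x y by (simp add: LA_ops[OF A] der_tensor_ops(1)[OF A anchor_Der anchor_Der])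
    show "cm_unit K A L (bracket L x y) = bracket (LA K A (cm K A L)) (cm_unit K A L x) (cm_unit K A L y)"
      using x y by (simp add: LA_ops[OF A] L.bracket_closed brk br der_tensor_ops(3)[OF A anchor_Der anchor_Der])
  qed (simp_all add: cm_unit_def)
  moreover have "anchor (LA K A (cm K A L)) (cm_unit K A L x) = anchor L x" if "x \<in> carrier L" for x
    using that cm_unit_closed[OF that] by (simp add: LA_anchor[OF A])
  ultimately show ?thesis by (simp add: anch_hom_def)
qed

lemma cm_transpose_apply:
  "x \<in> carrier L \<Longrightarrow> cm_transpose K A L g x =
    ((g (cm_pure K A L \<one>\<^bsub>A\<^esub> (uea_gen K L x) \<one>\<^bsub>A\<^esub>), der_tensor K A (anchor L x)), anchor L x)"
  using cm_unit_closed[of x] by (simp add: cm_transpose_def compose_eq cm_unit_apply LA_map_apply[OF A])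

lemma cm_transpose_extensional: "cm_transpose K A L g \<in> extensional (carrier L)"
  by (simp add: cm_transpose_def)

lemma cm_transpose_surj:
  assumes R: "is_b_ring K Ae R" and f: "f \<in> anch_hom K L (LA K A R)"
  shows "\<exists>g \<in> b_ring_hom K Ae (cm K A L) R. cm_transpose K A L g = f"
proof -
  have RA: "assoc_algebra K R" and \<phi>: "str R \<in> alg_hom K Ae R" using R by (simp_all add: is_b_ring_def)
  interpret R: assoc_algebra K R by (rule RA)
  have flin: "linear_map K L (LA K A R) f" and fext: "f \<in> extensional (carrier L)"
    and fbr: "\<And>x y. x \<in> carrier L \<Longrightarrow> y \<in> carrier L \<Longrightarrow> f (bracket L x y) = bracket (LA K A R) (f x) (f y)"
    and fanch: "\<And>x. x \<in> carrier L \<Longrightarrow> anchor (LA K A R) (f x) = anchor L x"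
    using f by (auto simp: anch_hom_def lie_hom_def lin_hom_iff)
  \<comment> \<open>Only this component of f carries information: compatibility with anchors forces
    the outer derivation to be the anchor of x, and membership in \<open>LA\<close> then forces the
    middle one.\<close>
  define r where "r x = fst (fst (f x))" for x
  have fx: "f x = ((r x, der_tensor K A (anchor L x)), anchor L x) \<and> f x \<in> carrier (LA K A R)" if x: "x \<in> carrier L" for x
  proof -
    have c: "f x \<in> carrier (LA K A R)" by (rule linear_map_closed[OF flin x])
    obtain D d where e: "f x = ((r x, D), d)" unfolding r_def by (metis prod.collapse)
    have "d = anchor L x" using LA_anchor[OF A, of "r x" D d R] c fanch[OF x] by (simp add: e)
    moreover have "D = der_tensor K A d" using c by (simp add: e LA_carrier[OF A])
    ultimately show ?thesis using c e by simp
  qed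
  have rc: "r x \<in> carrier R" and rcomm: "\<And>y. y \<in> carrier Ae \<Longrightarrow>
      r x \<otimes>\<^bsub>R\<^esub> str R y \<ominus>\<^bsub>R\<^esub> str R y \<otimes>\<^bsub>R\<^esub> r x = str R (der_tensor K A (anchor L x) y)" if "x \<in> carrier L" for x
    using fx[OF that] LA_carrier[OF A, of "r x" "der_tensor K A (anchor L x)" "anchor L x" R] by auto
  have rlin: "linear_map K L R r"
  proof (rule linear_mapI[OF rc])
    fix x y assume xy: "x \<in> carrier L" "y \<in> carrier L"
    then have "f (x \<oplus>\<^bsub>L\<^esub> y) = f x \<oplus>\<^bsub>LA K A R\<^esub> f y" by (simp add: linear_mapD[OF flin])
    then show "r (x \<oplus>\<^bsub>L\<^esub> y) = r x \<oplus>\<^bsub>R\<^esub> r y" using xy fx by (simp add: LA_ops[OF A])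
  next
    fix c x assume cx: "c \<in> carrier K" "x \<in> carrier L"
    then have "f (c \<odot>\<^bsub>L\<^esub> x) = c \<odot>\<^bsub>LA K A R\<^esub> f x" by (simp add: linear_mapD[OF flin])
    then show "r (c \<odot>\<^bsub>L\<^esub> x) = c \<odot>\<^bsub>R\<^esub> r x" using cx fx by (simp add: LA_ops[OF A])
  qed
  have rbr: "r (bracket L x y) = r x \<otimes>\<^bsub>R\<^esub> r y \<ominus>\<^bsub>R\<^esub> r y \<otimes>\<^bsub>R\<^esub> r x" if "x \<in> carrier L" "y \<in> carrier L" for x y
    using fbr[OF that] that fx by (simp add: LA_ops[OF A] L.bracket_closed)
  note \<rho> = uea_lift_hom[OF lie RA rlin rbr] and \<rho>g = uea_lift_gen[OF lie RA rlin rbr]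
  let ?\<rho> = "uea_lift K L R r"
  have comm: "?\<rho> (uea_gen K L x) \<otimes>\<^bsub>R\<^esub> str R y =
      str R (der_tensor K A (anchor L x) y) \<oplus>\<^bsub>R\<^esub> str R y \<otimes>\<^bsub>R\<^esub> ?\<rho> (uea_gen K L x)"
    if x: "x \<in> carrier L" and y: "y \<in> carrier Ae" for x y
  proof -
    have d: "der_tensor K A (anchor L x) y \<in> carrier Ae"
      by (rule linear_map_closed[OF der_tensor_linear[OF A Der_linear[OF anchor_Der[OF x]]] y])
    show ?thesis
      using rcomm[OF x y] x alg_hom_closed[OF \<phi> y] alg_hom_closed[OF \<phi> d] rc[OF x]
      by (simp add: \<rho>g R.M.minus_eq_iff_eq_add)
  qed
  obtain g where g: "g \<in> alg_hom K (cm K A L) R" "\<And>y. y \<in> carrier Ae \<Longrightarrow> g (str (cm K A L) y) = str R y"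
    "\<And>a u b. a \<in> carrier A \<Longrightarrow> u \<in> carrier U \<Longrightarrow> b \<in> carrier A \<Longrightarrow> g (cm_pure K A L a u b) = str R (pure a b) \<otimes>\<^bsub>R\<^esub> ?\<rho> u"
    using cm_lift[OF RA \<phi> \<rho> comm] by blast
  have "cm_transpose K A L g = f"
  proof (rule extensionalityI[OF cm_transpose_extensional fext])
    fix x assume x: "x \<in> carrier L"
    \<comment> \<open>The value of g at 1 \<otimes> x \<otimes> 1 has a factor from the structure
      map, which is the unit here, so that r x is left.\<close>
    have "str R (pure \<one>\<^bsub>A\<^esub> \<one>\<^bsub>A\<^esub>) = \<one>\<^bsub>R\<^esub>" using alg_hom_one[OF \<phi>] by (simp add: env_one[OF A])
    then have "g (cm_pure K A L \<one>\<^bsub>A\<^esub> (uea_gen K L x) \<one>\<^bsub>A\<^esub>) = r x" using x by (simp add: g(3) \<rho>g rc)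
    then show "cm_transpose K A L g x = f x" using fx[OF x] by (simp add: cm_transpose_apply x)
  qed
  moreover have "g \<in> b_ring_hom K Ae (cm K A L) R" using g(1,2) by (simp add: b_ring_hom_def)
  ultimately show ?thesis by blast
qed

lemma cm_transpose_bij:
  assumes R: "is_b_ring K Ae R"
  shows "bij_betw (cm_transpose K A L) (b_ring_hom K Ae (cm K A L) R) (anch_hom K L (LA K A R))"
proof (rule bij_betw_imageI)
  show "inj_on (cm_transpose K A L) (b_ring_hom K Ae (cm K A L) R)"
  proof (rule inj_onI)
    fix g h assume g: "g \<in> b_ring_hom K Ae (cm K A L) R" and h: "h \<in> b_ring_hom K Ae (cm K A L) R"
      and eq: "cm_transpose K A L g = cm_transpose K A L h"
    show "g = h"
    proof (rule cm_hom_eqI[OF g h])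
      fix x assume x: "x \<in> carrier L"
      have "cm_transpose K A L g x = cm_transpose K A L h x" by (simp add: eq)
      then show "g (cm_pure K A L \<one>\<^bsub>A\<^esub> (uea_gen K L x) \<one>\<^bsub>A\<^esub>) = h (cm_pure K A L \<one>\<^bsub>A\<^esub> (uea_gen K L x) \<one>\<^bsub>A\<^esub>)"
        using x by (simp add: cm_transpose_apply)
    qed
  qed
  have "cm_transpose K A L g \<in> anch_hom K L (LA K A R)" if g: "g \<in> b_ring_hom K Ae (cm K A L) R" for g
    unfolding cm_transpose_def
    by (rule anch_hom_compose[OF lie cm_unit_anch_hom LA_map_hom[OF A cm_b_ring R g]])
  then show "cm_transpose K A L ` b_ring_hom K Ae (cm K A L) R = anch_hom K L (LA K A R)"
    using cm_transpose_surj[OF R] by blast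
qed

lemma cm_map_id: "cm_map K A L L (\<lambda>x\<in>carrier L. x) = (\<lambda>x\<in>carrier (cm K A L). x)"
proof -
  have id: "(\<lambda>u\<in>carrier U. u) \<in> alg_hom K U U"
    by (auto simp: alg_hom_iff intro: linear_map_cong[OF linear_map_id _ U.module_axioms])
  have "(\<lambda>x\<in>carrier L. x) \<in> lie_hom K L L"
    by (auto simp: lie_hom_def lin_hom_iff L.bracket_closed intro: linear_map_cong[OF linear_map_id _ L.module_axioms])
  note spec = uea_map_spec[OF lie lie this]
  have "uea_map K L L (\<lambda>x\<in>carrier L. x) = (\<lambda>u\<in>carrier U. u)"
    by (rule uea_alg_hom_eq[OF lie conjunct1[OF spec] id]) (simp add: spec)
  then show ?thesis
    unfolding cm_map_def cm_simps
    by (intro W_lift_eq restrict_lin_hom[OF W.module_axioms linear_map_id]) (simp add: cm_pure_closed)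
qed

end

text \<open>Rather than checking that the given formula is multiplicative, a ring morphism into the
  Connes-Moscovici ring of L' is produced by \<open>cm_lift\<close> and then recognised as
  \<open>cm_map\<close> by its values on pure tensors.\<close>

lemma cm_map_spec:
  assumes A: "assoc_algebra K A" and L: "is_anch_lie K A L" and L': "is_anch_lie K A L'" and f: "f \<in> anch_hom K L L'"
  shows "cm_map K A L L' f \<in> b_ring_hom K (env_alg K A) (cm K A L) (cm K A L') \<and>
    (\<forall>a \<in> carrier A. \<forall>u \<in> carrier (uea K L). \<forall>b \<in> carrier A.
      cm_map K A L L' f (cm_pure K A L a u b) = cm_pure K A L' a (uea_map K L L' f u) b)"
proof -
  interpret L: anchored K A L by (rule anchored.intro[OF A L])
  interpret L': anchored K A L' by (rule anchored.intro[OF A L'])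
  have fl: "f \<in> lie_hom K L L'" and fa: "\<And>x. x \<in> carrier L \<Longrightarrow> anchor L' (f x) = anchor L x"
    using f by (auto simp: anch_hom_def)
  have fc: "f x \<in> carrier L'" if "x \<in> carrier L" for x
    using fl that by (rule lie_hom_closed)
  note spec = uea_map_spec[OF L.lie L'.lie fl]
  note hom = conjunct1[OF spec]
  let ?\<eta> = "\<lambda>u\<in>carrier (uea K L'). cm_pure K A L' \<one>\<^bsub>A\<^esub> u \<one>\<^bsub>A\<^esub>"
  let ?\<rho> = "compose (carrier (uea K L)) ?\<eta> (uea_map K L L' f)"
  have \<rho>: "?\<rho> \<in> alg_hom K (uea K L) (cm K A L')"
    by (rule alg_hom_compose[OF L.U.assoc_algebra_axioms hom L'.cm_unit_hom])
  have \<rho>u: "?\<rho> u = cm_pure K A L' \<one>\<^bsub>A\<^esub> (uea_map K L L' f u) \<one>\<^bsub>A\<^esub>" if "u \<in> carrier (uea K L)" for u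
    using that by (simp add: compose_eq alg_hom_closed[OF hom])
  have \<phi>: "str (cm K A L') \<in> alg_hom K (env_alg K A) (cm K A L')" using L'.cm_b_ring by (simp add: is_b_ring_def)
  \<comment> \<open>f preserves anchors, so f x acts on Ae by the same derivation as x, and the
    commutation rule for L' takes the form required for L.\<close>
  have comm: "?\<rho> (uea_gen K L x) \<otimes>\<^bsub>cm K A L'\<^esub> str (cm K A L') y =
      str (cm K A L') (der_tensor K A (anchor L x) y) \<oplus>\<^bsub>cm K A L'\<^esub> str (cm K A L') y \<otimes>\<^bsub>cm K A L'\<^esub> ?\<rho> (uea_gen K L x)"
    if x: "x \<in> carrier L" and y: "y \<in> carrier (env_alg K A)" for x y
    using L'.cm_commute[OF fc[OF x] y] x by (simp add: \<rho>u spec fa L'.cm_simps(2,5))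
  obtain g where g: "g \<in> alg_hom K (cm K A L) (cm K A L')"
    "\<And>y. y \<in> carrier (env_alg K A) \<Longrightarrow> g (str (cm K A L) y) = str (cm K A L') y"
    "\<And>a u b. a \<in> carrier A \<Longrightarrow> u \<in> carrier (uea K L) \<Longrightarrow> b \<in> carrier A \<Longrightarrow>
      g (cm_pure K A L a u b) = str (cm K A L') (pure_tensor K A (opp_alg A) a b) \<otimes>\<^bsub>cm K A L'\<^esub> ?\<rho> u"
    using L.cm_lift[OF L'.cm_assoc_algebra \<phi> \<rho> comm] by blast
  have gp: "g (cm_pure K A L a u b) = cm_pure K A L' a (uea_map K L L' f u) b"
    if "a \<in> carrier A" "u \<in> carrier (uea K L)" "b \<in> carrier A" for a u b
    using that L'.cm_pure_factor[OF that(1) alg_hom_closed[OF hom that(2)] that(3)]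
    by (simp add: g(3) \<rho>u L'.cm_simps(5))
  have "g \<in> lin_hom K (cm_space K A L) (cm_space K A L')"
    using g(1) by (simp add: alg_hom_iff lin_hom_iff linear_map_def L.cm_simps L'.cm_simps)
  then have "cm_map K A L L' f = g"
    unfolding cm_map_def by (rule L.W_lift_eq) (rule gp)
  with g(1,2) gp show ?thesis by (simp add: b_ring_hom_def)
qed

text \<open>Functoriality of U(L), tested on generators, enters in the middle factor; the outer
  factors are left untouched by all three maps.\<close>

lemma cm_map_compose:
  assumes A: "assoc_algebra K A" and L: "is_anch_lie K A L" and L': "is_anch_lie K A L'" and L'': "is_anch_lie K A L''"
    and f: "f \<in> anch_hom K L L'" and f': "f' \<in> anch_hom K L' L''"
  shows "cm_map K A L L'' (compose (carrier L) f' f) =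
    compose (carrier (cm K A L)) (cm_map K A L' L'' f') (cm_map K A L L' f)"
proof -
  interpret L: anchored K A L by (rule anchored.intro[OF A L])
  interpret L': anchored K A L' by (rule anchored.intro[OF A L'])
  interpret L'': anchored K A L'' by (rule anchored.intro[OF A L''])
  note ff = anch_hom_compose[OF L.lie f f']
  note s = cm_map_spec[OF A L L' f] and s' = cm_map_spec[OF A L' L'' f'] and s'' = cm_map_spec[OF A L L'' ff]
  have fl: "f \<in> lie_hom K L L'" "f' \<in> lie_hom K L' L''" "compose (carrier L) f' f \<in> lie_hom K L L''"
    using f f' ff by (simp_all add: anch_hom_def)
  note u = uea_map_spec[OF L.lie L'.lie fl(1)] and u' = uea_map_spec[OF L'.lie L''.lie fl(2)]
    and u'' = uea_map_spec[OF L.lie L''.lie fl(3)]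
  have fc: "f x \<in> carrier L'" if "x \<in> carrier L" for x
    using fl(1) that by (rule lie_hom_closed)
  have "uea_map K L L'' (compose (carrier L) f' f) =
      compose (carrier (uea K L)) (uea_map K L' L'' f') (uea_map K L L' f)"
    by (rule uea_alg_hom_eq[OF L.lie conjunct1[OF u'']
          alg_hom_compose[OF L.U.assoc_algebra_axioms conjunct1[OF u] conjunct1[OF u']]])
      (simp add: u u' u'' compose_eq fc)
  then have uc: "uea_map K L L'' (compose (carrier L) f' f) v = uea_map K L' L'' f' (uea_map K L L' f v)"
    if "v \<in> carrier (uea K L)" for v
    using that by (simp add: compose_eq)
  have h: "cm_map K A L L' f \<in> alg_hom K (cm K A L) (cm K A L')" "cm_map K A L' L'' f' \<in> alg_hom K (cm K A L') (cm K A L'')"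
    "cm_map K A L L'' (compose (carrier L) f' f) \<in> alg_hom K (cm K A L) (cm K A L'')"
    using s s' s'' by (simp_all add: b_ring_hom_def)
  note hc = alg_hom_compose[OF L.cm_assoc_algebra h(1,2)]
  show ?thesis
  proof (rule extensionalityI[OF alg_hom_extensional[OF h(3)] alg_hom_extensional[OF hc]])
    fix t assume "t \<in> carrier (cm K A L)"
    then have t: "t \<in> carrier (cm_space K A L)" by (simp add: L.cm_simps)
    have lin: "linear_map K (cm_space K A L) (cm K A L'') (cm_map K A L L'' (compose (carrier L) f' f))"
      "linear_map K (cm_space K A L) (cm K A L'') (compose (carrier (cm K A L)) (cm_map K A L' L'' f') (cm_map K A L L' f))"
      using alg_hom_linear[OF h(3)] alg_hom_linear[OF hc] by (simp_all add: linear_map_def L.cm_simps)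
    show "cm_map K A L L'' (compose (carrier L) f' f) t =
        compose (carrier (cm K A L)) (cm_map K A L' L'' f') (cm_map K A L L' f) t"
      by (rule L.W_linear_eq[OF lin _ t])
        (simp add: s s' s'' compose_eq L.cm_simps(1) L.cm_pure_closed uc alg_hom_closed[OF conjunct1[OF u]])
  qed
qed

text \<open>A transpose sees only the elements 1 \<otimes> x \<otimes> 1, and \<open>cm_map\<close>
  sends such an element to the one for f x. The two derivation components agree because f preserves
  anchors.\<close>

lemma cm_transpose_natural_left:
  assumes A: "assoc_algebra K A" and L: "is_anch_lie K A L" and L': "is_anch_lie K A L'" and f: "f \<in> anch_hom K L L'"
  shows "cm_transpose K A L (compose (carrier (cm K A L)) g (cm_map K A L L' f)) =
    compose (carrier L) (cm_transpose K A L' g) f"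
proof -
  interpret L: anchored K A L by (rule anchored.intro[OF A L])
  interpret L': anchored K A L' by (rule anchored.intro[OF A L'])
  have fl: "f \<in> lie_hom K L L'" and fa: "\<And>x. x \<in> carrier L \<Longrightarrow> anchor L' (f x) = anchor L x"
    using f by (auto simp: anch_hom_def)
  have fc: "f x \<in> carrier L'" if "x \<in> carrier L" for x
    using fl that by (rule lie_hom_closed)
  show ?thesis
  proof (rule extensionalityI[OF L.cm_transpose_extensional compose_extensional])
    fix x assume "x \<in> carrier L"
    then show "cm_transpose K A L (compose (carrier (cm K A L)) g (cm_map K A L L' f)) x =
        compose (carrier L) (cm_transpose K A L' g) f x"
      by (simp add: L.cm_transpose_apply L'.cm_transpose_apply compose_eq L.cm_simps(1) L.cm_pure_closed
          cm_map_spec[OF A L L' f] uea_map_spec[OF L.lie L'.lie fl] fa fc)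
  qed
qed

lemma cm_transpose_natural_right:
  assumes A: "assoc_algebra K A" and L: "is_anch_lie K A L" and R: "is_b_ring K (env_alg K A) R"
    and g: "g \<in> b_ring_hom K (env_alg K A) (cm K A L) R"
  shows "cm_transpose K A L (compose (carrier (cm K A L)) h g) = compose (carrier L) (LA_map K A R h) (cm_transpose K A L g)"
proof -
  interpret L: anchored K A L by (rule anchored.intro[OF A L])
  show ?thesis
  proof (rule extensionalityI[OF L.cm_transpose_extensional compose_extensional])
    fix x assume x: "x \<in> carrier L"
    \<comment> \<open>\<open>LA_map\<close> is a restricted function and can be evaluated only
      inside the carrier; that the transpose takes values there is read off from its being a map
      between the hom-sets.\<close>
    have "cm_transpose K A L g \<in> lie_hom K L (LA K A R)"
      using bij_betwE[OF L.cm_transpose_bij[OF R]] g by (simp add: anch_hom_def)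
    then have "cm_transpose K A L g x \<in> carrier (LA K A R)" using x by (rule lie_hom_closed)
    with x show "cm_transpose K A L (compose (carrier (cm K A L)) h g) x =
        compose (carrier L) (LA_map K A R h) (cm_transpose K A L g) x"
      by (simp add: L.cm_transpose_apply compose_eq L.cm_simps(1) L.cm_pure_closed LA_map_apply[OF A])
  qed
qed

theorem theorem2p8:
  fixes K :: "('k, 'kk) ring_scheme"
    and A :: "('k, 'a, 'aa) module_scheme"
  assumes "field K" and "char_zero K" and "assoc_algebra K A"
  shows
    "\<comment> \<open>the isomorphism of rings over the enveloping algebra of A\<close>
     (\<forall>L :: ('k, 'l, 'a) anch_lie. is_anch_lie K A L \<longrightarrow>
       is_b_ring K (env_alg K A) (smash K A L) \<and>
       is_b_ring K (env_alg K A) (cm K A L) \<and>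
       (\<forall>a \<in> carrier A. \<forall>b \<in> carrier A. \<forall>u \<in> carrier (uea K L).
          smash_to_cm K A L (smash_pure K A L (pure_tensor K A (opp_alg A) a b) u) = cm_pure K A L a u b) \<and>
       smash_to_cm K A L \<in> b_ring_iso K (env_alg K A) (smash K A L) (cm K A L)) \<and>
     \<comment> \<open>the Connes-Moscovici construction is a functor\<close>
     (\<forall>(L :: ('k, 'l, 'a) anch_lie) (L' :: ('k, 'l2, 'a) anch_lie).
       is_anch_lie K A L \<and> is_anch_lie K A L' \<longrightarrow>
       (\<forall>f \<in> anch_hom K L L'.
          cm_map K A L L' f \<in> b_ring_hom K (env_alg K A) (cm K A L) (cm K A L'))) \<and>
     (\<forall>L :: ('k, 'l, 'a) anch_lie. is_anch_lie K A L \<longrightarrow>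
       cm_map K A L L (\<lambda>x\<in>carrier L. x) = (\<lambda>x\<in>carrier (cm K A L). x)) \<and>
     (\<forall>(L :: ('k, 'l, 'a) anch_lie) (L' :: ('k, 'l2, 'a) anch_lie) (L'' :: ('k, 'l3, 'a) anch_lie).
       is_anch_lie K A L \<and> is_anch_lie K A L' \<and> is_anch_lie K A L'' \<longrightarrow>
       (\<forall>f \<in> anch_hom K L L'. \<forall>f' \<in> anch_hom K L' L''.
          cm_map K A L L'' (compose (carrier L) f' f) =
          compose (carrier (cm K A L)) (cm_map K A L' L'' f') (cm_map K A L L' f))) \<and>
     \<comment> \<open>LA is a functor\<close>
     (\<forall>R :: ('k, 'r, ('k, 'a, 'a) tens) b_ring. is_b_ring K (env_alg K A) R \<longrightarrow>
       is_anch_lie K A (LA K A R) \<and>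
       LA_map K A R (\<lambda>x\<in>carrier R. x) = (\<lambda>x\<in>carrier (LA K A R). x)) \<and>
     (\<forall>(R :: ('k, 'r, ('k, 'a, 'a) tens) b_ring) (R' :: ('k, 'r2, ('k, 'a, 'a) tens) b_ring).
       is_b_ring K (env_alg K A) R \<and> is_b_ring K (env_alg K A) R' \<longrightarrow>
       (\<forall>h \<in> b_ring_hom K (env_alg K A) R R'.
          LA_map K A R h \<in> anch_hom K (LA K A R) (LA K A R'))) \<and>
     (\<forall>(R :: ('k, 'r, ('k, 'a, 'a) tens) b_ring) (R' :: ('k, 'r2, ('k, 'a, 'a) tens) b_ring)
       (R'' :: ('k, 'r3, ('k, 'a, 'a) tens) b_ring).
       is_b_ring K (env_alg K A) R \<and> is_b_ring K (env_alg K A) R' \<and> is_b_ring K (env_alg K A) R'' \<longrightarrow>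
       (\<forall>h \<in> b_ring_hom K (env_alg K A) R R'. \<forall>h' \<in> b_ring_hom K (env_alg K A) R' R''.
          LA_map K A R (compose (carrier R) h' h) =
          compose (carrier (LA K A R)) (LA_map K A R' h') (LA_map K A R h))) \<and>
     \<comment> \<open>the hom-set bijection, and its naturality in either variable\<close>
     (\<forall>(L :: ('k, 'l, 'a) anch_lie) (R :: ('k, 'r, ('k, 'a, 'a) tens) b_ring).
       is_anch_lie K A L \<and> is_b_ring K (env_alg K A) R \<longrightarrow>
       bij_betw (cm_transpose K A L)
         (b_ring_hom K (env_alg K A) (cm K A L) R) (anch_hom K L (LA K A R))) \<and>
     (\<forall>(L :: ('k, 'l, 'a) anch_lie) (L' :: ('k, 'l2, 'a) anch_lie)
       (R :: ('k, 'r, ('k, 'a, 'a) tens) b_ring).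
       is_anch_lie K A L \<and> is_anch_lie K A L' \<and> is_b_ring K (env_alg K A) R \<longrightarrow>
       (\<forall>f \<in> anch_hom K L L'. \<forall>g \<in> b_ring_hom K (env_alg K A) (cm K A L') R.
          cm_transpose K A L (compose (carrier (cm K A L)) g (cm_map K A L L' f)) =
          compose (carrier L) (cm_transpose K A L' g) f)) \<and>
     (\<forall>(L :: ('k, 'l, 'a) anch_lie) (R :: ('k, 'r, ('k, 'a, 'a) tens) b_ring)
       (R' :: ('k, 'r2, ('k, 'a, 'a) tens) b_ring).
       is_anch_lie K A L \<and> is_b_ring K (env_alg K A) R \<and> is_b_ring K (env_alg K A) R' \<longrightarrow>
       (\<forall>h \<in> b_ring_hom K (env_alg K A) R R'. \<forall>g \<in> b_ring_hom K (env_alg K A) (cm K A L) R.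
          cm_transpose K A L (compose (carrier (cm K A L)) h g) =
          compose (carrier L) (LA_map K A R h) (cm_transpose K A L g)))"
proof (intro conjI allI impI ballI)
  note A = assms(3)
  {
    fix L :: "('k, 'l, 'a) anch_lie"
    assume L: "is_anch_lie K A L"
    interpret anchored K A L by (rule anchored.intro[OF A L])
    show "is_b_ring K (env_alg K A) (smash K A L)" by (rule smash_b_ring)
    show "is_b_ring K (env_alg K A) (cm K A L)" by (rule cm_b_ring)
    show "smash_to_cm K A L \<in> b_ring_iso K (env_alg K A) (smash K A L) (cm K A L)" by (rule smash_to_cm_iso)
    show "cm_map K A L L (\<lambda>x\<in>carrier L. x) = (\<lambda>x\<in>carrier (cm K A L). x)" by (rule cm_map_id)
    fix a b u assume "a \<in> carrier A" "b \<in> carrier A" "u \<in> carrier (uea K L)"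
    then show "smash_to_cm K A L (smash_pure K A L (pure_tensor K A (opp_alg A) a b) u) = cm_pure K A L a u b"
      by (rule smash_to_cm_pure)
  }
  {
    fix L :: "('k, 'l, 'a) anch_lie" and L' :: "('k, 'l2, 'a) anch_lie" and f
    assume "is_anch_lie K A L \<and> is_anch_lie K A L'" "f \<in> anch_hom K L L'"
    then show "cm_map K A L L' f \<in> b_ring_hom K (env_alg K A) (cm K A L) (cm K A L')"
      using cm_map_spec[OF A, of L L' f] by simp
  }
  {
    fix L :: "('k, 'l, 'a) anch_lie" and L' :: "('k, 'l2, 'a) anch_lie" and L'' :: "('k, 'l3, 'a) anch_lie" and f f'
    assume "is_anch_lie K A L \<and> is_anch_lie K A L' \<and> is_anch_lie K A L''" "f \<in> anch_hom K L L'" "f' \<in> anch_hom K L' L''"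
    then show "cm_map K A L L'' (compose (carrier L) f' f) =
        compose (carrier (cm K A L)) (cm_map K A L' L'' f') (cm_map K A L L' f)"
      by (intro cm_map_compose[OF A]) simp_all
  }
  {
    fix R :: "('k, 'r, ('k, 'a, 'a) tens) b_ring"
    assume R: "is_b_ring K (env_alg K A) R"
    show "is_anch_lie K A (LA K A R)" by (rule LA_anch_lie[OF A R])
    show "LA_map K A R (\<lambda>x\<in>carrier R. x) = (\<lambda>x\<in>carrier (LA K A R). x)" by (rule LA_map_id[OF A])
  }
  {
    fix R :: "('k, 'r, ('k, 'a, 'a) tens) b_ring" and R' :: "('k, 'r2, ('k, 'a, 'a) tens) b_ring" and h
    assume "is_b_ring K (env_alg K A) R \<and> is_b_ring K (env_alg K A) R'" "h \<in> b_ring_hom K (env_alg K A) R R'"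
    then show "LA_map K A R h \<in> anch_hom K (LA K A R) (LA K A R')"
      by (intro LA_map_hom[OF A]) simp_all
  }
  {
    fix R :: "('k, 'r, ('k, 'a, 'a) tens) b_ring" and R' :: "('k, 'r2, ('k, 'a, 'a) tens) b_ring"
      and R'' :: "('k, 'r3, ('k, 'a, 'a) tens) b_ring" and h h'
    assume "is_b_ring K (env_alg K A) R \<and> is_b_ring K (env_alg K A) R' \<and> is_b_ring K (env_alg K A) R''"
      "h \<in> b_ring_hom K (env_alg K A) R R'" "h' \<in> b_ring_hom K (env_alg K A) R' R''"
    then show "LA_map K A R (compose (carrier R) h' h) =
        compose (carrier (LA K A R)) (LA_map K A R' h') (LA_map K A R h)"
      by (intro LA_map_compose[OF A]) simp_all
  }
  {
    fix L :: "('k, 'l, 'a) anch_lie" and R :: "('k, 'r, ('k, 'a, 'a) tens) b_ring"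
    assume "is_anch_lie K A L \<and> is_b_ring K (env_alg K A) R"
    then show "bij_betw (cm_transpose K A L) (b_ring_hom K (env_alg K A) (cm K A L) R) (anch_hom K L (LA K A R))"
      using anchored.cm_transpose_bij[OF anchored.intro[OF A], of L R] by simp
  }
  {
    fix L :: "('k, 'l, 'a) anch_lie" and L' :: "('k, 'l2, 'a) anch_lie"
      and R :: "('k, 'r, ('k, 'a, 'a) tens) b_ring" and f g
    assume "is_anch_lie K A L \<and> is_anch_lie K A L' \<and> is_b_ring K (env_alg K A) R" "f \<in> anch_hom K L L'"
      "g \<in> b_ring_hom K (env_alg K A) (cm K A L') R"
    then show "cm_transpose K A L (compose (carrier (cm K A L)) g (cm_map K A L L' f)) =
        compose (carrier L) (cm_transpose K A L' g) f"
      by (intro cm_transpose_natural_left[OF A]) simp_all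
  }
  {
    fix L :: "('k, 'l, 'a) anch_lie" and R :: "('k, 'r, ('k, 'a, 'a) tens) b_ring"
      and R' :: "('k, 'r2, ('k, 'a, 'a) tens) b_ring" and h g
    assume "is_anch_lie K A L \<and> is_b_ring K (env_alg K A) R \<and> is_b_ring K (env_alg K A) R'"
      "h \<in> b_ring_hom K (env_alg K A) R R'" "g \<in> b_ring_hom K (env_alg K A) (cm K A L) R"
    then show "cm_transpose K A L (compose (carrier (cm K A L)) h g) =
        compose (carrier L) (LA_map K A R h) (cm_transpose K A L g)"
      by (intro cm_transpose_natural_right[OF A]) simp_all
  }
qed

end
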